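(* Let $s\in\mathbb{R}$ and let $\sigma\in V_{1,0}^s$. Then there exists a symbol $\sigma^*\in V_{1,0}^s$ such that $(T_\sigma)^*=T_{\sigma^*}$. Moreover, $\sigma^*$ has the asymptotic expansion $$\sigma^*(x,\xi)=\sum_{\alpha}\frac{i^{-|\alpha|}}{\alpha!}\,\partial_x^\alpha\partial_\xi^\alpha\sigma(x,-\xi),$$ in the sense that, for every $N\in\mathbb{N}$, $$\sigma^*(x,\xi)-\sum_{|\alpha|<N}\frac{i^{-|\alpha|}}{\alpha!}\,\partial_x^\alpha\partial_\xi^\alpha\sigma(x,-\xi)\in V_{1,0}^{s-N}.$$ Here $\alpha$ runs over multi-indices in $(\mathbb{N}\cup\{0\})^d$, and $\partial_x^\alpha\partial_\xi^\alpha\sigma(x,-\xi)$ denotes the derivative $\partial_x^\alpha\partial_\xi^\alpha$ of the function $(x,\xi)\mapsto\sigma(x,-\xi)$.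
   Context: For $s\in\mathbb{R}$, a smooth function (symbol) $\sigma:\mathbb{R}^d\times\mathbb{R}^d\to\mathbb{C}$ belongs to the class $V_{1,0}^s$ if for all multi-indices $\alpha,\beta$ there is a bounded function $K_{\alpha,\beta}(x,\xi)$ on $\mathbb{R}^d\times\mathbb{R}^d$ with $\lim_{|x|+|\xi|\to\infty}K_{\alpha,\beta}(x,\xi)=0$ such that $$|\partial_x^\alpha\partial_\xi^\beta\sigma(x,\xi)|\le K_{\alpha,\beta}(x,\xi)(1+|\xi|)^{s-|\beta|}\quad\text{for all }x,\xi\in\mathbb{R}^d.$$ The pseudodifferential operator $T_\sigma$ with symbol $\sigma$ is defined, a priori from $\mathcal{S}(\mathbb{R}^d)$ to $\mathcal{S}'(\mathbb{R}^d)$, by $$T_\sigma(f)(x)=\int_{\mathbb{R}^d}\sigma(x,\xi)\widehat f(\xi)e^{ix\cdot\xi}\,d\xi,\qquad \widehat f(\xi)=\int_{\mathbb{R}^d}f(y)e^{-iy\cdot\xi}\,dy.$$ $(T_\sigma)^*$ denotes the transpose of $T_\sigma$, i.e. $\langle T_\sigma(f),g\rangle=\langle f,(T_\sigma)^*(g)\rangle$ for all $f,g\in\mathcal{S}(\mathbb{R}^d)$, where $\langle\cdot,\cdot\rangle$ is the bilinear pairing given by $\langle f,g\rangle=\int_{\mathbb{R}^d}f(x)g(x)\,dx$ (no complex conjugation). *)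

theory Defs
  imports "HOL-Analysis.Analysis"
begin

definition dderiv :: "'a::real_normed_vector \<Rightarrow> ('a \<Rightarrow> complex) \<Rightarrow> 'a \<Rightarrow> complex" where
  "dderiv v f = (\<lambda>z. frechet_derivative f (at z) v)"

primrec times_diff :: "nat \<Rightarrow> ('a::real_normed_vector \<Rightarrow> complex) \<Rightarrow> bool" where
  "times_diff 0 f \<longleftrightarrow> continuous_on UNIV f"
| "times_diff (Suc n) f \<longleftrightarrow> (\<forall>z. f differentiable at z) \<and> (\<forall>v. times_diff n (dderiv v f))"

definition smooth :: "('a::real_normed_vector \<Rightarrow> complex) \<Rightarrow> bool" where
  "smooth f \<longleftrightarrow> (\<forall>n. times_diff n f)"

text \<open>Multi-indices of length $d$ are functions \<open>'d \<Rightarrow> nat\<close>, where $d$ is the cardinality of \<open>'d\<close>.\<close>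

definition mi_size :: "('d::finite \<Rightarrow> nat) \<Rightarrow> nat" where
  "mi_size \<alpha> = (\<Sum>i\<in>UNIV. \<alpha> i)"

definition mi_fact :: "('d::finite \<Rightarrow> nat) \<Rightarrow> nat" where
  "mi_fact \<alpha> = (\<Prod>i\<in>UNIV. fact (\<alpha> i))"

definition mi_power :: "real ^ 'd \<Rightarrow> ('d::finite \<Rightarrow> nat) \<Rightarrow> real" where
  "mi_power x \<alpha> = (\<Prod>i\<in>UNIV. (x $ i) ^ \<alpha> i)"

lemma finite_mi_size_less: "finite {\<alpha> :: 'd::finite \<Rightarrow> nat. mi_size \<alpha> < N}"
proof (rule finite_subset)
  show "{\<alpha> :: 'd \<Rightarrow> nat. mi_size \<alpha> < N} \<subseteq> PiE UNIV (\<lambda>_. {..<N})"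
  proof
    fix \<alpha> :: "'d \<Rightarrow> nat" assume "\<alpha> \<in> {\<alpha>. mi_size \<alpha> < N}"
    then have "\<alpha> i < N" for i
      using member_le_sum[of i UNIV \<alpha>] by (simp add: mi_size_def)
    then show "\<alpha> \<in> PiE UNIV (\<lambda>_. {..<N})" by auto
  qed
qed (simp add: finite_PiE)

text \<open>The index type carries no order, so the iterated partial derivatives are taken along an
  arbitrary fixed enumeration of it; for smooth functions the order is irrelevant.\<close>

definition index_list :: "'d::finite list" where
  "index_list = (SOME is. distinct is \<and> set is = UNIV)"

definition mderiv ::
  "('d::finite \<Rightarrow> 'a::real_normed_vector) \<Rightarrow> ('d \<Rightarrow> nat) \<Rightarrow> ('a \<Rightarrow> complex) \<Rightarrow> 'a \<Rightarrow> complex" where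
  "mderiv e \<alpha> f = fold (\<lambda>i. dderiv (e i) ^^ \<alpha> i) index_list f"

definition Dx :: "('d::finite \<Rightarrow> nat) \<Rightarrow>
    ((real ^ 'd) \<times> (real ^ 'd) \<Rightarrow> complex) \<Rightarrow> (real ^ 'd) \<times> (real ^ 'd) \<Rightarrow> complex" where
  "Dx = mderiv (\<lambda>i. (axis i 1, 0))"

definition Dxi :: "('d::finite \<Rightarrow> nat) \<Rightarrow>
    ((real ^ 'd) \<times> (real ^ 'd) \<Rightarrow> complex) \<Rightarrow> (real ^ 'd) \<times> (real ^ 'd) \<Rightarrow> complex" where
  "Dxi = mderiv (\<lambda>i. (0, axis i 1))"

text \<open>The class $V^s_{1,0}$. The norm on the product space is equivalent to $|x| + |\xi|$, so
  \<open>at_infinity\<close> is the filter $|x| + |\xi| \to \infty$.\<close>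

definition symbol_V :: "real \<Rightarrow> ((real ^ 'd::finite) \<times> (real ^ 'd) \<Rightarrow> complex) set" where
  "symbol_V s = {\<sigma>. smooth \<sigma> \<and>
     (\<forall>\<alpha> \<beta>. \<exists>K :: (real ^ 'd) \<times> (real ^ 'd) \<Rightarrow> real.
        bounded (range K) \<and> (K \<longlongrightarrow> 0) at_infinity \<and>
        (\<forall>x \<xi>. norm (Dx \<alpha> (Dxi \<beta> \<sigma>) (x, \<xi>))
                  \<le> K (x, \<xi>) * (1 + norm \<xi>) powr (s - real (mi_size \<beta>))))}"

definition schwartz :: "(real ^ 'd::finite \<Rightarrow> complex) set" where
  "schwartz = {f. smooth f \<and>
     (\<forall>\<alpha> \<beta>. bounded (range (\<lambda>x. mi_power x \<alpha> *\<^sub>R mderiv (\<lambda>i. axis i 1) \<beta> f x)))}"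

definition fourier :: "(real ^ 'd::finite \<Rightarrow> complex) \<Rightarrow> real ^ 'd \<Rightarrow> complex" where
  "fourier f \<xi> = (LINT y|lborel. f y * exp (- (\<i> * of_real (y \<bullet> \<xi>))))"

definition pseudo_op ::
  "((real ^ 'd::finite) \<times> (real ^ 'd) \<Rightarrow> complex) \<Rightarrow> (real ^ 'd \<Rightarrow> complex) \<Rightarrow> real ^ 'd \<Rightarrow> complex" where
  "pseudo_op \<sigma> f x = (LINT \<xi>|lborel. \<sigma> (x, \<xi>) * fourier f \<xi> * exp (\<i> * of_real (x \<bullet> \<xi>)))"

definition pairing :: "(real ^ 'd::finite \<Rightarrow> complex) \<Rightarrow> (real ^ 'd \<Rightarrow> complex) \<Rightarrow> complex" where
  "pairing f g = (LINT x|lborel. f x * g x)"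

definition is_transpose ::
  "((real ^ 'd::finite \<Rightarrow> complex) \<Rightarrow> real ^ 'd \<Rightarrow> complex) \<Rightarrow>
   ((real ^ 'd \<Rightarrow> complex) \<Rightarrow> real ^ 'd \<Rightarrow> complex) \<Rightarrow> bool" where
  "is_transpose T T' \<longleftrightarrow>
     (\<forall>f\<in>schwartz. \<forall>g\<in>schwartz. pairing (T f) g = pairing f (T' g))"

end

theory Submission
  imports Defs "HOL-Probability.Sinc_Integral" "HOL-Probability.Characteristic_Functions"
begin

text \<open>The decay in the class \<open>V\<close> is not uniform under translation: however far
  out \<open>q\<close> is, \<open>a (q + p)\<close> takes its large values at \<open>p\<close> near
  \<open>- q\<close>. The remedy is that \<open>Lam\<close> tolerates every polynomial growth. One
  extra power of \<open>1 + norm p\<close> pays for the points \<open>p\<close> of size comparable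
  to \<open>q\<close>, and small weighted norms make \<open>Lam\<close> small whatever the weight.
  For the same reason \<open>growth\<close> records no gain from differentiation: integration by
  parts takes its decay from \<open>japanese\<close>, not from the amplitude, and the improvement in
  the covariable enters through the Taylor remainder alone. Moreover \<open>transp_symbol\<close>
  and the terms of the expansion commute with derivatives, so a bound on the remainder without
  derivatives, valid for symbols of every order, already contains the full symbol estimate. The
  operators carry no factor (2 pi)^(-d); it would be the same on both sides of the transpose
  relation. The analysis takes place on the square of an abstract Euclidean space, with recursions
  over basis vectors; multi-indices come in only at the end.\<close>

text \<open>
  Put \<open>a (x, \<xi>) = \<sigma> (x, - \<xi>)\<close>. The transposed symbol is \<open>exp (- i \<partial>\<^sub>x \<cdot> \<partial>\<^sub>\<xi>) a\<close>, that is, the value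
  at \<open>q\<close> is \<open>\<Lambda> (a (q + \<cdot>))\<close>, where \<open>\<Lambda> b\<close> is the oscillatory integral of \<open>exp (- i z \<cdot> \<zeta>) b (z, \<zeta>)\<close>,
  normalised and regularised by a Gaussian cutoff. Integration by parts bounds \<open>\<Lambda>\<close> on symbols of
  polynomial growth by finitely many weighted sup norms, so that all statements about \<open>\<Lambda>\<close> reduce
  to norm estimates. In particular \<open>\<Lambda> (\<zeta>\<^sub>j b) = - i \<Lambda> (\<partial> b / \<partial> z\<^sub>j)\<close>, and \<open>\<Lambda>\<close> is evaluation at the
  origin on functions of \<open>z\<close> alone. Applied to the Taylor expansion of \<open>b\<close> in \<open>\<zeta>\<close>, this produces the
  terms of the asymptotic series, and the weighted norms of the Taylor remainder of \<open>a (q + \<cdot>)\<close> are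
  \<open>o ((1 + |\<xi>|) powr (s - N))\<close> as \<open>q = (x, \<xi>)\<close> tends to infinity. The transpose relation follows from
  Fubini's theorem and Fourier inversion for rapidly decreasing \<open>a\<close>, and in general by removing the
  cutoff with dominated convergence.
\<close>

section \<open>Directional derivatives\<close>

lemma dderiv_eqI: "(f has_derivative f') (at p) \<Longrightarrow> dderiv v f p = f' v"
  by (metis dderiv_def frechet_derivative_at)

lemma has_derivative_dderiv:
  "f differentiable at p \<Longrightarrow> (f has_derivative (\<lambda>v. dderiv v f p)) (at p)"
  by (simp add: dderiv_def frechet_derivative_works)

lemma dderiv_scaleR:
  assumes "f differentiable at p"
  shows "dderiv (c *\<^sub>R v) f p = of_real c * dderiv v f p"
  using linear_simps(5)[OF has_derivative_bounded_linear[OF has_derivative_dderiv[OF assms]], of c v]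
  by (simp add: scaleR_conv_of_real)

lemma dderiv_Basis:
  fixes f :: "'a::euclidean_space \<Rightarrow> complex"
  assumes "f differentiable at p"
  shows "dderiv v f p = (\<Sum>b\<in>Basis. of_real (v \<bullet> b) * dderiv b f p)"
proof -
  interpret bounded_linear "\<lambda>v. dderiv v f p"
    using has_derivative_dderiv[OF assms] by (rule has_derivative_bounded_linear)
  have "dderiv v f p = dderiv (\<Sum>b\<in>Basis. (v \<bullet> b) *\<^sub>R b) f p"
    by (simp add: euclidean_representation)
  also have "\<dots> = (\<Sum>b\<in>Basis. of_real (v \<bullet> b) * dderiv b f p)"
    by (simp only: sum scale) (simp add: scaleR_conv_of_real)
  finally show ?thesis .
qed

lemma dderiv_add:
  assumes "\<And>p. f differentiable at p" "\<And>p. g differentiable at p"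
  shows "dderiv v (\<lambda>p. f p + g p) = (\<lambda>p. dderiv v f p + dderiv v g p)"
  by (intro ext dderiv_eqI has_derivative_add has_derivative_dderiv assms)

lemma dderiv_diff:
  assumes "\<And>p. f differentiable at p" "\<And>p. g differentiable at p"
  shows "dderiv v (\<lambda>p. f p - g p) = (\<lambda>p. dderiv v f p - dderiv v g p)"
  by (intro ext dderiv_eqI has_derivative_diff has_derivative_dderiv assms)

lemma dderiv_mult:
  assumes "\<And>p. f differentiable at p" "\<And>p. g differentiable at p"
  shows "dderiv v (\<lambda>p. f p * g p) = (\<lambda>p. f p * dderiv v g p + dderiv v f p * g p)"
  by (intro ext dderiv_eqI has_derivative_mult has_derivative_dderiv assms)

lemma dderiv_const [simp]: "dderiv v (\<lambda>p. c) = (\<lambda>p. 0)"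
  by (intro ext dderiv_eqI[where f' = "\<lambda>_. 0"] has_derivative_const)

lemma dderiv_cmult:
  assumes "\<And>p. f differentiable at p"
  shows "dderiv v (\<lambda>p. c * f p) = (\<lambda>p. c * dderiv v f p)"
  using dderiv_mult[of "\<lambda>_. c" f v] assms by simp

lemma dderiv_sum:
  assumes "\<And>i p. i \<in> I \<Longrightarrow> f i differentiable at p"
  shows "dderiv v (\<lambda>p. \<Sum>i\<in>I. f i p) = (\<lambda>p. \<Sum>i\<in>I. dderiv v (f i) p)"
  by (intro ext dderiv_eqI has_derivative_sum has_derivative_dderiv assms)

lemma has_derivative_affine_comp:
  assumes "bounded_linear A" "\<And>p. f differentiable at p"
  shows "((\<lambda>p. f (c + A p)) has_derivative (\<lambda>v. dderiv (A v) f (c + A p))) (at p)"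
proof -
  have "((\<lambda>p. c + A p) has_derivative A) (at p)"
    by (auto intro!: derivative_eq_intros bounded_linear_imp_has_derivative assms)
  from has_derivative_compose[OF this has_derivative_dderiv[OF assms(2)]] show ?thesis .
qed

lemma dderiv_affine_comp:
  assumes "bounded_linear A" "\<And>p. f differentiable at p"
  shows "dderiv v (\<lambda>p. f (c + A p)) = (\<lambda>p. dderiv (A v) f (c + A p))"
  by (intro ext dderiv_eqI has_derivative_affine_comp assms)

lemma dderiv_translate:
  assumes "\<And>p. f differentiable at p"
  shows "dderiv v (\<lambda>p. f (c + p)) = (\<lambda>p. dderiv v f (c + p))"
  using dderiv_affine_comp[OF bounded_linear_ident assms, of v c] .

section \<open>Iterated differentiability and smooth functions\<close>

lemma times_diff_cont: "times_diff n f \<Longrightarrow> continuous_on UNIV f"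
  by (cases n) (auto intro!: continuous_at_imp_continuous_on differentiable_imp_continuous_within)

lemma times_diff_Suc: "times_diff (Suc n) f \<Longrightarrow> times_diff n f"
proof (induction n arbitrary: f)
  case 0
  then show ?case using times_diff_cont[of 1 f] by simp
qed auto

lemma times_diff_const [simp]: "times_diff n (\<lambda>_. c)"
  by (induction n arbitrary: c) auto

lemma times_diff_add:
  "times_diff n f \<Longrightarrow> times_diff n g \<Longrightarrow> times_diff n (\<lambda>p. f p + g p)"
proof (induction n arbitrary: f g)
  case (Suc n)
  then have "dderiv v (\<lambda>p. f p + g p) = (\<lambda>p. dderiv v f p + dderiv v g p)" for v
    by (intro dderiv_add) simp_all
  moreover have "(\<lambda>p. f p + g p) differentiable at z" for z
    using Suc.prems by (intro differentiable_add) simp_all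
  moreover have "times_diff n (\<lambda>p. dderiv v f p + dderiv v g p)" for v
    using Suc.prems by (intro Suc.IH) simp_all
  ultimately show ?case by simp
next
  case 0
  then show ?case unfolding times_diff.simps by (rule continuous_on_add)
qed

lemma times_diff_mult:
  "times_diff n f \<Longrightarrow> times_diff n g \<Longrightarrow> times_diff n (\<lambda>p. f p * g p)"
proof (induction n arbitrary: f g)
  case (Suc n)
  then show ?case
    using times_diff_Suc[OF Suc.prems(1)] times_diff_Suc[OF Suc.prems(2)]
    by (simp only: dderiv_mult differentiable_mult times_diff_add times_diff.simps simp_thms Suc.IH)
next
  case 0
  then show ?case unfolding times_diff.simps by (rule continuous_on_mult)
qed

lemma times_diff_cmult: "times_diff n f \<Longrightarrow> times_diff n (\<lambda>p. c * f p)"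
  by (rule times_diff_mult) auto

lemma times_diff_sum:
  "(\<And>i. i \<in> I \<Longrightarrow> times_diff n (f i)) \<Longrightarrow> times_diff n (\<lambda>p. \<Sum>i\<in>I. f i p)"
  by (induction I rule: infinite_finite_induct) (simp_all add: times_diff_add)

text \<open>The derivative is linear in its direction, so the quantifier over all \<open>v\<close>
  in \<open>times_diff\<close> reduces to basis vectors, the only directions that
  \<open>growth\<close> controls.\<close>

lemma times_diff_SucI:
  fixes f :: "'a::euclidean_space \<Rightarrow> complex"
  assumes "\<And>p. f differentiable at p" "\<And>v. v \<in> Basis \<Longrightarrow> times_diff n (dderiv v f)"
  shows "times_diff (Suc n) f"
proof -
  have "dderiv v f = (\<lambda>p. \<Sum>b\<in>Basis. of_real (v \<bullet> b) * dderiv b f p)" for v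
    by (intro ext dderiv_Basis assms(1))
  moreover have "times_diff n (\<lambda>p. \<Sum>b\<in>Basis. of_real (v \<bullet> b) * dderiv b f p)" for v
    by (intro times_diff_sum times_diff_cmult assms)
  ultimately show ?thesis using assms(1) by (metis times_diff.simps(2))
qed

lemma times_diff_affine_comp:
  assumes "bounded_linear A"
  shows "times_diff n f \<Longrightarrow> times_diff n (\<lambda>p. f (c + A p))"
proof (induction n arbitrary: f)
  case 0
  then show ?case
    using continuous_on_compose2[of UNIV f UNIV "\<lambda>p. c + A p"]
      continuous_on_add[OF continuous_on_const linear_continuous_on[OF assms]]
    by simp
next
  case (Suc n)
  have "(\<lambda>p. f (c + A p)) differentiable at p" for p
    using has_derivative_affine_comp[OF assms] Suc.prems by (auto simp: differentiable_def)
  then show ?case using Suc by (auto simp: dderiv_affine_comp[OF assms])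
qed

lemma smooth_dderiv: "smooth f \<Longrightarrow> smooth (dderiv v f)"
  unfolding smooth_def using times_diff.simps(2) by blast

lemma smooth_differentiable: "smooth f \<Longrightarrow> f differentiable at p"
  unfolding smooth_def using times_diff.simps(2) by blast

lemma smooth_cont: "smooth f \<Longrightarrow> continuous_on UNIV f"
  unfolding smooth_def using times_diff_cont by blast

lemma smooth_affine_comp: "bounded_linear A \<Longrightarrow> smooth f \<Longrightarrow> smooth (\<lambda>p. f (c + A p))"
  unfolding smooth_def using times_diff_affine_comp by blast

text \<open>Both mixed derivatives are the limit of the symmetric second difference quotient.\<close>

lemma second_difference_bound:
  fixes f :: "'a::real_normed_vector \<Rightarrow> complex"
  assumes f: "times_diff 2 f" and e: "0 < e"
  shows "\<exists>d>0. \<forall>h. 0 < h \<and> h < d \<longrightarrow>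
    norm (f (p + h *\<^sub>R u + h *\<^sub>R v) - f (p + h *\<^sub>R u) - f (p + h *\<^sub>R v) + f p
      - of_real (h\<^sup>2) * dderiv v (dderiv u f) p) \<le> h\<^sup>2 * e"
proof -
  define w where "w = dderiv v (dderiv u f)"
  have df: "f differentiable at q" and du: "dderiv u f differentiable at q" for q
    using f by (auto simp: numeral_2_eq_2)
  have ofr: "((\<lambda>t. of_real t * c) has_derivative (\<lambda>k. of_real k * c)) (at t)" for c :: complex and t
    by (rule bounded_linear_imp_has_derivative) 
      (rule bounded_linear_compose[OF bounded_linear_mult_left bounded_linear_of_real])
  have "isCont w p" using f
    by (auto simp: numeral_2_eq_2 w_def continuous_on_eq_continuous_at)
  then obtain r where r: "r > 0" "\<And>q. dist q p < r \<Longrightarrow> dist (w q) (w p) < e"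
    using e unfolding continuous_at_eps_delta by metis
  \<comment> \<open>For \<open>h < d\<close> the parallelogram spanned by
    \<open>h *\<^sub>R u\<close> and \<open>h *\<^sub>R v\<close> lies within distance
    \<open>r\<close> of \<open>p\<close>; the summand 1 keeps the denominator positive.\<close>
  define d where "d = r / (norm u + norm v + 1)"
  have npos: "norm u + norm v + 1 > 0" by (simp add: add_nonneg_pos)
  have "d > 0" using r(1) npos by (simp add: d_def)
  moreover have "norm (f (p + h *\<^sub>R u + h *\<^sub>R v) - f (p + h *\<^sub>R u) - f (p + h *\<^sub>R v) + f p
      - of_real (h\<^sup>2) * w p) \<le> h\<^sup>2 * e" if h: "0 < h" "h < d" for h
  proof -
    have near: "norm (w (p + s *\<^sub>R u + t *\<^sub>R v) - w p) \<le> e" if "s \<in> {0..h}" "t \<in> {0..h}" for s t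
    proof -
      have "norm (s *\<^sub>R u + t *\<^sub>R v) \<le> s * norm u + t * norm v"
        using that by (intro order_trans[OF norm_triangle_ineq]) simp
      also have "\<dots> \<le> h * (norm u + norm v + 1)"
        using that h mult_right_mono[of s h "norm u"] mult_right_mono[of t h "norm v"]
        by (auto simp: distrib_left)
      also have "\<dots> < r" using h(2) npos by (simp add: d_def pos_less_divide_eq)
      finally have "dist (p + s *\<^sub>R u + t *\<^sub>R v) p < r" by (simp add: dist_norm add.assoc)
      from r(2)[OF this] show ?thesis by (simp add: dist_norm less_imp_le)
    qed
    \<comment> \<open>The mean value inequality is used twice, here in direction \<open>v\<close>
      for \<open>dderiv u f\<close> and below in direction \<open>u\<close> for \<open>f\<close>.
      Each time the linear part built from \<open>w p\<close> is subtracted, so that only the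
      oscillation of \<open>w\<close> near \<open>p\<close> is left.\<close>
    have inner: "norm (dderiv u f (p + s *\<^sub>R u + h *\<^sub>R v) - dderiv u f (p + s *\<^sub>R u) - of_real h * w p) \<le> h * e"
      if s: "s \<in> {0..h}" for s
    proof -
      let ?g = "\<lambda>t. dderiv u f (p + s *\<^sub>R u + t *\<^sub>R v) - of_real t * w p"
      have *: "((\<lambda>t. dderiv u f ((p + s *\<^sub>R u) + t *\<^sub>R v)) has_derivative
           (\<lambda>k. dderiv (k *\<^sub>R v) (dderiv u f) (p + s *\<^sub>R u + t *\<^sub>R v))) (at t)" for t
        by (rule has_derivative_affine_comp[OF bounded_linear_scaleR_left du])
      have lin: "dderiv (k *\<^sub>R v) (dderiv u f) q = of_real k * w q" for k q
        by (simp add: w_def dderiv_scaleR[OF du])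
      have "norm (?g h - ?g 0) \<le> e * norm (h - 0)"
      proof (rule differentiable_bound[where f' = "\<lambda>t k. of_real k * (w (p + s *\<^sub>R u + t *\<^sub>R v) - w p)"])
        show "convex {0..h}" "h \<in> {0..h}" "0 \<in> {0..h}" using h by auto
        fix t assume t: "t \<in> {0..h}"
        show "(?g has_derivative (\<lambda>k. of_real k * (w (p + s *\<^sub>R u + t *\<^sub>R v) - w p))) (at t within {0..h})"
          using has_derivative_at_withinI[OF has_derivative_diff[OF *[unfolded lin] ofr]]
          by (simp add: right_diff_distrib)
        show "onorm (\<lambda>k. of_real k * (w (p + s *\<^sub>R u + t *\<^sub>R v) - w p)) \<le> e"
          by (rule onorm_le) (simp add: norm_mult mult.commute[of e] mult_left_mono near[OF s t])
      qed
      then show ?thesis using h by (simp add: algebra_simps)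
    qed
    let ?g = "\<lambda>s. f (p + s *\<^sub>R u + h *\<^sub>R v) - f (p + s *\<^sub>R u) - of_real s * (of_real h * w p)"
    have *: "((\<lambda>s. f (c + s *\<^sub>R u)) has_derivative (\<lambda>k. of_real k * dderiv u f (c + s *\<^sub>R u))) (at s)" for s c
      using has_derivative_affine_comp[OF bounded_linear_scaleR_left df, of c u s] by (simp add: dderiv_scaleR[OF df])
    have "norm (?g h - ?g 0) \<le> (h * e) * norm (h - 0)"
    proof (rule differentiable_bound[where f' = "\<lambda>s k. of_real k * (dderiv u f (p + s *\<^sub>R u + h *\<^sub>R v)
        - dderiv u f (p + s *\<^sub>R u) - of_real h * w p)"])
      show "convex {0..h}" "h \<in> {0..h}" "0 \<in> {0..h}" using h by auto
      fix s assume s: "s \<in> {0..h}"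
      have "((\<lambda>s. f (p + s *\<^sub>R u + h *\<^sub>R v)) has_derivative
          (\<lambda>k. of_real k * dderiv u f (p + s *\<^sub>R u + h *\<^sub>R v))) (at s)"
        using *[of "p + h *\<^sub>R v" s] by (simp add: algebra_simps)
      then show "(?g has_derivative (\<lambda>k. of_real k * (dderiv u f (p + s *\<^sub>R u + h *\<^sub>R v)
          - dderiv u f (p + s *\<^sub>R u) - of_real h * w p))) (at s within {0..h})"
        using has_derivative_at_withinI[OF has_derivative_diff[OF has_derivative_diff[OF _ *] ofr]]
        by (simp add: right_diff_distrib)
      show "onorm (\<lambda>k. of_real k * (dderiv u f (p + s *\<^sub>R u + h *\<^sub>R v)
          - dderiv u f (p + s *\<^sub>R u) - of_real h * w p)) \<le> h * e"
        by (rule onorm_le) (simp only: norm_mult norm_of_real real_norm_def mult.commute[of "h * e"]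
            mult_left_mono[OF inner[OF s]] abs_ge_zero)
    qed
    then show ?thesis using h by (simp add: algebra_simps power2_eq_square)
  qed
  ultimately show ?thesis unfolding w_def by blast
qed

lemma dderiv_commute:
  fixes f :: "'a::real_normed_vector \<Rightarrow> complex"
  assumes f: "times_diff 2 f"
  shows "dderiv v (dderiv u f) = dderiv u (dderiv v f)"
proof
  fix p
  let ?a = "dderiv v (dderiv u f) p" and ?b = "dderiv u (dderiv v f) p"
  have "dist ?a ?b \<le> 2 * e" if e: "e > 0" for e
  proof -
    obtain d1 where d1: "d1 > 0" "\<And>h. 0 < h \<Longrightarrow> h < d1 \<Longrightarrow>
      norm (f (p + h *\<^sub>R u + h *\<^sub>R v) - f (p + h *\<^sub>R u) - f (p + h *\<^sub>R v) + f p
        - of_real (h\<^sup>2) * ?a) \<le> h\<^sup>2 * e" using second_difference_bound[OF f e] by metis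
    obtain d2 where d2: "d2 > 0" "\<And>h. 0 < h \<Longrightarrow> h < d2 \<Longrightarrow>
      norm (f (p + h *\<^sub>R v + h *\<^sub>R u) - f (p + h *\<^sub>R v) - f (p + h *\<^sub>R u) + f p
        - of_real (h\<^sup>2) * ?b) \<le> h\<^sup>2 * e" using second_difference_bound[OF f e] by metis
    define h where "h = min d1 d2 / 2"
    have h: "0 < h" "h < d1" "h < d2" using d1(1) d2(1) by (auto simp: h_def)
    let ?S = "f (p + h *\<^sub>R u + h *\<^sub>R v) - f (p + h *\<^sub>R u) - f (p + h *\<^sub>R v) + f p"
    \<comment> \<open>The second difference is symmetric in \<open>u\<close> and \<open>v\<close>,
      so both estimates concern the same number.\<close>
    have S: "?S = f (p + h *\<^sub>R v + h *\<^sub>R u) - f (p + h *\<^sub>R v) - f (p + h *\<^sub>R u) + f p"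
      by (simp add: algebra_simps)
    have "norm ((?S - of_real (h\<^sup>2) * ?b) - (?S - of_real (h\<^sup>2) * ?a)) \<le> h\<^sup>2 * e + h\<^sup>2 * e"
      using norm_triangle_le_diff[OF add_mono[OF d2(2)[OF h(1,3), folded S] d1(2)[OF h(1,2)]]] .
    also have "(?S - of_real (h\<^sup>2) * ?b) - (?S - of_real (h\<^sup>2) * ?a) = of_real (h\<^sup>2) * (?a - ?b)"
      by (simp add: algebra_simps)
    finally have "h\<^sup>2 * dist ?a ?b \<le> h\<^sup>2 * (2 * e)"
      unfolding norm_mult dist_norm norm_of_real abs_power2 by (simp add: mult.commute)
    then show ?thesis using h(1) by (simp only: mult_le_cancel_left_pos zero_less_power)
  qed
  \<comment> \<open>A positive distance would be at most half of itself.\<close>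
  from this[of "dist ?a ?b / 4"] show "?a = ?b" by fastforce
qed

lemma dderiv_commute_smooth: "smooth f \<Longrightarrow> dderiv v (dderiv u f) = dderiv u (dderiv v f)"
  using dderiv_commute unfolding smooth_def by blast

section \<open>Weighted sup norms\<close>

text \<open>One constant bounds all derivatives up to order \<open>n\<close> against one weight.
  Thus \<open>growth n M C\<close> is a ball of radius \<open>C\<close> for a seminorm, and the
  estimates for \<open>osc\<close> and \<open>Lam\<close> can be stated as linear in
  \<open>C\<close>.\<close>

primrec growth :: "nat \<Rightarrow> real \<Rightarrow> real \<Rightarrow> ('a::euclidean_space \<Rightarrow> complex) \<Rightarrow> bool" where
  "growth 0 M C f \<longleftrightarrow> continuous_on UNIV f \<and> (\<forall>p. norm (f p) \<le> C * (1 + norm p) powr M)"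
| "growth (Suc n) M C f \<longleftrightarrow> (\<forall>p. f differentiable at p) \<and>
     (\<forall>p. norm (f p) \<le> C * (1 + norm p) powr M) \<and> (\<forall>v\<in>Basis. growth n M C (dderiv v f))"

text \<open>The order \<open>M\<close> is fixed while the constant may depend on \<open>n\<close>:
  amplitudes of order \<open>M\<close> and type 0, whose derivatives grow no faster than the
  function.\<close>

definition tame :: "real \<Rightarrow> ('a::euclidean_space \<Rightarrow> complex) \<Rightarrow> bool" where
  "tame M f \<longleftrightarrow> (\<forall>n. \<exists>C. growth n M C f)"

text \<open>Schwartz functions on an arbitrary Euclidean space; \<open>schwartz_rapid\<close> is the
  link to \<open>schwartz\<close>.\<close>

definition rapid :: "('a::euclidean_space \<Rightarrow> complex) \<Rightarrow> bool" where
  "rapid f \<longleftrightarrow> (\<forall>M. tame M f)"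

lemma growth_le: "growth n M C f \<Longrightarrow> norm (f p) \<le> C * (1 + norm p) powr M"
  by (cases n) simp_all

lemma growth_nonneg: "growth n M C f \<Longrightarrow> 0 \<le> C"
  using growth_le[of n M C f 0] norm_ge_zero[of "f 0"] by (simp del: norm_ge_zero)

lemma growth_differentiable: "growth (Suc n) M C f \<Longrightarrow> f differentiable at p"
  by simp

lemma growth_cont: "growth n M C f \<Longrightarrow> continuous_on UNIV f"
  by (cases n) (auto intro!: continuous_at_imp_continuous_on differentiable_imp_continuous_within)

lemma growth_Suc: "growth (Suc n) M C f \<Longrightarrow> growth n M C f"
proof (induction n arbitrary: f)
  case 0
  then show ?case using growth_cont[of 1 M C f] by simp
qed auto

lemma growth_order_mono: "growth n M C f \<Longrightarrow> m \<le> n \<Longrightarrow> growth m M C f"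
proof (induction n)
  case (Suc n)
  then show ?case using growth_Suc[of n M C f] by (cases "m = Suc n") (auto simp: le_Suc_eq)
qed simp

lemma growth_mono:
  assumes "growth n M C f" "M \<le> M'" "C \<le> C'"
  shows "growth n M' C' f"
proof -
  have *: "C * (1 + norm p) powr M \<le> C' * (1 + norm p) powr M'" for p :: 'a
    using growth_nonneg[OF assms(1)] assms(2,3)
    by (intro mult_mono powr_mono) simp_all
  show ?thesis using assms(1)
    by (induction n arbitrary: f) (simp_all, (meson * order_trans)+)
qed

lemma growth_dderiv: "growth (Suc n) M C f \<Longrightarrow> v \<in> Basis \<Longrightarrow> growth n M C (dderiv v f)"
  by simp

lemma growth_SucI:
  "(\<And>p. f differentiable at p) \<Longrightarrow> growth 0 M C f \<Longrightarrow> (\<And>v. v \<in> Basis \<Longrightarrow> growth n M C (dderiv v f))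
    \<Longrightarrow> growth (Suc n) M C f"
  by simp

lemma growth_const: "norm c \<le> C \<Longrightarrow> 0 \<le> M \<Longrightarrow> growth n M C (\<lambda>_. c)"
proof (induction n arbitrary: c)
  case 0
  have "C \<le> C * (1 + norm p) powr M" for p :: 'a
    using 0 ge_one_powr_ge_zero[of "1 + norm p" M]
    by (metis add_increasing2 mult.right_neutral mult_left_mono norm_ge_zero order_refl order_trans)
  with 0 show ?case by (auto intro: order_trans)
next
  case (Suc n)
  have "norm (0::complex) \<le> C" using order_trans[OF norm_ge_zero Suc.prems(1)] by simp
  from Suc.IH[OF this] have z: "growth n M C (\<lambda>_::'a. 0)" using Suc.prems(2) .
  from Suc have "growth 0 M C (\<lambda>_::'a. c)"
    using growth_order_mono[OF Suc.IH[of c], of 0] by simp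
  with z show ?case by simp
qed

lemma growth_add:
  "growth n M C f \<Longrightarrow> growth n M C' g \<Longrightarrow> growth n M (C + C') (\<lambda>p. f p + g p)"
proof (induction n arbitrary: f g)
  case 0
  have "norm (f p + g p) \<le> (C + C') * (1 + norm p) powr M" for p
    using 0 norm_triangle_mono[of "f p" _ "g p"] by (simp add: distrib_right)
  with 0 show ?case by (simp add: continuous_on_add)
next
  case (Suc n)
  have "norm (f p + g p) \<le> (C + C') * (1 + norm p) powr M" for p
    using Suc.prems norm_triangle_mono[of "f p" _ "g p"] by (simp add: distrib_right)
  moreover have "dderiv v (\<lambda>p. f p + g p) = (\<lambda>p. dderiv v f p + dderiv v g p)" for v
    using Suc.prems by (intro dderiv_add) simp_all
  moreover have "growth n M (C + C') (\<lambda>p. dderiv v f p + dderiv v g p)" if "v \<in> Basis" for v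
    using Suc.prems that by (intro Suc.IH) simp_all
  ultimately show ?case using Suc.prems by (simp add: differentiable_add)
qed

text \<open>Each differentiation splits a product in two by the Leibniz rule, whence the factor
  \<open>2 ^ n\<close>.\<close>

lemma growth_mult:
  "growth n M C f \<Longrightarrow> growth n M' C' g \<Longrightarrow> growth n (M + M') (2 ^ n * C * C') (\<lambda>p. f p * g p)"
proof (induction n arbitrary: f g)
  case 0
  have "norm (f p * g p) \<le> C * C' * (1 + norm p) powr (M + M')" for p
  proof -
    have "norm (f p * g p) \<le> (C * (1 + norm p) powr M) * (C' * (1 + norm p) powr M')"
      unfolding norm_mult using growth_le[OF 0(1)] growth_le[OF 0(2)] growth_nonneg[OF 0(1)]
      by (intro mult_mono) simp_all
    then show ?thesis by (simp add: powr_add ac_simps)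
  qed
  with 0 show ?case by (simp add: continuous_on_mult)
next
  case (Suc n)
  have le: "norm (f p * g p) \<le> 2 ^ Suc n * C * C' * (1 + norm p) powr (M + M')" for p
  proof -
    have "norm (f p * g p) \<le> 1 * ((C * (1 + norm p) powr M) * (C' * (1 + norm p) powr M'))"
      unfolding norm_mult mult_1 using growth_le[OF Suc(2)] growth_le[OF Suc(3)] growth_nonneg[OF Suc(2)]
      by (intro mult_mono) simp_all
    also have "\<dots> \<le> 2 ^ Suc n * ((C * (1 + norm p) powr M) * (C' * (1 + norm p) powr M'))"
      using growth_nonneg[OF Suc(2)] growth_nonneg[OF Suc(3)]
      by (intro mult_right_mono one_le_power mult_nonneg_nonneg) simp_all
    finally show ?thesis by (simp add: powr_add ac_simps)
  qed
  have "dderiv v (\<lambda>p. f p * g p) = (\<lambda>p. f p * dderiv v g p + dderiv v f p * g p)" for v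
    using Suc.prems by (intro dderiv_mult) simp_all
  moreover have "growth n (M + M') (2 ^ n * C * C' + 2 ^ n * C * C')
      (\<lambda>p. f p * dderiv v g p + dderiv v f p * g p)" if "v \<in> Basis" for v
    using Suc.prems(1,2)[THEN growth_Suc] Suc.prems that
    by (intro growth_add Suc.IH) simp_all
  ultimately show ?case using Suc.prems le
    by (simp add: differentiable_mult mult.assoc flip: mult_2)
qed

lemma growth_cmult: 
  assumes "growth n M C f" shows "growth n M (norm c * C) (\<lambda>p. c * f p)"
proof -
  have *: "norm (c * f p) \<le> norm c * C * (1 + norm p) powr M" if "growth n M C f" for p n f
    using growth_le[OF that, of p] by (simp add: norm_mult mult_left_mono mult.assoc)
  show ?thesis using assms
  proof (induction n arbitrary: f)
    case (Suc n)
    have "dderiv v (\<lambda>p. c * f p) = (\<lambda>p. c * dderiv v f p)" for v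
      using Suc.prems by (intro dderiv_cmult) simp_all
    moreover have "growth n M (norm c * C) (\<lambda>p. c * dderiv v f p)" if "v \<in> Basis" for v
      by (rule Suc.IH) (use Suc.prems that in simp)
    ultimately show ?case using *[OF Suc.prems] Suc.prems by (simp add: differentiable_mult)
  next
    case 0
    then show ?case using *[OF 0] by (simp add: continuous_on_mult_left)
  qed
qed

lemma growth_diff:
  assumes "growth n M C f" "growth n M C' g" 
  shows "growth n M (C + C') (\<lambda>p. f p - g p)"
  using growth_add[OF assms(1) growth_cmult[OF assms(2), of "-1"]] by simp

lemma growth_sum:
  "finite I \<Longrightarrow> (\<And>i. i \<in> I \<Longrightarrow> growth n M (C i) (f i)) \<Longrightarrow> growth n M (\<Sum>i\<in>I. C i) (\<lambda>p. \<Sum>i\<in>I. f i p)"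
proof (induction I rule: finite_induct)
  case empty
  have "growth n M 0 (\<lambda>_. 0)" by (induction n) auto
  then show ?case by simp
qed (simp add: growth_add)

text \<open>A general direction is expanded in the basis: \<open>DIM('a)\<close> terms, each with a
  coefficient of size at most \<open>norm v\<close>.\<close>

lemma growth_dderiv_any:
  assumes "growth (Suc n) M C (f :: 'a::euclidean_space \<Rightarrow> complex)"
  shows "growth n M (DIM('a) * norm v * C) (dderiv v f)"
proof -
  have "dderiv v f = (\<lambda>p. \<Sum>b\<in>Basis. of_real (v \<bullet> b) * dderiv b f p)"
    using assms by (intro ext dderiv_Basis) simp
  moreover have "growth n M (\<Sum>b\<in>(Basis::'a set). norm v * C) (\<lambda>p. \<Sum>b\<in>Basis. of_real (v \<bullet> b) * dderiv b f p)"
  proof (rule growth_sum)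
    fix b :: 'a assume b: "b \<in> Basis"
    show "growth n M (norm v * C) (\<lambda>p. of_real (v \<bullet> b) * dderiv b f p)"
      using growth_cmult[OF growth_dderiv[OF assms b], of "of_real (v \<bullet> b)"] Basis_le_norm[OF b, of v]
        growth_nonneg[OF assms]
      by (elim growth_mono) (auto intro: mult_right_mono)
  qed simp
  ultimately show ?thesis by (simp add: mult.assoc)
qed

lemma growth_inner: "growth n 1 (norm u) (\<lambda>p. of_real (p \<bullet> u))"
proof -
  have le: "norm (complex_of_real (p \<bullet> u)) \<le> norm u * (1 + norm p) powr 1" for p :: 'a
    using Cauchy_Schwarz_ineq2[of p u] by (simp add: algebra_simps)
      (smt (verit) mult.commute norm_ge_zero)
  have d: "((\<lambda>p. complex_of_real (p \<bullet> u)) has_derivative (\<lambda>v. of_real (v \<bullet> u))) (at p)" for p :: 'a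
    by (rule bounded_linear_imp_has_derivative)
      (rule bounded_linear_compose[OF bounded_linear_of_real bounded_linear_inner_left])
  show ?thesis
  proof (cases n)
    case 0
    have "continuous_on UNIV (\<lambda>p::'a. complex_of_real (p \<bullet> u))"
      by (intro continuous_intros)
    with 0 le show ?thesis by simp
  next
    case (Suc m)
    have "dderiv v (\<lambda>p. complex_of_real (p \<bullet> u)) = (\<lambda>p. of_real (v \<bullet> u))" for v
      by (intro ext dderiv_eqI d)
    moreover have "growth m 1 (norm u) (\<lambda>p::'a. complex_of_real (v \<bullet> u))" if "v \<in> Basis" for v
      using Basis_le_norm[OF that, of u] by (intro growth_const) (simp_all add: inner_commute)
    ultimately show ?thesis using Suc le differentiableI[OF d] by (simp del: powr_one)
  qed
qed

text \<open>Peetre's inequality, with the whole loss put on \<open>q\<close>. For negative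
  \<open>M\<close> it rests on the triangle inequality for \<open>p = (q + p) - q\<close>.\<close>

lemma peetre:
  fixes p q :: "'a::real_normed_vector"
  shows "(1 + norm (q + p)) powr M \<le> (1 + norm q) powr \<bar>M\<bar> * (1 + norm p) powr M"
proof (cases "M \<ge> 0")
  case True
  have "1 + norm (q + p) \<le> (1 + norm q) * (1 + norm p)"
    using norm_triangle_ineq[of q p] by (simp add: algebra_simps add_increasing)
      (smt (verit) mult_nonneg_nonneg norm_ge_zero)
  then have "(1 + norm (q + p)) powr M \<le> ((1 + norm q) * (1 + norm p)) powr M"
    using True by (intro powr_mono2) simp_all
  then show ?thesis using True by (simp add: powr_mult)
next
  case False
  have "norm p \<le> norm (q + p) + norm q"
    using norm_triangle_ineq4[of "q + p" q] by simp
  then have "1 + norm p \<le> (1 + norm q) * (1 + norm (q + p))"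
    by (simp add: algebra_simps) (smt (verit) mult_nonneg_nonneg norm_ge_zero)
  then have "((1 + norm q) * (1 + norm (q + p))) powr M \<le> (1 + norm p) powr M"
    using False by (intro powr_mono2') (simp_all add: add_pos_nonneg)
  then have "(1 + norm q) powr (-M) * ((1 + norm q) powr M * (1 + norm (q + p)) powr M)
      \<le> (1 + norm q) powr (-M) * (1 + norm p) powr M"
    by (intro mult_left_mono) (simp_all add: powr_mult)
  moreover have "(1 + norm q) powr (-M) * (1 + norm q) powr M = 1"
    using powr_add[of "1 + norm q" "-M" M, symmetric] by (simp add: add_nonneg_eq_0_iff)
  ultimately show ?thesis using False by (simp flip: mult.assoc)
qed

text \<open>The order survives a translation and the constant grows polynomially in
  \<open>q\<close>. Later this gives the polynomial bound on transposed symbols that dominated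
  convergence needs.\<close>

lemma growth_translate:
  "growth n M C f \<Longrightarrow> growth n M (C * (1 + norm q) powr \<bar>M\<bar>) (\<lambda>p. f (q + p))"
proof (induction n arbitrary: f)
  case 0
  have "norm (f (q + p)) \<le> C * (1 + norm q) powr \<bar>M\<bar> * (1 + norm p) powr M" for p
    using order_trans[OF growth_le[OF 0, of "q + p"] mult_left_mono[OF peetre growth_nonneg[OF 0]]]
    by (simp add: mult.assoc)
  with 0 show ?case
    by (auto intro!: continuous_on_compose2[of UNIV f UNIV "\<lambda>p. q + p"] continuous_on_add)
next
  case (Suc n)
  have "norm (f (q + p)) \<le> C * (1 + norm q) powr \<bar>M\<bar> * (1 + norm p) powr M" for p
    using order_trans[OF growth_le[OF Suc.prems, of "q + p"] mult_left_mono[OF peetre growth_nonneg[OF Suc.prems]]]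
    by (simp add: mult.assoc)
  moreover have "(\<lambda>p. f (q + p)) differentiable at p" for p
    using has_derivative_affine_comp[OF bounded_linear_ident, of f q p] Suc.prems
    by (auto simp: differentiable_def)
  ultimately show ?case using Suc by (simp add: dderiv_translate)
qed

section \<open>Amplitudes and Schwartz functions: closure properties\<close>

lemma tameI: "(\<And>n. \<exists>C. growth n M C f) \<Longrightarrow> tame M f"
  by (simp add: tame_def)

lemma tameE: "tame M f \<Longrightarrow> (\<And>C. growth n M C f \<Longrightarrow> thesis) \<Longrightarrow> thesis"
  unfolding tame_def by blast

lemma tame_smooth: "tame M f \<Longrightarrow> smooth f"
proof -
  have "growth n M C f \<Longrightarrow> times_diff n f" for n C
    by (induction n arbitrary: f) (auto simp del: times_diff.simps(2) intro!: times_diff_SucI)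
  then show "tame M f \<Longrightarrow> smooth f" unfolding tame_def smooth_def by blast
qed

lemma tame_mono: "tame M f \<Longrightarrow> M \<le> M' \<Longrightarrow> tame M' f"
  unfolding tame_def by (meson growth_mono order_refl)

lemma tame_dderiv: "tame M f \<Longrightarrow> tame M (dderiv v f)"
  by (rule tameI, elim tameE, rule exI, erule growth_dderiv_any)

lemma tame_add: "tame M f \<Longrightarrow> tame M g \<Longrightarrow> tame M (\<lambda>p. f p + g p)"
  by (rule tameI, elim tameE, rule exI, erule growth_add, assumption)

lemma tame_diff: "tame M f \<Longrightarrow> tame M g \<Longrightarrow> tame M (\<lambda>p. f p - g p)"
  by (rule tameI, elim tameE, rule exI, erule growth_diff, assumption)

lemma tame_mult: "tame M f \<Longrightarrow> tame M' g \<Longrightarrow> tame (M + M') (\<lambda>p. f p * g p)"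
  by (rule tameI, elim tameE, rule exI, erule growth_mult, assumption)

lemma tame_cmult: "tame M f \<Longrightarrow> tame M (\<lambda>p. c * f p)"
  by (rule tameI, elim tameE, rule exI, erule growth_cmult)

lemma tame_sum: "finite I \<Longrightarrow> (\<And>i. i \<in> I \<Longrightarrow> tame M (f i)) \<Longrightarrow> tame M (\<lambda>p. \<Sum>i\<in>I. f i p)"
  unfolding tame_def
proof
  fix n assume I: "finite I" and *: "\<And>i. i \<in> I \<Longrightarrow> \<forall>n. \<exists>C. growth n M C (f i)"
  from * have "\<forall>i\<in>I. \<exists>C. growth n M C (f i)" by blast
  from bchoice[OF this] obtain C where "\<forall>i\<in>I. growth n M (C i) (f i)" by blast
  with I have "growth n M (\<Sum>i\<in>I. C i) (\<lambda>p. \<Sum>i\<in>I. f i p)" by (intro growth_sum) auto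
  then show "\<exists>C. growth n M C (\<lambda>p. \<Sum>i\<in>I. f i p)" ..
qed

lemma tame_translate: "tame M f \<Longrightarrow> tame M (\<lambda>p. f (q + p))"
  by (rule tameI, elim tameE, rule exI, erule growth_translate)

lemma tame_const: "tame 0 (\<lambda>_. c)"
  unfolding tame_def using growth_const by blast

lemma tame_inner: "tame 1 (\<lambda>p. of_real (p \<bullet> u))"
  unfolding tame_def using growth_inner by blast

text \<open>The finitely many constants for \<open>f\<close> and its basis derivatives are merged by
  taking their sum, which dominates each of them as all are nonnegative.\<close>

lemma ex_growth_SucI:
  assumes "\<And>p. f differentiable at p" "\<exists>C. growth 0 M C f" 
    "\<And>v. v \<in> Basis \<Longrightarrow> \<exists>C. growth n M C (dderiv v (f :: 'a::euclidean_space \<Rightarrow> complex))"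
  shows "\<exists>C. growth (Suc n) M C f"
proof -
  obtain C0 where C0: "growth 0 M C0 f" using assms(2) by blast
  obtain C where C: "\<And>v. v \<in> Basis \<Longrightarrow> growth n M (C v) (dderiv v f)" using assms(3) by metis
  define D where "D = C0 + (\<Sum>v\<in>Basis. C v)"
  have "C0 \<le> D" unfolding D_def using growth_nonneg[OF C] by (simp add: sum_nonneg)
  moreover have "C v \<le> D" if "v \<in> Basis" for v
    unfolding D_def using growth_nonneg[OF C0] growth_nonneg[OF C] that
    by (intro add_increasing member_le_sum) auto
  ultimately have "growth (Suc n) M D f"
    using C0 C assms(1) by (intro growth_SucI) (meson growth_mono order_refl)+
  then show ?thesis ..
qed

lemma rapid_tame: "rapid f \<Longrightarrow> tame M f"
  by (simp add: rapid_def)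

lemma rapid_mult_tame: "rapid f \<Longrightarrow> tame M g \<Longrightarrow> rapid (\<lambda>p. f p * g p)"
  unfolding rapid_def using tame_mult[of _ f M g] by (metis diff_add_cancel)

lemma rapid_dderiv: "rapid f \<Longrightarrow> rapid (dderiv v f)"
  by (simp add: rapid_def tame_dderiv)

lemma rapid_add: "rapid f \<Longrightarrow> rapid g \<Longrightarrow> rapid (\<lambda>p. f p + g p)"
  by (simp add: rapid_def tame_add)

lemma rapid_diff: "rapid f \<Longrightarrow> rapid g \<Longrightarrow> rapid (\<lambda>p. f p - g p)"
  by (simp add: rapid_def tame_diff)

lemma rapid_cmult: "rapid f \<Longrightarrow> rapid (\<lambda>p. c * f p)"
  by (simp add: rapid_def tame_cmult)

lemma rapid_sum: "finite I \<Longrightarrow> (\<And>i. i \<in> I \<Longrightarrow> rapid (f i)) \<Longrightarrow> rapid (\<lambda>p. \<Sum>i\<in>I. f i p)"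
  by (simp add: rapid_def tame_sum)

lemma rapid_translate: "rapid f \<Longrightarrow> rapid (\<lambda>p. f (q + p))"
  by (simp add: rapid_def tame_translate)

section \<open>Two model functions: the inverse square of the Japanese bracket and the
  Gaussian\<close>

definition japanese :: "'a::euclidean_space \<Rightarrow> complex" where
  "japanese p = of_real (inverse (1 + p \<bullet> p))"

text \<open>The factor 1/2 in the exponent makes the Gaussian an eigenfunction of the Fourier
  transform.\<close>

definition gauss :: "'a::euclidean_space \<Rightarrow> complex" where
  "gauss p = of_real (exp (- (p \<bullet> p) / 2))"

lemma has_derivative_japanese:
  "(japanese has_derivative (\<lambda>v. (-2) * (of_real (p \<bullet> v) * (japanese p * japanese p)))) (at p)"
proof -
  have "1 + p \<bullet> p \<noteq> 0" by (simp add: add_nonneg_eq_0_iff)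
  then have "((\<lambda>p. inverse (1 + p \<bullet> p)) has_derivative
      (\<lambda>v. - (inverse (1 + p \<bullet> p) * (p \<bullet> v + v \<bullet> p) * inverse (1 + p \<bullet> p)))) (at p)"
    by (intro Deriv.has_derivative_inverse has_derivative_add[OF has_derivative_const
        has_derivative_inner[OF has_derivative_ident has_derivative_ident], simplified])
  from has_derivative_of_real[OF this, where 'a = complex] show ?thesis
    by (simp add: japanese_def[abs_def] inner_commute algebra_simps)
qed

lemma has_derivative_gauss:
  "(gauss has_derivative (\<lambda>v. (-1) * (of_real (p \<bullet> v) * gauss p))) (at p)"
proof -
  have "((\<lambda>p. - (p \<bullet> p) / 2) has_derivative (\<lambda>v. - (p \<bullet> v))) (at p)"
    by (auto intro!: derivative_eq_intros simp: inner_commute)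
  from has_derivative_of_real[OF has_derivative_exp[OF this], where 'a = complex] show ?thesis
    by (simp add: gauss_def[abs_def] algebra_simps)
qed

text \<open>The derivative is a linear factor times \<open>japanese\<close> squared, of order 1 - 2
  - 2 = -3. This is below -2, so the order reproduces itself in the induction.\<close>

lemma tame_japanese: "tame (-2) (japanese :: 'a::euclidean_space \<Rightarrow> complex)"
proof (rule tameI)
  fix n
  have base: "growth 0 (-2) 2 (japanese :: 'a \<Rightarrow> complex)"
  proof -
    have "norm (japanese p) \<le> 2 * (1 + norm p) powr (-2)" for p :: 'a
    proof -
      have "(1 + norm p)\<^sup>2 \<le> 2 * (1 + (norm p)\<^sup>2)"
        using zero_le_power2[of "1 - norm p"] by (simp add: power2_eq_square algebra_simps)
      moreover have "0 < (1 + norm p)\<^sup>2" "0 < 1 + (norm p)\<^sup>2"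
        by (auto simp: add_nonneg_eq_0_iff add_pos_nonneg zero_less_power2)
      ultimately have "inverse (1 + (norm p)\<^sup>2) \<le> 2 * inverse ((1 + norm p)\<^sup>2)"
        by (simp only: field_simps) simp
      moreover have "(1 + norm p) powr (-2) = inverse ((1 + norm p)\<^sup>2)"
        using powr_realpow[of "1 + norm p" 2] by (simp add: powr_minus add_pos_nonneg)
      ultimately have "inverse (1 + (norm p)\<^sup>2) \<le> 2 * (1 + norm p) powr (-2)"
        by simp
      then show ?thesis
        unfolding japanese_def norm_of_real dot_square_norm by simp
    qed
    moreover have "continuous_on UNIV (japanese :: 'a \<Rightarrow> complex)"
      using has_derivative_japanese has_derivative_continuous
      by (blast intro: continuous_at_imp_continuous_on)
    ultimately show ?thesis by simp
  qed
  show "\<exists>C. growth n (-2) C (japanese :: 'a \<Rightarrow> complex)"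
  proof (induction n)
    case 0
    show ?case using base by blast
  next
    case (Suc n)
    then obtain C where C: "growth n (-2) C (japanese :: 'a \<Rightarrow> complex)" by blast
    show ?case
    proof (rule ex_growth_SucI)
      show "\<exists>C. growth n (-2) C (dderiv v (japanese :: 'a \<Rightarrow> complex))" for v
      proof -
        have "dderiv v japanese = (\<lambda>p::'a. (-2) * (of_real (p \<bullet> v) * (japanese p * japanese p)))"
          by (intro ext dderiv_eqI has_derivative_japanese)
        then have "growth n (-3) (norm (-2::complex) * (2 ^ n * norm v * (2 ^ n * C * C)))
            (dderiv v (japanese :: 'a \<Rightarrow> complex))"
          using growth_cmult[OF growth_mult[OF growth_inner growth_mult[OF C C]], of "-2" v] by simp
        then show ?thesis using growth_mono[of n "-3" _ _ "-2"] by auto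
      qed
    qed (use has_derivative_japanese differentiableI base in blast)+
  qed
qed

lemma continuous_gauss: "continuous_on UNIV gauss"
  using has_derivative_gauss has_derivative_continuous
  by (blast intro: continuous_at_imp_continuous_on)

lemma rapid_gauss: "rapid (gauss :: 'a::euclidean_space \<Rightarrow> complex)"
proof -
  have base: "\<exists>C. growth 0 M C (gauss :: 'a \<Rightarrow> complex)" for M
  proof -
    define k where "k = nat \<lceil>- M\<rceil>"
    have k: "- M \<le> real k" unfolding k_def by linarith
    \<comment> \<open>With r = \<open>norm p\<close>, the k-th term of the exponential series gives
      (1 + r)^k \<le> k! exp (1 + r), and 1 + r \<le> 3/2 + r^2/2 because (1 - r)^2 \<ge> 0. This is
      the origin of \<open>fact k * exp (3/2)\<close>.\<close>
    have "norm (gauss p) \<le> (fact k * exp (3/2)) * (1 + norm p) powr M" for p :: 'a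
    proof -
      have "(1 + norm p) powr (- M) \<le> (1 + norm p) ^ k"
        using powr_mono[OF k, of "1 + norm p"] by (simp add: powr_realpow add_pos_nonneg)
      also have "\<dots> \<le> fact k * exp (1 + norm p)"
        using sum_le_suminf[OF summable_exp_generic, of "{k}" "1 + norm p"]
        by (simp add: exp_def field_simps)
      also have "exp (1 + norm p) \<le> exp (3/2 + (p \<bullet> p) / 2)"
        using zero_le_power2[of "1 - norm p"]
        by (simp add: dot_square_norm power2_eq_square algebra_simps)
      finally have "(1 + norm p) powr (- M) \<le> fact k * exp (3/2) * exp ((p \<bullet> p) / 2)"
        by (simp add: exp_add mult.assoc)
      moreover have "(1 + norm p) powr M > 0" by (simp add: add_nonneg_eq_0_iff)
      moreover have "norm (gauss p) = inverse (exp ((p \<bullet> p) / 2))"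
        by (simp add: gauss_def flip: exp_minus)
      moreover have "inverse E \<le> c * P" if "inverse P \<le> c * E" "0 < P" "0 < E" for c E P :: real
        using that by (simp add: field_simps)
      ultimately show ?thesis unfolding powr_minus by simp
    qed
    then show ?thesis using continuous_gauss by auto
  qed
  \<comment> \<open>\<open>M\<close> stays arbitrary in the induction: differentiation multiplies
    the Gaussian by a linear factor, which is paid for by using order \<open>M - 1\<close>.\<close>
  have "\<exists>C. growth n M C (gauss :: 'a \<Rightarrow> complex)" for n M
  proof (induction n arbitrary: M)
    case 0
    show ?case by (rule base)
  next
    case (Suc n)
    show ?case
    proof (rule ex_growth_SucI)
      show "\<exists>C. growth n M C (dderiv v (gauss :: 'a \<Rightarrow> complex))" for v
      proof -
        obtain C where C: "growth n (M - 1) C (gauss :: 'a \<Rightarrow> complex)" using Suc by blast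
        have "dderiv v gauss = (\<lambda>p::'a. (-1) * (of_real (p \<bullet> v) * gauss p))"
          by (intro ext dderiv_eqI has_derivative_gauss)
        with growth_cmult[OF growth_mult[OF growth_inner C], of "-1" v]
        have "growth n (1 + (M - 1)) (norm (-1::complex) * (2 ^ n * norm v * C))
            (dderiv v (gauss :: 'a \<Rightarrow> complex))" by simp
        then show ?thesis by auto
      qed
    qed (use has_derivative_gauss differentiableI base in blast)+
  qed
  then show ?thesis by (simp add: rapid_def tame_def)
qed

section \<open>Dilations and Taylor remainders in the weighted norms\<close>

lemma dderiv_scale:
  fixes f :: "'a::real_normed_vector \<Rightarrow> complex"
  assumes "\<And>p. f differentiable at p"
  shows "dderiv v (\<lambda>p. f (t *\<^sub>R p)) = (\<lambda>p. of_real t * dderiv v f (t *\<^sub>R p))"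
  using dderiv_affine_comp[OF bounded_linear_scaleR_right assms, of v 0 t]
  by (simp add: dderiv_scaleR assms)

lemma differentiable_scale:
  fixes f :: "'a::real_normed_vector \<Rightarrow> complex"
  assumes "\<And>p. f differentiable at p"
  shows "(\<lambda>p. f (t *\<^sub>R p)) differentiable at p"
  using has_derivative_affine_comp[OF bounded_linear_scaleR_right[of t] assms, where c = 0]
  by (auto simp: differentiable_def)

text \<open>The chain rule contributes powers of \<open>t \<le> 1\<close>, so only the weight costs
  something, through \<open>t * (1 + norm p) \<le> 1 + norm (t *\<^sub>R p)\<close>. At
  \<open>M = 0\<close> nothing is lost, which makes the Gaussian cutoffs bounded uniformly in their
  scale.\<close>

lemma growth_scale:
  assumes t: "0 < t" "t \<le> 1" and M: "M \<le> 0"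
  shows "growth n M C f \<Longrightarrow> growth n M (C * t powr M) (\<lambda>p. f (t *\<^sub>R p))"
proof (induction n arbitrary: f)
  have base: "norm (f (t *\<^sub>R p)) \<le> C * t powr M * (1 + norm p) powr M" if "growth n M C f" for n f p
  proof -
    have "t * (1 + norm p) \<le> 1 + norm (t *\<^sub>R p)"
      using t by (simp add: distrib_left)
    then have "(1 + norm (t *\<^sub>R p)) powr M \<le> (t * (1 + norm p)) powr M"
      using t M by (intro powr_mono2') (simp_all add: add_pos_nonneg)
    then have "C * (1 + norm (t *\<^sub>R p)) powr M \<le> C * (t powr M * (1 + norm p) powr M)"
      using growth_nonneg[OF that] t by (intro mult_left_mono) (simp_all add: powr_mult)
    with growth_le[OF that, of "t *\<^sub>R p"] show ?thesis by (simp add: mult.assoc)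
  qed
  {
    case 0
    then show ?case using base[OF 0]
      by (auto intro!: continuous_on_compose2[of UNIV f UNIV "\<lambda>p. t *\<^sub>R p"] continuous_on_scaleR)
  next
    case (Suc n)
    have "growth n M (C * t powr M) (\<lambda>p. of_real t * dderiv v f (t *\<^sub>R p))" if "v \<in> Basis" for v
    proof -
      have "growth n M (norm (complex_of_real t) * (C * t powr M)) (\<lambda>p. of_real t * dderiv v f (t *\<^sub>R p))"
        by (intro growth_cmult Suc.IH growth_dderiv[OF Suc.prems that])
      then show ?thesis
        by (rule growth_mono)
          (use t growth_nonneg[OF Suc.prems] in \<open>simp_all add: mult_left_le_one_le\<close>)
    qed
    then show ?case using Suc.prems base[OF Suc.prems] by (simp add: dderiv_scale differentiable_scale)
  }
qed

lemma norm_increment_le: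
  fixes g :: "real \<Rightarrow> complex"
  assumes "\<And>s. s \<in> {0..1} \<Longrightarrow> (g has_derivative (\<lambda>k. of_real k * g' s)) (at s)"
    and "\<And>s. s \<in> {0..1} \<Longrightarrow> norm (g' s) \<le> B"
  shows "norm (g 1 - g 0) \<le> B"
proof -
  have "norm (g 1 - g 0) \<le> B * norm (1 - 0 :: real)"
  proof (rule differentiable_bound[where f' = "\<lambda>s k. of_real k * g' s" and S = "{0..1}"])
    show "onorm (\<lambda>k. complex_of_real k * g' s) \<le> B" if "s \<in> {0..1}" for s
      by (rule onorm_le) (simp add: norm_mult mult.commute[of B] mult_left_mono assms(2)[OF that])
    show "(g has_derivative (\<lambda>k. of_real k * g' s)) (at s within {0..1})" if "s \<in> {0..1}" for s
      by (rule has_derivative_at_withinI[OF assms(1)[OF that]])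
  qed simp_all
  then show ?thesis by simp
qed

lemma has_derivative_along:
  assumes "\<And>p. f differentiable at p"
  shows "((\<lambda>s. f (p + s *\<^sub>R h)) has_derivative (\<lambda>k. of_real k * dderiv h f (p + s *\<^sub>R h))) (at s)"
  using has_derivative_affine_comp[OF bounded_linear_scaleR_left[of h] assms, of p s]
  by (simp add: dderiv_scaleR assms)

lemma norm_diff_along_le:
  assumes "\<And>p. f differentiable at p" "\<And>s. s \<in> {0..1} \<Longrightarrow> norm (dderiv h f (p + s *\<^sub>R h)) \<le> B"
  shows "norm (f (p + h) - f p) \<le> B"
  using norm_increment_le[OF has_derivative_along[OF assms(1)] assms(2)] by simp

text \<open>Dilating the argument towards the origin costs an error of size \<open>t\<close>, bought
  with one power of the weight: the value is estimated along the segment from 0 to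
  \<open>t *\<^sub>R p\<close>, and every derivative carries a factor \<open>t\<close> by the chain
  rule. For the Gaussian this yields the rate of convergence of the cutoffs.\<close>

lemma growth_scale_diff:
  fixes C t :: real
  assumes t: "0 < t" "t \<le> 1" and f: "growth (Suc n) 0 C (f :: 'a::euclidean_space \<Rightarrow> complex)"
  shows "growth n 1 (DIM('a) * C * t) (\<lambda>p. f 0 - f (t *\<^sub>R p))"
proof -
  have diff: "f differentiable at p" for p using f by simp
  have C: "0 \<le> C" using growth_nonneg[OF f] .
  have DIM: "1 \<le> real DIM('a)" by (simp add: Suc_leI)
  have le: "norm (f 0 - f (t *\<^sub>R p)) \<le> DIM('a) * C * t * (1 + norm p) powr 1" for p
  proof -
    have "norm (f (0 + t *\<^sub>R p) - f 0) \<le> DIM('a) * norm (t *\<^sub>R p) * C"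
      by (rule norm_diff_along_le[OF diff])
        (use growth_le[OF growth_dderiv_any[OF growth_order_mono[OF f]], of 0 "t *\<^sub>R p"] in 
          \<open>simp add: add_nonneg_eq_0_iff\<close>)
    also have "\<dots> \<le> DIM('a) * C * t * (1 + norm p)"
      using t C by (simp add: algebra_simps)
    finally show ?thesis by (simp add: norm_minus_commute)
  qed
  show ?thesis
  proof (cases n)
    case 0
    have "continuous_on UNIV (\<lambda>p. f 0 - f (t *\<^sub>R p))"
      using growth_cont[OF growth_scale[OF t _ f]] by (intro continuous_on_diff) auto
    with 0 le show ?thesis by simp
  next
    case (Suc m)
    have "dderiv v (\<lambda>p. f 0 - f (t *\<^sub>R p)) = (\<lambda>p. - of_real t * dderiv v f (t *\<^sub>R p))" for v
      using dderiv_diff[of "\<lambda>_. f 0" "\<lambda>p. f (t *\<^sub>R p)" v] differentiable_scale[OF diff]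
      by (simp add: dderiv_scale[OF diff])
    moreover have "growth m 1 (DIM('a) * C * t) (\<lambda>p. - of_real t * dderiv v f (t *\<^sub>R p))" if "v \<in> Basis" for v
    proof -
      have "growth m 0 C (dderiv v f)"
        using growth_order_mono[OF f, of "Suc m"] Suc that by simp
      from growth_cmult[OF growth_scale[OF t _ this], of "- of_real t"] show ?thesis
        by (rule growth_mono) (use t mult_right_mono[OF DIM, of "C * t"] C in \<open>simp_all add: ac_simps\<close>)
    qed
    ultimately show ?thesis using Suc le differentiable_scale[OF diff]
      by (simp add: differentiable_diff del: powr_one)
  qed
qed

text \<open>Taking the first-order Taylor remainder commutes with differentiation in
  \<open>p\<close>, so the pointwise estimate also serves for all derivatives. The weight stays
  \<open>M\<close>; two derivatives are spent. Expanding \<open>h\<close> twice in the basis gives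
  the squared dimension, and Peetre's inequality with \<open>norm h \<le> 1\<close> gives
  \<open>2 powr \<bar>M\<bar>\<close>.\<close>

lemma growth_taylor:
  assumes h: "norm h \<le> 1"
  shows "smooth f \<Longrightarrow> growth (Suc (Suc n)) M C (f :: 'a::euclidean_space \<Rightarrow> complex) \<Longrightarrow>
    growth n M ((DIM('a))\<^sup>2 * 2 powr \<bar>M\<bar> * C * (norm h)\<^sup>2) (\<lambda>p. f (h + p) - f p - dderiv h f p)"
proof (induction n arbitrary: f)
  have base: "norm (f (h + p) - f p - dderiv h f p)
      \<le> (DIM('a))\<^sup>2 * 2 powr \<bar>M\<bar> * C * (norm h)\<^sup>2 * (1 + norm p) powr M"
    (is "_ \<le> ?B") if f: "smooth f" "growth (Suc (Suc 0)) M C f" for f p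
  proof -
    have dh: "growth 0 M (DIM('a) * norm h * (DIM('a) * norm h * C)) (dderiv h (dderiv h f))"
      using f(2) by (intro growth_dderiv_any)
    have C: "0 \<le> C" using growth_nonneg[OF f(2)] .
    have B: "norm (dderiv h (dderiv h f) (p + s *\<^sub>R h)) \<le> ?B" if s: "s \<in> {0..1}" for s
    proof -
      have "norm (s *\<^sub>R h) \<le> 1" using s h by (simp add: mult_le_one)
      then have "(1 + norm (s *\<^sub>R h)) powr \<bar>M\<bar> \<le> 2 powr \<bar>M\<bar>"
        by (intro powr_mono2) simp_all
      then have "(1 + norm (p + s *\<^sub>R h)) powr M \<le> 2 powr \<bar>M\<bar> * (1 + norm p) powr M"
        using peetre[of "s *\<^sub>R h" p M] mult_right_mono[of _ _ "(1 + norm p) powr M"]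
        by (fastforce simp: add.commute intro: order_trans)
      then have "(DIM('a))\<^sup>2 * C * (norm h)\<^sup>2 * (1 + norm (p + s *\<^sub>R h)) powr M
          \<le> (DIM('a))\<^sup>2 * C * (norm h)\<^sup>2 * (2 powr \<bar>M\<bar> * (1 + norm p) powr M)"
        using C by (intro mult_left_mono) simp_all
      then show ?thesis using growth_le[OF dh, of "p + s *\<^sub>R h"]
        by (simp add: power2_eq_square ac_simps)
    qed
    \<comment> \<open>The increment of the first derivative is again an increment along a segment,
      here of direction \<open>s *\<^sub>R h\<close>. The parameter \<open>r * s\<close> stays in
      the unit interval, where the bound \<open>B\<close> on second derivatives holds.\<close>
    have d1: "norm (dderiv h f (p + s *\<^sub>R h) - dderiv h f p) \<le> ?B" if s: "s \<in> {0..1}" for s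
    proof -
      have "norm (dderiv h f (p + s *\<^sub>R h) - dderiv h f p) \<le> ?B"
      proof (rule norm_diff_along_le[OF smooth_differentiable[OF smooth_dderiv[OF f(1)]]])
        fix r :: real assume r: "r \<in> {0..1}"
        have "norm (dderiv h (dderiv h f) (p + (r * s) *\<^sub>R h)) \<le> ?B"
          using r s by (intro B) (simp add: mult_le_one)
        then have "s * norm (dderiv h (dderiv h f) (p + (r * s) *\<^sub>R h)) \<le> ?B"
          using s mult_left_le_one_le[OF norm_ge_zero, of s "dderiv h (dderiv h f) (p + (r * s) *\<^sub>R h)"]
          by auto
        then show "norm (dderiv (s *\<^sub>R h) (dderiv h f) (p + r *\<^sub>R s *\<^sub>R h)) \<le> ?B"
          using s by (simp add: dderiv_scaleR smooth_differentiable smooth_dderiv f(1) norm_mult)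
      qed
      then show ?thesis .
    qed
    have "norm ((f (p + 1 *\<^sub>R h) - of_real 1 * dderiv h f p) - (f (p + 0 *\<^sub>R h) - of_real 0 * dderiv h f p)) \<le> ?B"
    proof (rule norm_increment_le[OF _ d1])
      fix s :: real
      have "((\<lambda>s. complex_of_real s * dderiv h f p) has_derivative (\<lambda>k. of_real k * dderiv h f p)) (at s)"
        by (rule bounded_linear_imp_has_derivative) 
          (rule bounded_linear_compose[OF bounded_linear_mult_left bounded_linear_of_real])
      from has_derivative_diff[OF has_derivative_along[OF smooth_differentiable[OF f(1)]] this, of p h]
      show "((\<lambda>s. f (p + s *\<^sub>R h) - of_real s * dderiv h f p) has_derivative
          (\<lambda>k. of_real k * (dderiv h f (p + s *\<^sub>R h) - dderiv h f p))) (at s)"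
        by (simp add: right_diff_distrib)
    qed
    then show ?thesis by (simp add: algebra_simps)
  qed
  {
    case 0
    have "continuous_on UNIV (\<lambda>p. f (h + p) - f p - dderiv h f p)"
      using smooth_cont[OF 0(1)] smooth_cont[OF smooth_dderiv[OF 0(1)]]
        smooth_cont[OF smooth_affine_comp[OF bounded_linear_ident 0(1)]]
      by (intro continuous_on_diff) simp_all
    with base[OF 0] show ?case by simp
  next
    case (Suc n)
    have d: "smooth (\<lambda>p. f (h + p))" by (rule smooth_affine_comp[OF bounded_linear_ident Suc.prems(1)])
    note sd = smooth_differentiable smooth_dderiv d Suc.prems(1)
    have "dderiv v (\<lambda>p. f (h + p) - f p - dderiv h f p) =
        (\<lambda>p. dderiv v f (h + p) - dderiv v f p - dderiv h (dderiv v f) p)" for v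
      by (simp add: dderiv_diff differentiable_diff sd dderiv_translate dderiv_commute_smooth[of f v h])
    moreover have "(\<lambda>p. f (h + p) - f p - dderiv h f p) differentiable at p" for p
      by (intro differentiable_diff sd)
    moreover have "growth (Suc (Suc n)) M C (dderiv v f)" if "v \<in> Basis" for v
      using growth_dderiv[OF Suc.prems(2) that] .
    ultimately show ?case
      using base[OF Suc.prems(1) growth_order_mono[OF Suc.prems(2)]] Suc.IH smooth_dderiv[OF Suc.prems(1)]
      by (simp del: growth.simps(2) add: growth.simps(2)[of n])
  }
qed

section \<open>Oscillatory integrals\<close>

definition weight_mass :: "'a::euclidean_space itself \<Rightarrow> real" where
  "weight_mass _ = (LINT p|lborel. (1 + norm (p :: 'a)) powr (- 2 * DIM('a)))"

text \<open>The exponent is twice the dimension because the weight is then dominated by the product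
  over the coordinates of 1 / (1 + x^2), whose integral factorises.\<close>

lemma integrable_weight:
  "integrable lborel (\<lambda>p :: 'a::euclidean_space. (1 + norm p) powr (- 2 * real DIM('a)))"
proof (rule integrableI_bounded)
  have pos: "1 + x\<^sup>2 > 0" for x :: real by (simp add: add_pos_nonneg)
  have le: "(1 + norm p) powr (- 2 * real DIM('a)) \<le> (\<Prod>b\<in>Basis. inverse (1 + (p \<bullet> b)\<^sup>2))" for p :: 'a
  proof -
    have "1 + (p \<bullet> b)\<^sup>2 \<le> (1 + norm p) powr 2" if "b \<in> Basis" for b
    proof -
      have "\<bar>p \<bullet> b\<bar>\<^sup>2 \<le> (norm p)\<^sup>2" using Basis_le_norm[OF that, of p] by (intro power_mono) simp_all
      then show ?thesis by (simp add: power2_eq_square algebra_simps add_pos_nonneg powr_numeral)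
          (smt (verit) norm_ge_zero)
    qed
    then have "(\<Prod>b\<in>Basis. inverse (1 + (p \<bullet> b)\<^sup>2)) \<ge> (\<Prod>b\<in>(Basis :: 'a set). inverse ((1 + norm p) powr 2))"
      by (intro prod_mono conjI le_imp_inverse_le pos) simp_all
    moreover have "(\<Prod>b\<in>(Basis :: 'a set). inverse ((1 + norm p) powr 2)) = (1 + norm p) powr (- 2 * real DIM('a))"
      using powr_realpow[of "1 + norm p" "2 * DIM('a)"]
      by (simp add: powr_minus power_mult power_inverse add_pos_nonneg)
    ultimately show ?thesis by simp
  qed
  have "(\<integral>\<^sup>+p. norm ((1 + norm p) powr (- 2 * real DIM('a))) \<partial>(lborel :: 'a measure))
      \<le> (\<integral>\<^sup>+p. (\<Prod>b\<in>Basis. ennreal (inverse (1 + (p \<bullet> b)\<^sup>2))) \<partial>(lborel :: 'a measure))"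
    using le pos by (intro nn_integral_mono) (simp add: prod_ennreal less_imp_le ennreal_leI)
  also have "\<dots> = (\<Prod>b\<in>(Basis::'a set). (\<integral>\<^sup>+x. ennreal (inverse (1 + x\<^sup>2)) \<partial>lborel))"
    by (rule nn_integral_lborel_prod) simp_all
  also have "\<dots> < \<infinity>"
  proof -
    have "integrable lborel (\<lambda>x::real. inverse (1 + x\<^sup>2))"
      using integrable_inverse_1_plus_square by (simp add: set_integrable_def einterval_eq)
    from integrableD(2)[OF this] have "(\<integral>\<^sup>+x. ennreal (inverse (1 + x\<^sup>2)) \<partial>lborel) < \<infinity>"
      using pos by (simp add: less_top less_imp_le)
    then show ?thesis by (simp add: power_less_top_ennreal)
  qed
  finally show "(\<integral>\<^sup>+p. norm ((1 + norm p) powr (- 2 * real DIM('a))) \<partial>(lborel :: 'a measure)) < \<infinity>" .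
qed measurable

lemma weight_mass_nonneg: "0 \<le> weight_mass a"
  unfolding weight_mass_def by (rule integral_nonneg_AE) simp

lemma growth_integral:
  fixes f :: "'a::euclidean_space \<Rightarrow> complex"
  assumes f: "growth n M C f" and M: "M \<le> - 2 * real DIM('a)"
    and u: "continuous_on UNIV u" "\<And>p. norm (u p) \<le> 1"
  shows "integrable lborel (\<lambda>p. u p * f p)"
    and "norm (LINT p|lborel. u p * f p) \<le> weight_mass TYPE('a) * C"
proof -
  have le: "norm (u p * f p) \<le> C * (1 + norm p) powr (- 2 * real DIM('a))" for p
  proof -
    have "norm (u p * f p) \<le> 1 * (C * (1 + norm p) powr M)"
      unfolding norm_mult using u(2) growth_le[OF f] by (intro mult_mono) simp_all
    also have "\<dots> \<le> C * (1 + norm p) powr (- 2 * real DIM('a))"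
      using growth_nonneg[OF f] M by (simp add: mult_left_mono powr_mono)
    finally show ?thesis .
  qed
  have [measurable]: "u \<in> borel_measurable borel" "f \<in> borel_measurable borel"
    using growth_cont[OF f] u(1) by (auto intro: borel_measurable_continuous_onI)
  show int: "integrable lborel (\<lambda>p. u p * f p)"
    by (rule Bochner_Integration.integrable_bound[OF integrable_mult_right[OF integrable_weight, of C]])
      (use order_trans[OF le abs_ge_self] in auto)
  have "norm (LINT p|lborel. u p * f p) \<le> (LINT p|lborel. norm (u p * f p))"
    by (rule integral_norm_bound)
  also have "\<dots> \<le> (LINT p|lborel. C * (1 + norm (p::'a)) powr (- 2 * real DIM('a)))"
    by (intro integral_mono integrable_norm int integrable_mult_right integrable_weight le)
  finally show "norm (LINT p|lborel. u p * f p) \<le> weight_mass TYPE('a) * C"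
    by (simp add: weight_mass_def mult.commute)
qed

lemma rapid_cont: "rapid f \<Longrightarrow> continuous_on UNIV f"
  using tame_smooth[OF rapid_tame] smooth_cont by blast

lemma rapid_smooth: "rapid f \<Longrightarrow> smooth f"
  using tame_smooth[OF rapid_tame] by blast

lemma rapid_integrable:
  fixes f :: "'a::euclidean_space \<Rightarrow> complex"
  assumes "rapid f" shows "integrable lborel f"
proof -
  obtain C where "growth 0 (- 2 * real DIM('a)) C f"
    using assms unfolding rapid_def tame_def by blast
  from growth_integral(1)[OF this, of "\<lambda>_. 1"] show ?thesis by simp
qed

lemma integral_translate:
  fixes f :: "'a::euclidean_space \<Rightarrow> complex"
  assumes "continuous_on UNIV f"
  shows "(LINT p|lborel. f (q + p)) = (LINT p|lborel. f p)"
proof -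
  have [measurable]: "f \<in> borel_measurable borel" using assms by (rule borel_measurable_continuous_onI)
  have "(LINT p|lborel. f p) = (LINT p|distr lborel borel ((+) q). f p)"
    by (simp add: lborel_distr_plus)
  also have "\<dots> = (LINT p|lborel. f (q + p))" by (rule integral_distr) measurable
  finally show ?thesis ..
qed

text \<open>The integral of a difference quotient vanishes by translation invariance.\<close>

lemma integral_dderiv:
  fixes f :: "'a::euclidean_space \<Rightarrow> complex"
  assumes f: "rapid f"
  shows "(LINT p|lborel. dderiv v f p) = 0"
proof -
  let ?M = "- 2 * real DIM('a)"
  obtain C where C: "growth 2 ?M C f" using f unfolding rapid_def tame_def by blast
  note sm = rapid_smooth[OF f]
  define K where "K = weight_mass TYPE('a) * ((DIM('a))\<^sup>2 * 2 powr \<bar>?M\<bar> * C * (norm v)\<^sup>2)"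
  have le: "norm (LINT p|lborel. dderiv v f p) \<le> t * K" if t: "0 < t" "t * norm v \<le> 1" for t
  proof -
    have "norm (t *\<^sub>R v) \<le> 1" using t by simp
    from growth_taylor[OF this sm C[unfolded numeral_2_eq_2]]
    have g: "growth 0 ?M ((DIM('a))\<^sup>2 * 2 powr \<bar>?M\<bar> * C * (norm (t *\<^sub>R v))\<^sup>2)
       (\<lambda>p. f (t *\<^sub>R v + p) - f p - dderiv (t *\<^sub>R v) f p)" .
    have "dderiv (t *\<^sub>R v) f p = of_real t * dderiv v f p" for p
      by (rule dderiv_scaleR[OF smooth_differentiable[OF sm]])
    with growth_integral(2)[OF g, of "\<lambda>_. 1"]
    have "norm (LINT p|lborel. f (t *\<^sub>R v + p) - f p - of_real t * dderiv v f p)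
       \<le> weight_mass TYPE('a) * ((DIM('a))\<^sup>2 * 2 powr \<bar>?M\<bar> * C * (norm (t *\<^sub>R v))\<^sup>2)"
      by simp
    \<comment> \<open>The Taylor remainder integrates to order \<open>t\<close> squared, whereas the
      integral in question enters with factor \<open>t\<close>. Division by \<open>t\<close> leaves
      \<open>t * K\<close>, which tends to 0.\<close>
    also have "\<dots> = t * (t * K)" by (simp add: K_def power_mult_distrib power2_eq_square)
    also have "(LINT p|lborel. f (t *\<^sub>R v + p) - f p - of_real t * dderiv v f p)
        = - of_real t * (LINT p|lborel. dderiv v f p)"
      using rapid_integrable[OF f] rapid_integrable[OF rapid_dderiv[OF f]]
        rapid_integrable[OF rapid_translate[OF f]] integral_translate[OF rapid_cont[OF f]]
      by simp
    finally have "t * norm (LINT p|lborel. dderiv v f p) \<le> t * (t * K)" using t by (simp add: norm_mult)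
    then show ?thesis using t by simp
  qed
  have "norm (LINT p|lborel. dderiv v f p) \<le> 0"
  proof (rule tendsto_lowerbound)
    show "((\<lambda>t. t * K) \<longlongrightarrow> 0) (at_right 0)" by (auto intro!: tendsto_eq_intros)
    have "eventually (\<lambda>t. t < 1 / (norm v + 1)) (at_right (0::real))"
      by (intro order_tendstoD(2)[OF tendsto_ident_at]) (simp add: add_nonneg_pos)
    moreover have "eventually (\<lambda>t. t > 0) (at_right (0::real))" by (simp add: eventually_at_right_less)
    ultimately show "eventually (\<lambda>t. norm (LINT p|lborel. dderiv v f p) \<le> t * K) (at_right 0)"
    proof eventually_elim
      case (elim t)
      then have "t * (norm v + 1) < 1" by (simp add: pos_less_divide_eq add_nonneg_pos)
      with elim show ?case by (intro le) (simp_all add: algebra_simps)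
    qed
  qed simp
  then show ?thesis by simp
qed

text \<open>A quadratic phase is not of any fixed order, since each derivative produces another
  linear factor, so \<open>rapid_mult_tame\<close> does not apply. But a derivative of
  \<open>u\<close> times a rapid function is again \<open>u\<close> times a rapid function, and
  \<open>u\<close> has modulus 1.\<close>

lemma rapid_times_phase:
  fixes u :: "'a::euclidean_space \<Rightarrow> complex"
  assumes u: "\<And>p. norm (u p) = 1" "\<And>p. u differentiable at p"
    "\<And>v. dderiv v u = (\<lambda>p. c v p * u p)" "\<And>v. tame 1 (c v)"
    and f: "rapid f"
  shows "rapid (\<lambda>p. u p * f p)"
proof -
  have "\<exists>C. growth n M C (\<lambda>p. u p * f p)" for n M
    using f
  proof (induction n arbitrary: f)
    have cont: "continuous_on UNIV u"
      using u(2) by (auto intro!: continuous_at_imp_continuous_on differentiable_imp_continuous_within)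
    case 0
    then obtain C where C: "growth 0 M C f" unfolding rapid_def tame_def by blast
    have "growth 0 M C (\<lambda>p. u p * f p)"
      using C cont u(1) by (auto simp: norm_mult intro: continuous_on_mult)
    then show ?case by blast
  next
    case (Suc n)
    have diff: "f differentiable at p" for p by (rule smooth_differentiable[OF rapid_smooth[OF Suc.prems]])
    show ?case
    proof (rule ex_growth_SucI)
      show "\<exists>C. growth 0 M C (\<lambda>p. u p * f p)"
        using Suc.IH[OF Suc.prems] growth_order_mono[of n M _ _ 0] by blast
      show "\<exists>C. growth n M C (dderiv v (\<lambda>p. u p * f p))" for v
      proof -
        have "dderiv v (\<lambda>p. u p * f p) = (\<lambda>p. u p * (dderiv v f p + f p * c v p))"
          using dderiv_mult[of u f v] u diff by (simp add: algebra_simps)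
        moreover have "rapid (\<lambda>p. dderiv v f p + f p * c v p)"
          by (intro rapid_add rapid_dderiv rapid_mult_tame[OF _ u(4)] Suc.prems)
        ultimately show ?thesis using Suc.IH by simp
      qed
    qed (intro differentiable_mult u(2) diff)
  qed
  then show ?thesis by (simp add: rapid_def tame_def)
qed

section \<open>The oscillatory phase and integration by parts\<close>

lemma has_derivative_cis:
  assumes "(q has_derivative q') (at p)"
  shows "((\<lambda>p. exp (- (\<i> * complex_of_real (q p)))) has_derivative
    (\<lambda>v. (- \<i> * of_real (q' v)) * exp (- (\<i> * of_real (q p))))) (at p)"
proof -
  have "((\<lambda>p. - (\<i> * complex_of_real (q p))) has_derivative (\<lambda>v. - (\<i> * of_real (q' v)))) (at p)"
    by (intro has_derivative_minus has_derivative_mult_right has_derivative_of_real assms)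
  from has_derivative_compose[OF this DERIV_exp[unfolded has_field_derivative_def]]
  show ?thesis by (simp add: mult.commute)
qed

definition osc_phase :: "'b::euclidean_space \<times> 'b \<Rightarrow> complex" where
  "osc_phase p = exp (- (\<i> * of_real (fst p \<bullet> snd p)))"

definition osc :: "('b::euclidean_space \<times> 'b \<Rightarrow> complex) \<Rightarrow> complex" where
  "osc f = (LINT p|lborel. osc_phase p * f p)"

lemma norm_osc_phase [simp]: "norm (osc_phase p) = 1"
  by (simp add: osc_phase_def)

lemma inner_swap: "prod.swap p \<bullet> v = p \<bullet> prod.swap v"
  by (simp add: inner_prod_def add.commute prod.swap_def)

lemma has_derivative_osc_phase:
  fixes p :: "'b::euclidean_space \<times> 'b"
  shows "(osc_phase has_derivative (\<lambda>v. (- \<i> * of_real (prod.swap p \<bullet> v)) * osc_phase p)) (at p)"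
proof -
  have "((\<lambda>p :: 'b \<times> 'b. fst p \<bullet> snd p) has_derivative (\<lambda>v. fst p \<bullet> snd v + fst v \<bullet> snd p)) (at p)"
    by (intro has_derivative_inner has_derivative_fst has_derivative_snd has_derivative_ident)
  from has_derivative_cis[OF this] show ?thesis
    by (simp add: osc_phase_def[abs_def] inner_prod_def inner_commute add.commute prod.swap_def)
qed

lemma dderiv_osc_phase: "dderiv v osc_phase = (\<lambda>p. (- \<i> * of_real (p \<bullet> prod.swap v)) * osc_phase p)"
  using has_derivative_osc_phase by (intro ext dderiv_eqI) (simp add: inner_swap)

lemma differentiable_osc_phase: "osc_phase differentiable at p"
  using has_derivative_osc_phase by (rule differentiableI)

lemma continuous_osc_phase: "continuous_on UNIV osc_phase"
  using differentiable_osc_phase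
  by (auto intro!: continuous_at_imp_continuous_on differentiable_imp_continuous_within)

lemma rapid_osc_phase: "rapid f \<Longrightarrow> rapid (\<lambda>p. osc_phase p * f p)"
  by (rule rapid_times_phase[where c = "\<lambda>v p. - \<i> * of_real (p \<bullet> prod.swap v)",
        OF norm_osc_phase differentiable_osc_phase dderiv_osc_phase tame_cmult[OF tame_inner]])

lemma osc_integrable: "rapid f \<Longrightarrow> integrable lborel (\<lambda>p. osc_phase p * f p)"
  by (intro rapid_integrable rapid_osc_phase)

lemma osc_add: "rapid f \<Longrightarrow> rapid g \<Longrightarrow> osc (\<lambda>p. f p + g p) = osc f + osc g"
  by (simp add: osc_def distrib_left osc_integrable)

lemma osc_diff: "rapid f \<Longrightarrow> rapid g \<Longrightarrow> osc (\<lambda>p. f p - g p) = osc f - osc g"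
  by (simp add: osc_def right_diff_distrib osc_integrable)

lemma osc_cmult: "osc (\<lambda>p. c * f p) = c * osc f"
  by (simp add: osc_def mult.left_commute[of _ c])

lemma osc_sum: "finite I \<Longrightarrow> (\<And>i. i \<in> I \<Longrightarrow> rapid (f i)) \<Longrightarrow> osc (\<lambda>p. \<Sum>i\<in>I. f i p) = (\<Sum>i\<in>I. osc (f i))"
  by (simp add: osc_def sum_distrib_left osc_integrable)

text \<open>The gradient of the inner product of the two halves of \<open>p\<close> is
  \<open>prod.swap p\<close>. Hence integration by parts turns a derivative in a space direction
  into multiplication by the covariable coordinate, and conversely.\<close>

lemma osc_dderiv:
  assumes f: "rapid f"
  shows "osc (dderiv v f) = \<i> * osc (\<lambda>p. of_real (p \<bullet> prod.swap v) * f p)"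
proof -
  have "dderiv v (\<lambda>p. osc_phase p * f p)
      = (\<lambda>p. osc_phase p * dderiv v f p - \<i> * (osc_phase p * (of_real (p \<bullet> prod.swap v) * f p)))"
    using dderiv_mult[OF differentiable_osc_phase smooth_differentiable[OF rapid_smooth[OF f]], of v]
    by (simp add: dderiv_osc_phase algebra_simps)
  moreover have "rapid (\<lambda>p. of_real (p \<bullet> prod.swap v) * f p)"
    using rapid_mult_tame[OF f tame_inner] by (simp add: mult.commute)
  ultimately show ?thesis
    using integral_dderiv[OF rapid_osc_phase[OF f], of v] osc_integrable[OF rapid_dderiv[OF f], of v]
      osc_integrable[of "\<lambda>p. of_real (p \<bullet> prod.swap v) * f p"]
    by (simp add: osc_def)
qed

text \<open>The transpose of \<open>(1 + |p|\<^sup>2)\<^sup>-\<^sup>1 (1 + i \<Sum>\<^sub>v (p \<bullet> prod.swap v) \<partial>\<^sub>v)\<close>, an operator that fixes the phase.\<close>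

definition osc_transpose :: "('b::euclidean_space \<times> 'b \<Rightarrow> complex) \<Rightarrow> 'b \<times> 'b \<Rightarrow> complex" where
  "osc_transpose f p = japanese p * f p +
     (- \<i>) * (\<Sum>v\<in>Basis. dderiv v (\<lambda>p. of_real (p \<bullet> prod.swap v) * (japanese p * f p)) p)"

lemma rapid_osc_transpose_parts:
  assumes f: "rapid f"
  shows "rapid (\<lambda>p. japanese p * f p)" "rapid (\<lambda>p. of_real (p \<bullet> w) * (japanese p * f p))"
proof -
  show "rapid (\<lambda>p. japanese p * f p)"
    using rapid_mult_tame[OF f tame_japanese] by (simp add: mult.commute)
  from rapid_mult_tame[OF this tame_inner] show "rapid (\<lambda>p. of_real (p \<bullet> w) * (japanese p * f p))"
    by (simp add: mult.commute)
qed

lemma rapid_osc_transpose: "rapid f \<Longrightarrow> rapid (osc_transpose f)"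
  unfolding osc_transpose_def[abs_def]
  by (intro rapid_add rapid_cmult rapid_sum rapid_dderiv rapid_osc_transpose_parts) simp_all

text \<open>Integration by parts sends the summand for \<open>v\<close> to the square of the
  coordinate of \<open>p\<close> along \<open>prod.swap v\<close>, the signs cancelling by -i * i =
  1. The squares sum to \<open>p \<bullet> p\<close>; with the first summand this is
  \<open>1 + p \<bullet> p\<close>, which cancels \<open>japanese\<close>.\<close>

lemma osc_osc_transpose:
  fixes f :: "'b::euclidean_space \<times> 'b \<Rightarrow> complex"
  assumes f: "rapid f"
  shows "osc (osc_transpose f) = osc f"
proof -
  note rp = rapid_osc_transpose_parts[OF f]
  have pos: "1 + p \<bullet> p \<noteq> 0" for p :: "'b \<times> 'b" by (simp add: add_nonneg_eq_0_iff)
  have "osc (osc_transpose f) = osc (\<lambda>p. japanese p * f p) +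
      (- \<i>) * (\<Sum>v\<in>Basis. \<i> * osc (\<lambda>p. of_real (p \<bullet> prod.swap v) * (of_real (p \<bullet> prod.swap v) * (japanese p * f p))))"
    unfolding osc_transpose_def[abs_def]
    by (simp only: osc_add[OF rp(1) rapid_cmult[OF rapid_sum[OF finite_Basis rapid_dderiv[OF rp(2)]]]] osc_cmult
       osc_sum[OF finite_Basis rapid_dderiv[OF rp(2)]] osc_dderiv[OF rp(2)])
  also have "\<dots> = osc (\<lambda>p. japanese p * f p) +
      (\<Sum>v\<in>Basis. osc (\<lambda>p. of_real (p \<bullet> prod.swap v) * (of_real (p \<bullet> prod.swap v) * (japanese p * f p))))"
    by (simp add: sum_distrib_left flip: mult.assoc)
  also have "\<dots> = osc (\<lambda>p. japanese p * f p + (\<Sum>v\<in>Basis. of_real (p \<bullet> prod.swap v) * (of_real (p \<bullet> prod.swap v) * (japanese p * f p))))"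
  proof -
    have r2: "rapid (\<lambda>p. of_real (p \<bullet> prod.swap v) * (of_real (p \<bullet> prod.swap v) * (japanese p * f p)))" for v
      using rapid_mult_tame[OF rp(2) tame_inner]
      by (subst mult.commute)
    show ?thesis by (simp add: osc_add osc_sum r2 rp rapid_sum)
  qed
  also have "(\<lambda>p. japanese p * f p + (\<Sum>v\<in>Basis. of_real (p \<bullet> prod.swap v) * (of_real (p \<bullet> prod.swap v) * (japanese p * f p)))) = f"
  proof
    fix p :: "'b \<times> 'b"
    have "(\<Sum>v\<in>Basis. (p \<bullet> prod.swap v) * (p \<bullet> prod.swap v)) = prod.swap p \<bullet> prod.swap p"
      using euclidean_inner[of "prod.swap p" "prod.swap p"] by (simp add: inner_swap)
    also have "\<dots> = p \<bullet> p" by (simp add: inner_swap)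
    finally have "(\<Sum>v\<in>Basis. complex_of_real (p \<bullet> prod.swap v) * of_real (p \<bullet> prod.swap v)) = of_real (p \<bullet> p)"
      by (metis (mono_tags, lifting) of_real_mult of_real_sum sum.cong)
    then have "(\<Sum>v\<in>Basis. of_real (p \<bullet> prod.swap v) * (of_real (p \<bullet> prod.swap v) * (japanese p * f p)))
        = of_real (p \<bullet> p) * (japanese p * f p)"
      by (simp flip: mult.assoc sum_distrib_right)
    moreover have "complex_of_real (1 + p \<bullet> p) * japanese p = 1"
      unfolding japanese_def of_real_mult[symmetric] using pos[of p] by simp
    then have "japanese p * f p + of_real (p \<bullet> p) * (japanese p * f p) = f p"
      by (metis (no_types, lifting) distrib_right mult.assoc mult_1 of_real_1 of_real_add)
    ultimately show "japanese p * f p + (\<Sum>v\<in>Basis. of_real (p \<bullet> prod.swap v) * (of_real (p \<bullet> prod.swap v) * (japanese p * f p))) = f p"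
      by simp
  qed
  finally show ?thesis .
qed

text \<open>The worst term combines order -2 from \<open>japanese\<close> with order 1 from the
  linear factor, and its derivative gains nothing: a net gain of one power for one derivative. The
  constant \<open>c\<close> is chosen before \<open>C\<close> and \<open>f\<close>, so the estimate
  can be iterated.\<close>

lemma growth_osc_transpose:
  "\<exists>c\<ge>0. \<forall>C. \<forall>f :: 'b::euclidean_space \<times> 'b \<Rightarrow> complex.
     growth (Suc n) M C f \<longrightarrow> growth n (M - 1) (c * C) (osc_transpose f)"
proof -
  obtain J where J: "growth (Suc n) (-2) J (japanese :: 'b \<times> 'b \<Rightarrow> complex)"
    using tame_japanese unfolding tame_def by blast
  define c1 where "c1 = 2 ^ Suc n * J"
  define c2 where "c2 = 2 ^ Suc n * c1"
  have J0: "0 \<le> J" by (rule growth_nonneg[OF J])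
  have c: "0 \<le> c1" "0 \<le> c2" using J0 by (simp_all add: c1_def c2_def)
  have "growth n (M - 1) ((c1 + (\<Sum>v\<in>(Basis::('b \<times> 'b) set). c2)) * C) (osc_transpose f)"
    if f: "growth (Suc n) M C f" for C and f :: "'b \<times> 'b \<Rightarrow> complex"
  proof -
    have g1: "growth (Suc n) (M - 2) (c1 * C) (\<lambda>p. japanese p * f p)"
      using growth_mult[OF J f] by (simp add: c1_def)
    have g2: "growth n (M - 1) (c2 * C) (dderiv v (\<lambda>p. of_real (p \<bullet> prod.swap v) * (japanese p * f p)))"
      if v: "v \<in> Basis" for v
    proof -
      have "norm (prod.swap v) = norm v"
        by (simp add: norm_eq_sqrt_inner inner_swap)
      then show ?thesis
        using growth_dderiv[OF growth_mult[OF growth_inner g1] v, of "prod.swap v"] v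
        by (simp add: c2_def mult.assoc)
    qed
    have "growth n (M - 1) (c1 * C + norm (- \<i>) * (\<Sum>v\<in>(Basis::('b \<times> 'b) set). c2 * C)) (osc_transpose f)"
      unfolding osc_transpose_def[abs_def]
      by (intro growth_add growth_cmult growth_sum finite_Basis g2 growth_mono[OF growth_Suc[OF g1]]) simp_all
    then show ?thesis by (simp add: distrib_right mult.assoc)
  qed
  moreover have "0 \<le> c1 + (\<Sum>v\<in>(Basis::('b \<times> 'b) set). c2)" using c by simp
  ultimately show ?thesis by blast
qed

lemma growth_osc_transpose_iter:
  "\<exists>c\<ge>0. \<forall>C. \<forall>f :: 'b::euclidean_space \<times> 'b \<Rightarrow> complex.
     growth k M C f \<longrightarrow> growth 0 (M - real k) (c * C) ((osc_transpose ^^ k) f)"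
proof (induction k arbitrary: M)
  case 0
  show ?case by (rule exI[of _ 1]) simp
next
  case (Suc k)
  from Suc[of "M - 1"] obtain c where c: "c \<ge> 0" 
    "\<And>C f. growth k (M - 1) C (f :: 'b \<times> 'b \<Rightarrow> complex) \<Longrightarrow> growth 0 (M - 1 - real k) (c * C) ((osc_transpose ^^ k) f)"
    by blast
  obtain c' where c': "c' \<ge> 0" 
    "\<And>C f. growth (Suc k) M C (f :: 'b \<times> 'b \<Rightarrow> complex) \<Longrightarrow> growth k (M - 1) (c' * C) (osc_transpose f)"
    using growth_osc_transpose by blast
  have "growth 0 (M - real (Suc k)) (c * c' * C) ((osc_transpose ^^ Suc k) f)"
    if "growth (Suc k) M C f" for C and f :: "'b \<times> 'b \<Rightarrow> complex"
    using c(2)[OF c'(2)[OF that]] by (simp add: funpow_swap1 mult.assoc algebra_simps)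
  then show ?case using mult_nonneg_nonneg[OF c(1) c'(1)] by blast
qed

text \<open>Each integration by parts gains one power of decay.\<close>

lemma osc_bound:
  obtains k c where "0 \<le> c"
    "\<And>C f. rapid f \<Longrightarrow> growth k M C (f :: 'b::euclidean_space \<times> 'b \<Rightarrow> complex) \<Longrightarrow> norm (osc f) \<le> c * C"
proof -
  \<comment> \<open>The number of integrations by parts that bring the order from \<open>M\<close>
    into the integrable range.\<close>
  define k where "k = nat \<lceil>M + 2 * real DIM('b \<times> 'b)\<rceil>"
  have k: "M - real k \<le> - 2 * real DIM('b \<times> 'b)" unfolding k_def by linarith
  obtain c where c: "c \<ge> 0"
    "\<And>C f. growth k M C (f :: 'b \<times> 'b \<Rightarrow> complex) \<Longrightarrow> growth 0 (M - real k) (c * C) ((osc_transpose ^^ k) f)"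
    using growth_osc_transpose_iter by blast
  have "norm (osc f) \<le> weight_mass TYPE('b \<times> 'b) * c * C"
    if f: "rapid f" "growth k M C f" for C and f :: "'b \<times> 'b \<Rightarrow> complex"
  proof -
    have "rapid ((osc_transpose ^^ j) f) \<and> osc ((osc_transpose ^^ j) f) = osc f" for j
      by (induction j) (simp_all add: f(1) rapid_osc_transpose osc_osc_transpose)
    then have "osc f = (LINT p|lborel. osc_phase p * (osc_transpose ^^ k) f p)"
      by (simp add: osc_def)
    then show ?thesis
      using growth_integral(2)[OF c(2)[OF f(2)] k continuous_osc_phase] by (simp add: mult.assoc)
  qed
  with mult_nonneg_nonneg[OF weight_mass_nonneg c(1)] show thesis by (rule that)
qed

section \<open>The Fourier transform of the Gaussian and Fourier inversion\<close>

text \<open>The number (2 pi)^(d/2), carried as a symbol; \<open>gauss_mass_nonzero\<close> permits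
  division by it.\<close>

definition gauss_mass :: "'b::euclidean_space itself \<Rightarrow> complex" where
  "gauss_mass _ = (LINT z|lborel. gauss (z :: 'b))"

lemma norm_gauss_le: "norm (gauss p) \<le> 1"
  by (simp add: gauss_def)

lemma gauss_0 [simp]: "gauss 0 = 1"
  by (simp add: gauss_def)

text \<open>A strictly positive function with integral 0 would make the whole space a null
  set.\<close>

lemma gauss_mass_nonzero: "gauss_mass TYPE('b::euclidean_space) \<noteq> 0"
proof
  assume z: "gauss_mass TYPE('b) = 0"
  let ?g = "\<lambda>z :: 'b. exp (- (z \<bullet> z) / 2)"
  have int: "integrable lborel ?g"
    using rapid_integrable[OF rapid_gauss] unfolding gauss_def[abs_def] complex_of_real_integrable_eq .
  have "complex_of_real (LINT z|lborel. ?g z) = 0"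
    using z unfolding gauss_mass_def gauss_def[abs_def] integral_complex_of_real .
  then have "(LINT z|lborel. ?g z) = 0" by simp
  then have "AE z in (lborel :: 'b measure). ?g z = 0"
    using integral_nonneg_eq_0_iff_AE[OF int] by simp
  then have "AE z in (lborel :: 'b measure). False" by simp
  then have "emeasure (lborel :: 'b measure) UNIV = 0"
    using AE_iff_measurable[of UNIV "lborel :: 'b measure" "\<lambda>_. False"] by simp
  then show False by simp
qed

text \<open>The formula of \<open>fourier\<close>, freed of the coordinate space;
  \<open>fourier_conv_ft\<close> identifies the two.\<close>

definition ft :: "('b::euclidean_space \<Rightarrow> complex) \<Rightarrow> 'b \<Rightarrow> complex" where
  "ft f \<xi> = (LINT y|lborel. f y * exp (- (\<i> * of_real (y \<bullet> \<xi>))))"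

lemma has_derivative_char:
  "((\<lambda>y :: 'b::euclidean_space. exp (- (\<i> * complex_of_real (y \<bullet> \<xi>)))) has_derivative
     (\<lambda>v. (- \<i> * of_real (v \<bullet> \<xi>)) * exp (- (\<i> * of_real (y \<bullet> \<xi>))))) (at y)"
  by (rule has_derivative_cis) (rule has_derivative_inner_left[OF has_derivative_ident])

lemma rapid_char:
  assumes "rapid f"
  shows "rapid (\<lambda>y :: 'b::euclidean_space. exp (- (\<i> * complex_of_real (y \<bullet> \<xi>))) * f y)"
proof (rule rapid_times_phase[where c = "\<lambda>v _. - \<i> * of_real (v \<bullet> \<xi>)"])
  show "dderiv v (\<lambda>y :: 'b. exp (- (\<i> * complex_of_real (y \<bullet> \<xi>)))) =
      (\<lambda>y. (- \<i> * of_real (v \<bullet> \<xi>)) * exp (- (\<i> * of_real (y \<bullet> \<xi>))))" for v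
    by (intro ext dderiv_eqI has_derivative_char)
  show "tame 1 (\<lambda>_ :: 'b. - \<i> * complex_of_real (v \<bullet> \<xi>))" for v
    by (rule tame_mono[OF tame_const]) simp
  show "(\<lambda>y :: 'b. exp (- (\<i> * complex_of_real (y \<bullet> \<xi>)))) differentiable at y" for y
    by (rule differentiableI[OF has_derivative_char])
qed (simp_all add: assms)

lemma rapid_mult_char:
  assumes "rapid f"
  shows "rapid (\<lambda>y :: 'b::euclidean_space. f y * exp (- (\<i> * complex_of_real (y \<bullet> \<xi>))))"
  using rapid_char[OF assms] by (simp add: mult.commute)

lemma ft_dderiv:
  fixes f :: "'b::euclidean_space \<Rightarrow> complex"
  assumes f: "rapid f"
  shows "ft (dderiv v f) \<xi> = \<i> * of_real (v \<bullet> \<xi>) * ft f \<xi>"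
proof -
  let ?e = "\<lambda>y :: 'b. exp (- (\<i> * complex_of_real (y \<bullet> \<xi>)))"
  have "dderiv v ?e = (\<lambda>y. (- \<i> * of_real (v \<bullet> \<xi>)) * ?e y)"
    by (intro ext dderiv_eqI has_derivative_char)
  then have "dderiv v (\<lambda>y. f y * ?e y) = (\<lambda>y. dderiv v f y * ?e y - (\<i> * of_real (v \<bullet> \<xi>)) * (f y * ?e y))"
    using dderiv_mult[OF smooth_differentiable[OF rapid_smooth[OF f]] differentiableI[OF has_derivative_char], of v \<xi>]
    by (simp add: algebra_simps)
  then have "(LINT y|lborel. dderiv v f y * ?e y - (\<i> * of_real (v \<bullet> \<xi>)) * (f y * ?e y)) = 0"
    using integral_dderiv[OF rapid_mult_char[OF f], of v \<xi>] by simp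
  then show ?thesis
    using rapid_integrable[OF rapid_mult_char[OF rapid_dderiv[OF f]]] rapid_integrable[OF rapid_mult_char[OF f]]
    by (simp add: ft_def)
qed

lemma norm_ft_le: "norm (ft f \<xi>) \<le> (LINT y|lborel. norm (f y))"
  unfolding ft_def by (rule order_trans[OF integral_norm_bound]) (simp add: norm_mult)

lemma ft_measurable [measurable]:
  assumes [measurable]: "f \<in> borel_measurable borel"
  shows "ft f \<in> borel_measurable borel"
proof -
  have *: "(\<lambda>(\<xi>, y). f y * exp (- (\<i> * complex_of_real (y \<bullet> \<xi>)))) \<in> borel_measurable (lborel \<Otimes>\<^sub>M lborel)"
    unfolding split_beta' by measurable
  have "(\<lambda>\<xi>. LINT y|lborel. f y * exp (- (\<i> * complex_of_real (y \<bullet> \<xi>)))) \<in> borel_measurable lborel"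
    by (rule lborel.borel_measurable_lebesgue_integral) (use * in simp)
  then show ?thesis by (simp add: ft_def[abs_def])
qed

lemma rapid_borel [measurable]: "rapid f \<Longrightarrow> f \<in> borel_measurable borel"
  by (intro borel_measurable_continuous_onI rapid_cont)

text \<open>Bounds against powers of single coordinates suffice, since the norm is comparable to the
  largest coordinate. The lemma serves twice: for Fourier transforms, where a coordinate power comes
  from differentiating the function, and for the monomial bounds defining
  \<open>schwartz\<close>.\<close>

lemma moment_decay:
  fixes F :: "'b::euclidean_space \<Rightarrow> complex"
  assumes N: "- M \<le> real N" and C0: "\<And>\<xi>. norm (F \<xi>) \<le> C0"
    and C: "\<And>v \<xi>. v \<in> Basis \<Longrightarrow> \<bar>\<xi> \<bullet> v\<bar> ^ N * norm (F \<xi>) \<le> C v"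
  shows "\<exists>D. \<forall>\<xi>. norm (F \<xi>) \<le> D * (1 + norm \<xi>) powr M"
proof -
  define D where "D = real (DIM('b) + 1)"
  have nn: "0 \<le> C0" "v \<in> Basis \<Longrightarrow> 0 \<le> C v" for v
    using order_trans[OF norm_ge_zero C0] order_trans[OF mult_nonneg_nonneg[OF zero_le_power[OF abs_ge_zero] norm_ge_zero] C]
    by blast+
  have "norm (F \<xi>) \<le> D ^ N * (C0 + (\<Sum>v\<in>Basis. C v)) * (1 + norm \<xi>) powr M" for \<xi>
  proof -
    \<comment> \<open>Including 1 in the maximum covers the points near the origin, where
      \<open>C0\<close> is the bound that counts.\<close>
    define m where "m = Max (insert 1 ((\<lambda>v. \<bar>\<xi> \<bullet> v\<bar>) ` Basis))"
    have m1: "1 \<le> m" and mv: "\<And>v. v \<in> Basis \<Longrightarrow> \<bar>\<xi> \<bullet> v\<bar> \<le> m"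
      unfolding m_def by (rule Max_ge; simp)+
    have "1 + norm \<xi> \<le> 1 + (\<Sum>v\<in>Basis. \<bar>\<xi> \<bullet> v\<bar>)" using norm_le_l1[of \<xi>] by simp
    also have "\<dots> \<le> m + (\<Sum>v\<in>(Basis::'b set). m)" by (intro add_mono m1 sum_mono mv)
    also have "\<dots> = D * m" by (simp add: D_def distrib_right)
    finally have le: "1 + norm \<xi> \<le> D * m" .
    have "m ^ N * norm (F \<xi>) \<le> C0 + (\<Sum>v\<in>Basis. C v)"
    proof -
      have "m \<in> insert 1 ((\<lambda>v. \<bar>\<xi> \<bullet> v\<bar>) ` Basis)" unfolding m_def by (intro Max_in) auto
      then consider "m = 1" | v where "v \<in> Basis" "m = \<bar>\<xi> \<bullet> v\<bar>" by auto
      then show ?thesis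
      proof cases
        case 1
        then show ?thesis using C0[of \<xi>] nn by (simp add: sum_nonneg add_increasing2)
      next
        case (2 v)
        have "m ^ N * norm (F \<xi>) \<le> C v" using C[OF 2(1), of \<xi>] 2 by simp
        also have "\<dots> \<le> (\<Sum>v\<in>Basis. C v)" using 2 nn by (intro member_le_sum) auto
        finally show ?thesis using nn by simp
      qed
    qed
    then have *: "D ^ N * (m ^ N * norm (F \<xi>)) \<le> D ^ N * (C0 + (\<Sum>v\<in>Basis. C v))"
      by (intro mult_left_mono) (simp_all add: D_def)
    have "(1 + norm \<xi>) powr (- M) \<le> (1 + norm \<xi>) ^ N"
      using powr_mono[OF N, of "1 + norm \<xi>"] by (simp add: powr_realpow add_pos_nonneg)
    also have "\<dots> \<le> (D * m) ^ N" using le by (intro power_mono) simp_all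
    finally have "(1 + norm \<xi>) powr (- M) * norm (F \<xi>) \<le> (D * m) ^ N * norm (F \<xi>)"
      by (rule mult_right_mono) simp
    also have "\<dots> \<le> D ^ N * (C0 + (\<Sum>v\<in>Basis. C v))" using * by (simp add: power_mult_distrib mult.assoc)
    finally have "inverse ((1 + norm \<xi>) powr M) * norm (F \<xi>) \<le> D ^ N * (C0 + (\<Sum>v\<in>Basis. C v))"
      by (simp add: powr_minus)
    moreover have "a \<le> c * P" if "inverse P * a \<le> c" "0 < P" for a c P :: real
      using that by (simp add: field_simps)
    ultimately show ?thesis by (simp add: add_nonneg_eq_0_iff)
  qed
  then show ?thesis by blast
qed

lemma ft_decay:
  fixes f :: "'b::euclidean_space \<Rightarrow> complex"
  assumes f: "rapid f"
  shows "\<exists>C. \<forall>\<xi>. norm (ft f \<xi>) \<le> C * (1 + norm \<xi>) powr M"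
proof -
  define N where "N = nat \<lceil>- M\<rceil>"
  have N: "- M \<le> real N" unfolding N_def by linarith
  have r: "rapid ((dderiv v ^^ k) f)" for v k by (induction k) (simp_all add: f rapid_dderiv)
  have ft: "ft ((dderiv v ^^ k) f) \<xi> = (\<i> * of_real (v \<bullet> \<xi>)) ^ k * ft f \<xi>" for v k \<xi>
    by (induction k) (simp_all add: ft_dderiv r)
  show ?thesis
  proof (rule moment_decay[OF N norm_ft_le])
    fix v \<xi> :: 'b
    have "\<bar>\<xi> \<bullet> v\<bar> ^ N * norm (ft f \<xi>) = norm (ft ((dderiv v ^^ N) f) \<xi>)"
      by (simp add: ft norm_mult norm_power inner_commute)
    then show "\<bar>\<xi> \<bullet> v\<bar> ^ N * norm (ft f \<xi>) \<le> (LINT y|lborel. norm ((dderiv v ^^ N) f y))"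
      using norm_ft_le by simp
  qed
qed

lemma ft_integrable:
  fixes f :: "'b::euclidean_space \<Rightarrow> complex"
  assumes f: "rapid f"
  shows "integrable lborel (ft f)"
proof -
  obtain C where C: "\<And>\<xi>. norm (ft f \<xi>) \<le> C * (1 + norm \<xi>) powr (- 2 * real DIM('b))"
    using ft_decay[OF f] by blast
  have [measurable]: "f \<in> borel_measurable borel" by (rule rapid_borel[OF f])
  show ?thesis
    by (rule Bochner_Integration.integrable_bound[OF integrable_mult_right[OF integrable_weight, of C]])
      (use order_trans[OF C abs_ge_self] in auto)
qed

text \<open>Along rays the transform of the Gaussian solves \<open>\<phi>'(s) = - s |z|\<^sup>2 \<phi>(s)\<close>.\<close>

lemma ft_gauss: "ft gauss (z :: 'b::euclidean_space) = gauss_mass TYPE('b) * gauss z"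
proof -
  define \<phi> where "\<phi> s = ft gauss (s *\<^sub>R z)" for s :: real
  define K where "K = (LINT y|lborel. (y \<bullet> z)\<^sup>2 * norm (gauss y))"
  let ?e = "\<lambda>s y. exp (- (\<i> * complex_of_real (y \<bullet> (s *\<^sub>R z))))"
  have r1: "rapid (\<lambda>y. of_real (y \<bullet> z) * gauss y)"
    using rapid_mult_tame[OF rapid_gauss tame_inner, of z] by (simp add: mult.commute)
  have intK: "integrable lborel (\<lambda>y. (y \<bullet> z)\<^sup>2 * norm (gauss y))"
  proof -
    have "rapid (\<lambda>y. of_real (y \<bullet> z) * (of_real (y \<bullet> z) * gauss y))"
      using rapid_mult_tame[OF r1 tame_inner, of z] by (subst mult.commute)
    from integrable_norm[OF rapid_integrable[OF this]] show ?thesis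
      by (simp add: norm_mult power2_eq_square flip: mult.assoc)
  qed
  \<comment> \<open>The expansion of the character to second order, uniform in \<open>a\<close>. It
    stands in for differentiation under the integral sign: against the Gaussian, the error h^2 (y .
    z)^2 integrates to \<open>K * h\<^sup>2\<close>.\<close>
  have sec: "norm (exp (- (\<i> * complex_of_real (a + b))) - exp (- (\<i> * of_real a)) + \<i> * of_real b * exp (- (\<i> * of_real a))) \<le> b\<^sup>2" for a b :: real
  proof -
    have "norm (iexp (- b) - (\<Sum>k\<le>1. (\<i> * of_real (- b)) ^ k / fact k)) \<le> b\<^sup>2 / 2"
      using iexp_approx1[of "- b" 1] by (simp add: numeral_2_eq_2)
    then have "norm (exp (- (\<i> * of_real b)) - 1 + \<i> * of_real b) \<le> b\<^sup>2"
      by (simp add: algebra_simps) (smt (verit) zero_le_power2)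
    moreover have "exp (- (\<i> * complex_of_real (a + b))) - exp (- (\<i> * of_real a)) + \<i> * of_real b * exp (- (\<i> * of_real a))
       = exp (- (\<i> * of_real a)) * (exp (- (\<i> * of_real b)) - 1 + \<i> * of_real b)"
      by (simp add: algebra_simps exp_add[symmetric])
    ultimately show ?thesis by (simp add: norm_mult)
  qed
  have d\<phi>: "norm (\<phi> (s + h) - \<phi> s - of_real h * (- of_real (s * (z \<bullet> z)) * \<phi> s)) \<le> K * h\<^sup>2" for s h
  proof -
    \<comment> \<open>Differentiating the Gaussian produces its first moment up to sign, so
      \<open>ft_dderiv\<close> expresses the moment \<open>F\<close> by \<open>\<phi> s\<close>.
      This closes the differential equation.\<close>
    have "dderiv z gauss = (\<lambda>p. (-1) * (of_real (p \<bullet> z) * gauss p))"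
      by (intro ext dderiv_eqI has_derivative_gauss)
    then have "- ft (\<lambda>y. of_real (y \<bullet> z) * gauss y) (s *\<^sub>R z) = \<i> * of_real (s * (z \<bullet> z)) * \<phi> s"
      using ft_dderiv[OF rapid_gauss, of z "s *\<^sub>R z"] unfolding \<phi>_def by (simp add: ft_def)
    then have "ft (\<lambda>y. of_real (y \<bullet> z) * gauss y) (s *\<^sub>R z) = - (\<i> * of_real (s * (z \<bullet> z)) * \<phi> s)"
      by (metis minus_minus)
    moreover define F where "F = ft (\<lambda>y. of_real (y \<bullet> z) * gauss y) (s *\<^sub>R z)"
    ultimately have 1: "- of_real (s * (z \<bullet> z)) * \<phi> s = - \<i> * F"
      by (simp flip: mult.assoc)
    have i: "integrable lborel (\<lambda>y. gauss y * ?e s y)" "integrable lborel (\<lambda>y. of_real (y \<bullet> z) * gauss y * ?e s y)" for s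
      by (intro rapid_integrable rapid_mult_char rapid_gauss r1)+
    have "\<phi> (s + h) - \<phi> s - of_real h * (- of_real (s * (z \<bullet> z)) * \<phi> s)
       = \<phi> (s + h) - \<phi> s + \<i> * of_real h * F" unfolding 1 by simp
    moreover have "\<phi> (s + h) - \<phi> s + \<i> * of_real h * F = (LINT y|lborel. gauss y * ?e (s + h) y - gauss y * ?e s y + \<i> * of_real h * (of_real (y \<bullet> z) * gauss y * ?e s y))"
      unfolding F_def \<phi>_def ft_def using i[of s] i[of "s + h"] by (simp add: mult.assoc)
    moreover have "norm (LINT y|lborel. gauss y * ?e (s + h) y - gauss y * ?e s y + \<i> * of_real h * (of_real (y \<bullet> z) * gauss y * ?e s y)) \<le> (LINT y|lborel. norm (gauss y * ?e (s + h) y - gauss y * ?e s y + \<i> * of_real h * (of_real (y \<bullet> z) * gauss y * ?e s y)))"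
      by (rule integral_norm_bound)
    moreover have "(LINT y|lborel. norm (gauss y * ?e (s + h) y - gauss y * ?e s y + \<i> * of_real h * (of_real (y \<bullet> z) * gauss y * ?e s y)))
       \<le> (LINT y|lborel. h\<^sup>2 * ((y \<bullet> z)\<^sup>2 * norm (gauss y)))"
    proof (rule integral_mono)
      show "integrable lborel (\<lambda>y. norm (gauss y * ?e (s + h) y - gauss y * ?e s y + \<i> * of_real h * (of_real (y \<bullet> z) * gauss y * ?e s y)))"
        by (rule integrable_norm[OF Bochner_Integration.integrable_add[OF
            Bochner_Integration.integrable_diff[OF i(1)[of "s + h"] i(1)[of s]] integrable_mult_right[OF i(2)[of s]]]])
      show "norm (gauss y * ?e (s + h) y - gauss y * ?e s y + \<i> * of_real h * (of_real (y \<bullet> z) * gauss y * ?e s y))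
          \<le> h\<^sup>2 * ((y \<bullet> z)\<^sup>2 * norm (gauss y))" for y
      proof -
        have e: "?e r y = exp (- (\<i> * complex_of_real (r * (y \<bullet> z))))" for r by simp
        have "g * a - g * b + \<i> * c * (d * g * b) = g * (a - b + \<i> * (c * d) * b)" for g a b c d :: complex
          by (simp add: algebra_simps)
        then have "gauss y * ?e (s + h) y - gauss y * ?e s y + \<i> * of_real h * (of_real (y \<bullet> z) * gauss y * ?e s y)
          = gauss y * (exp (- (\<i> * complex_of_real (s * (y \<bullet> z) + h * (y \<bullet> z)))) - exp (- (\<i> * of_real (s * (y \<bullet> z))))
             + \<i> * of_real (h * (y \<bullet> z)) * exp (- (\<i> * of_real (s * (y \<bullet> z)))))"
          unfolding e of_real_mult[of h] distrib_right[of s h] .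
        then show ?thesis
          using mult_left_mono[OF sec[of "s * (y \<bullet> z)" "h * (y \<bullet> z)"] norm_ge_zero[of "gauss y"]]
          by (simp only: norm_mult power_mult_distrib ac_simps)
      qed
    qed (use intK in simp)
    moreover have "(LINT y|lborel. h\<^sup>2 * ((y \<bullet> z)\<^sup>2 * norm (gauss y))) = K * h\<^sup>2" by (simp add: K_def)
    ultimately show ?thesis by (simp only:)
  qed
  have "(\<phi> has_derivative (\<lambda>k. of_real k * (- of_real (s * (z \<bullet> z)) * \<phi> s))) (at s)" for s
    unfolding has_derivative_at
  proof
    show "bounded_linear (\<lambda>k. complex_of_real k * (- of_real (s * (z \<bullet> z)) * \<phi> s))"
      by (rule bounded_linear_compose[OF bounded_linear_mult_left bounded_linear_of_real])
    show "(\<lambda>h. norm (\<phi> (s + h) - \<phi> s - complex_of_real h * (- complex_of_real (s * (z \<bullet> z)) * \<phi> s)) / norm h) \<midarrow>0\<rightarrow> 0"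
    proof (rule Lim_null_comparison)
      show "(\<lambda>h. K * \<bar>h\<bar>) \<midarrow>0\<rightarrow> 0" by (auto intro!: tendsto_eq_intros)
      show "\<forall>\<^sub>F h in at 0. norm (norm (\<phi> (s + h) - \<phi> s - complex_of_real h * (- complex_of_real (s * (z \<bullet> z)) * \<phi> s)) / norm h) \<le> K * \<bar>h\<bar>"
        unfolding eventually_at
      proof (intro exI[of _ 1] conjI ballI impI)
        fix h :: real assume "h \<noteq> 0 \<and> dist h 0 < 1"
        then have h: "0 < \<bar>h\<bar>" by simp
        show "norm (norm (\<phi> (s + h) - \<phi> s - complex_of_real h * (- complex_of_real (s * (z \<bullet> z)) * \<phi> s)) / norm h) \<le> K * \<bar>h\<bar>"
          using d\<phi>[of s h] h by (simp add: pos_divide_le_eq power2_eq_square mult.assoc)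
      qed simp
    qed
  qed
  note D = this
  \<comment> \<open>The integrating factor: its product with \<open>\<phi>\<close> has derivative 0,
    and comparing s = 1 with s = 0 gives the claim.\<close>
  have E: "((\<lambda>s. complex_of_real (exp (s\<^sup>2 * (z \<bullet> z) / 2))) has_derivative
      (\<lambda>k. of_real k * (of_real (s * (z \<bullet> z)) * of_real (exp (s\<^sup>2 * (z \<bullet> z) / 2))))) (at s)" for s
  proof -
    have "((\<lambda>s. exp (s\<^sup>2 * (z \<bullet> z) / 2)) has_derivative (\<lambda>k. k * (s * (z \<bullet> z) * exp (s\<^sup>2 * (z \<bullet> z) / 2)))) (at s)"
      by (auto intro!: derivative_eq_intros simp: algebra_simps)
    from has_derivative_of_real[OF this, where 'a = complex] show ?thesis by simp
  qed
  have "norm (\<phi> 1 * of_real (exp (1\<^sup>2 * (z \<bullet> z) / 2)) - \<phi> 0 * of_real (exp (0\<^sup>2 * (z \<bullet> z) / 2))) \<le> 0"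
  proof (rule norm_increment_le[where g' = "\<lambda>_. 0"])
    show "((\<lambda>s. \<phi> s * of_real (exp (s\<^sup>2 * (z \<bullet> z) / 2))) has_derivative (\<lambda>k. of_real k * 0)) (at s)" for s
      using has_derivative_mult[OF D[of s] E[of s]] by (simp add: algebra_simps)
  qed simp
  then have "\<phi> 1 * of_real (exp ((z \<bullet> z) / 2)) = \<phi> 0" by simp
  then have "\<phi> 1 = \<phi> 0 * of_real (exp (- (z \<bullet> z) / 2))"
    by (simp add: exp_minus field_simps)
  then show ?thesis by (simp add: \<phi>_def ft_def gauss_mass_def gauss_def)
qed

lemma integral_scale:
  fixes f :: "'b::euclidean_space \<Rightarrow> complex"
  assumes f: "continuous_on UNIV f" and t: "0 < t"
  shows "(LINT p|lborel. f p) = of_real (t ^ DIM('b)) * (LINT p|lborel. f (t *\<^sub>R p))"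
proof -
  have [measurable]: "f \<in> borel_measurable borel" using f by (rule borel_measurable_continuous_onI)
  have "(LINT p|lborel. f p) = (LINT p|density (distr lborel borel (\<lambda>x. 0 + t *\<^sub>R x)) (\<lambda>_. ennreal (\<bar>t\<bar> ^ DIM('b))). f p)"
    using lborel_affine[of t "0::'b"] t by simp
  also have "\<dots> = (LINT p|distr lborel borel (\<lambda>x. 0 + t *\<^sub>R x). (\<bar>t\<bar> ^ DIM('b)) *\<^sub>R f p)"
    by (rule integral_density) simp_all
  also have "\<dots> = (LINT p|lborel. (\<bar>t\<bar> ^ DIM('b)) *\<^sub>R f (0 + t *\<^sub>R p))"
    by (rule integral_distr) measurable
  finally show ?thesis using t by (simp add: scaleR_conv_of_real)
qed

lemma integrable_pair_mult:
  fixes f :: "'a::euclidean_space \<Rightarrow> complex" and g :: "'b::euclidean_space \<Rightarrow> complex"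
  assumes f: "integrable lborel f" and g: "integrable lborel g"
    and u: "continuous_on UNIV u" "\<And>p. norm (u p) \<le> 1"
  shows "integrable (lborel \<Otimes>\<^sub>M lborel) (\<lambda>(x, y). u (x, y) * (f x * g y))"
proof -
  have [measurable]: "f \<in> borel_measurable borel" "g \<in> borel_measurable borel"
    using borel_measurable_integrable[OF f] borel_measurable_integrable[OF g] by simp_all
  have [measurable]: "u \<in> borel_measurable (borel \<Otimes>\<^sub>M borel)"
    using borel_measurable_continuous_onI[OF u(1)] by (simp add: borel_prod)
  have [measurable]: "u \<in> borel_measurable (lborel \<Otimes>\<^sub>M lborel)"
    using borel_measurable_continuous_onI[OF u(1)] by (simp add: lborel_prod)
  have m: "(\<lambda>(x, y). f x * g y) \<in> borel_measurable (lborel \<Otimes>\<^sub>M lborel)"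
    unfolding split_beta' by measurable
  have "integrable (lborel \<Otimes>\<^sub>M lborel) (\<lambda>(x, y). f x * g y)"
  proof (rule lborel_pair.Fubini_integrable[OF m])
    show "integrable lborel (\<lambda>x. LINT y|lborel. norm (case (x, y) of (x, y) \<Rightarrow> f x * g y))"
      using f by (simp add: norm_mult)
    show "AE x in lborel. integrable lborel (\<lambda>y. case (x, y) of (x, y) \<Rightarrow> f x * g y)"
      using g by simp
  qed
  then show ?thesis
  proof (rule Bochner_Integration.integrable_bound)
    show "(\<lambda>(x, y). u (x, y) * (f x * g y)) \<in> borel_measurable (lborel \<Otimes>\<^sub>M lborel)"
      using borel_measurable_times[OF _ m, of u] by (simp add: split_beta')
    show "AE p in lborel \<Otimes>\<^sub>M lborel. norm (case p of (x, y) \<Rightarrow> u (x, y) * (f x * g y)) \<le> norm (case p of (x, y) \<Rightarrow> f x * g y)"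
      using u(2) by (auto simp: split_beta' norm_mult intro!: mult_left_le_one_le mult_nonneg_nonneg)
  qed
qed

lemma rapid_scale: 
  assumes f: "rapid f" and t: "0 < t" "t \<le> 1" shows "rapid (\<lambda>p. f (t *\<^sub>R p))"
proof -
  have "tame M (\<lambda>p. f (t *\<^sub>R p))" if "M \<le> 0" for M
    using rapid_tame[OF f, of M] growth_scale[OF t that] unfolding tame_def by blast
  then show ?thesis unfolding rapid_def by (metis linear tame_mono min.cobounded1 min.cobounded2)
qed

text \<open>Fubini moves the transform from \<open>h\<close> to the dilated Gaussian, whose
  transform is a Gaussian concentrated at scale \<open>t\<close>. Rescaling by \<open>t\<close> then
  moves the parameter into the argument of \<open>h\<close>, where the limit \<open>t\<close> to 0
  is harmless.\<close>

lemma gauss_inversion: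
  fixes h :: "'b::euclidean_space \<Rightarrow> complex"
  assumes h: "rapid h" and t: "0 < t" "t \<le> 1"
  shows "(LINT \<xi>|lborel. gauss (t *\<^sub>R \<xi>) * ft h \<xi>) = gauss_mass TYPE('b) * (LINT u|lborel. h (t *\<^sub>R u) * gauss u)"
proof -
  let ?e = "\<lambda>(x, y). exp (- (\<i> * complex_of_real (x \<bullet> (y :: 'b))))"
  have gt: "rapid (\<lambda>\<xi> :: 'b. gauss (t *\<^sub>R \<xi>))" by (rule rapid_scale[OF rapid_gauss t])
  have ce: "continuous_on UNIV ?e" by (auto simp: split_beta' intro!: continuous_intros)
  have int: "integrable (lborel \<Otimes>\<^sub>M lborel) (\<lambda>(z, \<xi>). ?e (z, \<xi>) * (h z * gauss (t *\<^sub>R \<xi>)))"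
    by (rule integrable_pair_mult[OF rapid_integrable[OF h] rapid_integrable[OF gt] ce]) auto
  have "(LINT \<xi>|lborel. gauss (t *\<^sub>R \<xi>) * ft h \<xi>) = (LINT \<xi>|lborel. LINT z|lborel. ?e (z, \<xi>) * (h z * gauss (t *\<^sub>R \<xi>)))"
    unfolding ft_def integral_mult_right_zero[symmetric] by (simp add: ac_simps)
  also have "\<dots> = (LINT z|lborel. LINT \<xi>|lborel. ?e (z, \<xi>) * (h z * gauss (t *\<^sub>R \<xi>)))"
    by (rule lborel_pair.Fubini_integral) (rule int)
  also have "\<dots> = (LINT z|lborel. h z * ft (\<lambda>\<xi>. gauss (t *\<^sub>R \<xi>)) z)"
    unfolding ft_def integral_mult_right_zero[symmetric] by (simp add: ac_simps inner_commute)
  also have "\<dots> = of_real (t ^ DIM('b)) * (LINT u|lborel. h (t *\<^sub>R u) * ft (\<lambda>\<xi>. gauss (t *\<^sub>R \<xi>)) (t *\<^sub>R u))"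
  proof (rule integral_scale[OF _ t(1)])
    have "ft (\<lambda>\<xi>. gauss (t *\<^sub>R \<xi>)) = (\<lambda>z. of_real (inverse (t ^ DIM('b))) * (gauss_mass TYPE('b) * gauss (inverse t *\<^sub>R z :: 'b)))"
    proof
      fix z :: 'b
      have "ft gauss (inverse t *\<^sub>R z) = of_real (t ^ DIM('b)) * ft (\<lambda>\<xi>. gauss (t *\<^sub>R \<xi>)) z"
        unfolding ft_def using t
        by (subst integral_scale[OF _ t(1)])
          (auto intro!: continuous_intros continuous_gauss simp flip: mult.assoc)
      then show "ft (\<lambda>\<xi>. gauss (t *\<^sub>R \<xi>)) z = of_real (inverse (t ^ DIM('b))) * (gauss_mass TYPE('b) * gauss (inverse t *\<^sub>R z))"
        using t by (simp add: ft_gauss)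
    qed
    then show "continuous_on UNIV (\<lambda>z. h z * ft (\<lambda>\<xi>. gauss (t *\<^sub>R \<xi>)) z)"
      by (auto intro!: continuous_intros rapid_cont[OF h] continuous_on_compose2[OF continuous_gauss])
  qed
  also have "\<dots> = (LINT u|lborel. h (t *\<^sub>R u) * (of_real (t ^ DIM('b)) * ft (\<lambda>\<xi>. gauss (t *\<^sub>R \<xi>)) (t *\<^sub>R u)))"
    unfolding integral_mult_right_zero[symmetric] by (simp add: ac_simps)
  also have "\<dots> = (LINT u|lborel. h (t *\<^sub>R u) * (gauss_mass TYPE('b) * gauss u))"
  proof -
    have "of_real (t ^ DIM('b)) * ft (\<lambda>\<xi>. gauss (t *\<^sub>R \<xi>)) (t *\<^sub>R u) = ft gauss u" for u :: 'b
      unfolding ft_def using t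
      by (subst (2) integral_scale[OF _ t(1)]) (auto intro!: continuous_intros continuous_gauss)
    then show ?thesis by (simp add: ft_gauss)
  qed
  also have "\<dots> = gauss_mass TYPE('b) * (LINT u|lborel. h (t *\<^sub>R u) * gauss u)"
    unfolding integral_mult_right_zero[symmetric] by (simp add: ac_simps)
  finally show ?thesis .
qed

text \<open>Dominated convergence, with the Gaussian absorbing polynomial growth. Mere boundedness
  of \<open>h n\<close> would not cover \<open>Lam_fst\<close>, where the amplitude may
  grow.\<close>

lemma gauss_approximation:
  fixes h :: "nat \<Rightarrow> 'b::euclidean_space \<Rightarrow> complex"
  assumes lim: "\<And>u. (\<lambda>n. h n u) \<longlonglongrightarrow> l"
    and bd: "\<And>n u. norm (h n u) \<le> C * (1 + norm u) powr M"
    and cont: "\<And>n. continuous_on UNIV (h n)"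
  shows "(\<lambda>n. LINT u|lborel. h n u * gauss u) \<longlonglongrightarrow> gauss_mass TYPE('b) * l"
proof -
  have [measurable]: "h n \<in> borel_measurable borel" for n
    using cont by (rule borel_measurable_continuous_onI)
  have [measurable]: "(gauss :: 'b \<Rightarrow> complex) \<in> borel_measurable borel"
    by (rule rapid_borel[OF rapid_gauss])
  obtain G where G: "growth 0 (- 2 * real DIM('b) - M) G (gauss :: 'b \<Rightarrow> complex)"
    using rapid_gauss unfolding rapid_def tame_def by blast
  have "(\<lambda>n. LINT u|lborel. h n u * gauss u) \<longlonglongrightarrow> (LINT u|lborel. l * gauss (u :: 'b))"
  proof (rule integral_dominated_convergence)
    show "integrable lborel (\<lambda>u :: 'b. C * G * (1 + norm u) powr (- 2 * real DIM('b)))"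
      by (intro integrable_mult_right integrable_weight)
    show "AE u in lborel. (\<lambda>n. h n u * gauss u) \<longlonglongrightarrow> l * gauss u"
      by (intro AE_I2 tendsto_intros lim)
    show "AE u in lborel. norm (h n u * gauss u) \<le> C * G * (1 + norm u) powr (- 2 * real DIM('b))" for n
    proof (rule AE_I2)
      fix u :: 'b
      have "0 \<le> C * (1 + norm u) powr M" using order_trans[OF norm_ge_zero bd] .
      then have "norm (h n u * gauss u) \<le> (C * (1 + norm u) powr M) * (G * (1 + norm u) powr (- 2 * real DIM('b) - M))"
        unfolding norm_mult using bd growth_le[OF G] by (intro mult_mono) simp_all
      also have "\<dots> = C * G * ((1 + norm u) powr M * (1 + norm u) powr (- 2 * real DIM('b) - M))" by simp
      finally show "norm (h n u * gauss u) \<le> C * G * (1 + norm u) powr (- 2 * real DIM('b))"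
        by (simp flip: powr_add)
    qed
  qed measurable
  then show ?thesis by (simp add: gauss_mass_def mult.commute)
qed

text \<open>Translating \<open>g\<close> by \<open>x\<close> modulates its transform, so only the
  value at the origin is at stake. There both sides of \<open>gauss_inversion\<close> have limits:
  \<open>ft h\<close> dominates the left, and the right concentrates at \<open>h 0\<close>. Each of
  the two Gaussian integrations contributes one factor \<open>gauss_mass\<close>.\<close>

lemma fourier_inversion:
  fixes g :: "'b::euclidean_space \<Rightarrow> complex"
  assumes g: "rapid g"
  shows "(LINT \<xi>|lborel. ft g \<xi> * exp (\<i> * of_real (x \<bullet> \<xi>))) = (gauss_mass TYPE('b))\<^sup>2 * g x"
proof -
  define h where "h = (\<lambda>z. g (x + z))"
  have h: "rapid h" unfolding h_def by (rule rapid_translate[OF g])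
  have fth: "ft h \<xi> = ft g \<xi> * exp (\<i> * of_real (x \<bullet> \<xi>))" for \<xi>
  proof -
    have "ft g \<xi> = (LINT y|lborel. g (x + y) * exp (- (\<i> * of_real ((x + y) \<bullet> \<xi>))))"
      unfolding ft_def
      by (rule integral_translate[symmetric]) (intro continuous_intros rapid_cont[OF g])
    also have "\<dots> = (LINT y|lborel. exp (- (\<i> * of_real (x \<bullet> \<xi>))) * (h y * exp (- (\<i> * of_real (y \<bullet> \<xi>)))))"
      by (simp add: h_def inner_add_left algebra_simps flip: exp_add)
    also have "\<dots> = exp (- (\<i> * of_real (x \<bullet> \<xi>))) * ft h \<xi>" by (simp add: ft_def)
    finally show ?thesis by (simp add: exp_minus field_simps)
  qed
  define t where "t n = inverse (real (Suc n))" for n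
  have t: "0 < t n" "t n \<le> 1" for n unfolding t_def by (simp_all add: inverse_le_1_iff)
  have t0: "t \<longlonglongrightarrow> 0" unfolding t_def by (rule LIMSEQ_inverse_real_of_nat)
  have hm: "(\<lambda>n. LINT \<xi>|lborel. gauss (t n *\<^sub>R \<xi>) * ft h \<xi>) \<longlonglongrightarrow> (LINT \<xi>|lborel. ft h \<xi>)"
  proof (rule integral_dominated_convergence)
    have [measurable]: "h \<in> borel_measurable borel" by (rule rapid_borel[OF h])
    have [measurable]: "(gauss :: 'b \<Rightarrow> complex) \<in> borel_measurable borel"
      by (rule rapid_borel[OF rapid_gauss])
    show "ft h \<in> borel_measurable lborel" "(\<lambda>\<xi>. gauss (t n *\<^sub>R \<xi>) * ft h \<xi>) \<in> borel_measurable lborel" for n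
      by measurable
    show "integrable lborel (\<lambda>\<xi>. norm (ft h \<xi>))" by (intro integrable_norm ft_integrable h)
    show "AE \<xi> in lborel. norm (gauss (t n *\<^sub>R \<xi>) * ft h \<xi>) \<le> norm (ft h \<xi>)" for n
      by (intro AE_I2) (simp add: norm_mult mult_left_le_one_le norm_gauss_le)
    have "(\<lambda>n. gauss (t n *\<^sub>R \<xi>)) \<longlonglongrightarrow> gauss (0 *\<^sub>R \<xi>)" for \<xi> :: 'b
      by (intro continuous_on_tendsto_compose[OF continuous_gauss] tendsto_intros t0) simp_all
    then show "AE \<xi> in lborel. (\<lambda>n. gauss (t n *\<^sub>R \<xi>) * ft h \<xi>) \<longlonglongrightarrow> ft h \<xi>"
      using tendsto_mult[OF _ tendsto_const, of "\<lambda>n. gauss (t n *\<^sub>R _)" 1 sequentially] by (intro AE_I2) fastforce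
  qed
  obtain C where C: "growth 0 0 C h" using h unfolding rapid_def tame_def by blast
  have "(\<lambda>n. gauss_mass TYPE('b) * (LINT u|lborel. h (t n *\<^sub>R u) * gauss u)) \<longlonglongrightarrow> gauss_mass TYPE('b) * (gauss_mass TYPE('b) * h 0)"
  proof (intro tendsto_mult_left gauss_approximation)
    show "(\<lambda>n. h (t n *\<^sub>R u)) \<longlonglongrightarrow> h 0" for u
      using continuous_on_tendsto_compose[OF rapid_cont[OF h], of "\<lambda>n. t n *\<^sub>R u" 0 sequentially]
        tendsto_scaleR[OF t0 tendsto_const[of u]] by simp
    show "norm (h (t n *\<^sub>R u)) \<le> C * (1 + norm u) powr 0" for n u
      using growth_le[OF C, of "t n *\<^sub>R u"] by (simp add: add_nonneg_eq_0_iff)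
    show "continuous_on UNIV (\<lambda>u. h (t n *\<^sub>R u))" for n
      by (intro continuous_on_compose2[OF rapid_cont[OF h]] continuous_intros) simp
  qed
  from LIMSEQ_unique[OF hm[unfolded gauss_inversion[OF h t]] this] show ?thesis
    unfolding fth[symmetric] by (simp add: h_def power2_eq_square)
qed

section \<open>The regularised functional\<close>

text \<open>A sequence of cutoffs rather than a continuous family, ready for dominated convergence;
  \<open>Suc\<close> keeps the scale in the interval (0, 1] that the dilation lemmas
  require.\<close>

definition reg :: "nat \<Rightarrow> ('b::euclidean_space \<Rightarrow> complex) \<Rightarrow> 'b \<Rightarrow> complex" where
  "reg n b p = gauss (inverse (real (Suc n)) *\<^sub>R p) * b p"

text \<open>The value at the origin of \<open>exp (- i \<partial>\<^sub>z \<cdot> \<partial>\<^sub>\<zeta>) b\<close>, as a regularised oscillatory integral.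
  Dividing by the squared mass of the Gaussian replaces the usual constant \<open>(2 \<pi>)\<^sup>-\<^sup>d\<close>.\<close>

definition Lam :: "('b::euclidean_space \<times> 'b \<Rightarrow> complex) \<Rightarrow> complex" where
  "Lam b = lim (\<lambda>n. osc (reg n b)) / (gauss_mass TYPE('b))\<^sup>2"

lemma inverse_Suc_bounds: "0 < inverse (real (Suc n))" "inverse (real (Suc n)) \<le> 1"
  by (simp_all add: inverse_le_1_iff)

lemma rapid_reg: "tame M b \<Longrightarrow> rapid (reg n b)"
  unfolding reg_def[abs_def] by (intro rapid_mult_tame rapid_scale rapid_gauss inverse_Suc_bounds)

text \<open>The constant does not depend on \<open>n\<close>, because the dilated Gaussians are
  bounded uniformly at order 0. Bounds on regularised integrals therefore survive the limit.\<close>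

lemma growth_reg:
  obtains c where "0 \<le> c"
    "\<And>n M C b. growth k M C (b :: 'b::euclidean_space \<Rightarrow> complex) \<Longrightarrow> growth k M (c * C) (reg n b)"
proof -
  obtain G where G: "growth k 0 G (gauss :: 'b \<Rightarrow> complex)"
    using rapid_gauss unfolding rapid_def tame_def by blast
  have "growth k M (2 ^ k * G * C) (reg n b)" if "growth k M C b" for n M C and b :: "'b \<Rightarrow> complex"
    using growth_mult[OF growth_scale[OF inverse_Suc_bounds order_refl G, of n] that]
    unfolding reg_def[abs_def] by simp
  moreover have "0 \<le> 2 ^ k * G" using growth_nonneg[OF G] by simp
  ultimately show thesis by (intro that)
qed

lemma growth_reg_diff:
  obtains c where "0 \<le> c"
    "\<And>n M C b. growth k M C (b :: 'b::euclidean_space \<Rightarrow> complex) \<Longrightarrow>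
       growth k (M + 1) (c * C * inverse (real (Suc n))) (\<lambda>p. b p - reg n b p)"
proof -
  obtain G where G: "growth (Suc k) 0 G (gauss :: 'b \<Rightarrow> complex)"
    using rapid_gauss unfolding rapid_def tame_def by blast
  have "growth k (M + 1) (2 ^ k * (real DIM('b) * G) * C * inverse (real (Suc n))) (\<lambda>p. b p - reg n b p)"
    if b: "growth k M C b" for n M C and b :: "'b \<Rightarrow> complex"
  proof -
    have eq: "(\<lambda>p. b p - reg n b p) = (\<lambda>p. (gauss 0 - gauss (inverse (real (Suc n)) *\<^sub>R p)) * b p)"
      by (simp add: fun_eq_iff reg_def left_diff_distrib)
    show ?thesis
      by (subst eq) (rule growth_mono[OF growth_mult[OF growth_scale_diff[OF inverse_Suc_bounds[of n] G] b]], simp_all)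
  qed
  moreover have "0 \<le> 2 ^ k * (real DIM('b) * G)" using growth_nonneg[OF G] by simp
  ultimately show thesis by (intro that)
qed

lemma osc_reg_Cauchy:
  fixes b :: "'b::euclidean_space \<times> 'b \<Rightarrow> complex"
  assumes b: "tame M b"
  shows "Cauchy (\<lambda>n. osc (reg n b))"
proof (rule metric_CauchyI)
  fix e :: real assume e: "0 < e"
  obtain k c where c: "0 \<le> c"
    "\<And>C f. rapid f \<Longrightarrow> growth k (M + 1) C (f :: 'b \<times> 'b \<Rightarrow> complex) \<Longrightarrow> norm (osc f) \<le> c * C"
    by (rule osc_bound[where M = "M + 1"]) (rule that)
  obtain C where C: "growth k M C b" using b unfolding tame_def by blast
  obtain c' where c': "0 \<le> c'" "\<And>n M C b. growth k M C (b :: 'b \<times> 'b \<Rightarrow> complex) \<Longrightarrow>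
       growth k (M + 1) (c' * C * inverse (real (Suc n))) (\<lambda>p. b p - reg n b p)"
    by (rule growth_reg_diff[where k = k]) (rule that)
  define K where "K = c * (c' * C)"
  have K: "0 \<le> K" using c(1) c'(1) growth_nonneg[OF C] by (simp add: K_def)
  have le: "dist (osc (reg m b)) (osc (reg n b)) \<le> K * (inverse (real (Suc n)) + inverse (real (Suc m)))" for m n
  proof -
    \<comment> \<open>The error \<open>b p - reg n b p\<close> need not be rapid, but the difference
      of two errors is. Decay is read off from the difference and smallness from the single
      errors.\<close>
    have "osc (reg m b) - osc (reg n b) = osc (\<lambda>p. (b p - reg n b p) - (b p - reg m b p))"
      using osc_diff[OF rapid_reg[OF b] rapid_reg[OF b], of m n] by simp
    moreover have g: "growth k (M + 1) (c' * C * inverse (real (Suc n)) + c' * C * inverse (real (Suc m)))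
        (\<lambda>p. (b p - reg n b p) - (b p - reg m b p))"
      by (rule growth_diff[OF c'(2)[OF C] c'(2)[OF C]])
    moreover have r: "rapid (\<lambda>p. (b p - reg n b p) - (b p - reg m b p))"
      using rapid_diff[OF rapid_reg[OF b] rapid_reg[OF b], of m n] by simp
    ultimately show ?thesis using c(2)[OF r g]
      unfolding dist_norm by (simp add: K_def distrib_left mult.assoc)
  qed
  obtain N where N: "inverse (real (Suc N)) < e / (2 * K + 1)"
    using reals_Archimedean[of "e / (2 * K + 1)"] e K by auto
  have "dist (osc (reg m b)) (osc (reg n b)) < e" if "N \<le> m" "N \<le> n" for m n
  proof -
    have "inverse (real (Suc m)) \<le> inverse (real (Suc N))" "inverse (real (Suc n)) \<le> inverse (real (Suc N))"
      using that by (auto intro: le_imp_inverse_le)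
    then have "K * (inverse (real (Suc n)) + inverse (real (Suc m))) \<le> K * (2 * inverse (real (Suc N)))"
      by (intro mult_left_mono K) linarith
    also have "\<dots> \<le> (2 * K + 1) * inverse (real (Suc N))"
      by (simp add: distrib_right)
    also have "\<dots> < e" using N K by (simp add: pos_less_divide_eq mult.commute)
    finally show ?thesis using le[of m n] by simp
  qed
  then show "\<exists>N. \<forall>m\<ge>N. \<forall>n\<ge>N. dist (osc (reg m b)) (osc (reg n b)) < e" by blast
qed

lemma osc_reg_tendsto:
  fixes b :: "'b::euclidean_space \<times> 'b \<Rightarrow> complex"
  assumes "tame M b"
  shows "(\<lambda>n. osc (reg n b)) \<longlonglongrightarrow> (gauss_mass TYPE('b))\<^sup>2 * Lam b"
  using osc_reg_Cauchy[OF assms] gauss_mass_nonzero[where 'b = 'b]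
  by (simp add: Lam_def Cauchy_convergent_iff convergent_LIMSEQ_iff)

lemma Lam_eqI:
  fixes b :: "'b::euclidean_space \<times> 'b \<Rightarrow> complex"
  assumes "tame M b" "(\<lambda>n. osc (reg n b)) \<longlonglongrightarrow> (gauss_mass TYPE('b))\<^sup>2 * l"
  shows "Lam b = l"
  using LIMSEQ_unique[OF osc_reg_tendsto[OF assms(1)] assms(2)] gauss_mass_nonzero[where 'b = 'b]
  by simp

text \<open>Tameness of some order \<open>M'\<close> makes the regularised integrals converge, while
  the estimate uses the order \<open>M\<close>, and \<open>k\<close> and \<open>c\<close> depend on
  \<open>M\<close> alone. For Taylor remainders the two orders differ.\<close>

lemma Lam_bound:
  obtains k c where "0 \<le> c"
    "\<And>M' C b. tame M' b \<Longrightarrow> growth k M C (b :: 'b::euclidean_space \<times> 'b \<Rightarrow> complex) \<Longrightarrow> norm (Lam b) \<le> c * C"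
proof -
  obtain k c where c: "0 \<le> c"
    "\<And>C f. rapid f \<Longrightarrow> growth k M C (f :: 'b \<times> 'b \<Rightarrow> complex) \<Longrightarrow> norm (osc f) \<le> c * C"
    by (rule osc_bound[where M = "M"]) (rule that)
  obtain c' where c': "0 \<le> c'"
    "\<And>n M C b. growth k M C (b :: 'b \<times> 'b \<Rightarrow> complex) \<Longrightarrow> growth k M (c' * C) (reg n b)"
    by (rule growth_reg[where k = k]) (rule that)
  define m where "m = norm ((gauss_mass TYPE('b))\<^sup>2)"
  have m: "0 < m" using gauss_mass_nonzero[where 'b = 'b] by (simp add: m_def)
  have "norm (Lam b) \<le> (c * c' / m) * C" if b: "tame M' b" "growth k M C b" for M' C and b :: "'b \<times> 'b \<Rightarrow> complex"
  proof -
    have "norm ((gauss_mass TYPE('b))\<^sup>2 * Lam b) \<le> c * (c' * C)"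
      by (rule LIMSEQ_le_const2[OF tendsto_norm[OF osc_reg_tendsto[OF b(1)]]])
        (use c(2)[OF rapid_reg[OF b(1)] c'(2)[OF b(2)]] in blast)
    then have "m * norm (Lam b) \<le> c * (c' * C)" by (simp add: norm_mult m_def)
    then show ?thesis using m by (simp add: field_simps)
  qed
  moreover have "0 \<le> c * c' / m" using c(1) c'(1) m by simp
  ultimately show thesis by (intro that)
qed

lemma Lam_add: 
  assumes "tame M a" "tame M b" shows "Lam (\<lambda>p. a p + b p) = Lam a + Lam b"
proof (rule Lam_eqI[OF tame_add[OF assms]])
  have "osc (reg n (\<lambda>p. a p + b p)) = osc (reg n a) + osc (reg n b)" for n
    using osc_add[OF rapid_reg[OF assms(1)] rapid_reg[OF assms(2)], of n n] by (simp add: reg_def[abs_def] distrib_left)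
  then show "(\<lambda>n. osc (reg n (\<lambda>p. a p + b p))) \<longlonglongrightarrow> (gauss_mass TYPE('a))\<^sup>2 * (Lam a + Lam b)"
    using tendsto_add[OF osc_reg_tendsto[OF assms(1)] osc_reg_tendsto[OF assms(2)]] by (simp add: distrib_left)
qed

lemma Lam_cmult: 
  assumes "tame M b" shows "Lam (\<lambda>p. c * b p) = c * Lam b"
proof (rule Lam_eqI[OF tame_cmult[OF assms]])
  have "osc (reg n (\<lambda>p. c * b p)) = c * osc (reg n b)" for n
    using osc_cmult[of c "reg n b"] by (simp add: reg_def[abs_def] mult.left_commute)
  then show "(\<lambda>n. osc (reg n (\<lambda>p. c * b p))) \<longlonglongrightarrow> (gauss_mass TYPE('a))\<^sup>2 * (c * Lam b)"
    using tendsto_mult_left[OF osc_reg_tendsto[OF assms(1)], of c] by (simp add: mult.left_commute)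
qed

lemma Lam_diff: "tame M a \<Longrightarrow> tame M b \<Longrightarrow> Lam (\<lambda>p. a p - b p) = Lam a - Lam b"
  using Lam_add[OF _ tame_cmult[of M b "-1"]] Lam_cmult[of M b "-1"] by simp

lemma Lam_0: "Lam (\<lambda>_. 0) = 0"
  using Lam_cmult[OF tame_const, of 0] by simp

lemma Lam_sum: "finite I \<Longrightarrow> (\<And>i. i \<in> I \<Longrightarrow> tame M (b i)) \<Longrightarrow> Lam (\<lambda>p. \<Sum>i\<in>I. b i p) = (\<Sum>i\<in>I. Lam (b i))"
proof (induction I rule: finite_induct)
  case (insert i I)
  then show ?case using Lam_add[OF insert(4)[of i] tame_sum[of I M b]] by simp
qed (simp add: Lam_0)

text \<open>For absolutely convergent integrals the cutoff disappears in the limit: its error has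
  order 1 with a constant of size 1/(n+1), and \<open>osc_bound\<close> applies at order 1.\<close>

lemma Lam_rapid:
  fixes b :: "'b::euclidean_space \<times> 'b \<Rightarrow> complex"
  assumes b: "rapid b"
  shows "(gauss_mass TYPE('b))\<^sup>2 * Lam b = osc b"
proof -
  obtain k c where c: "0 \<le> c"
    "\<And>C f. rapid f \<Longrightarrow> growth k 1 C (f :: 'b \<times> 'b \<Rightarrow> complex) \<Longrightarrow> norm (osc f) \<le> c * C"
    by (rule osc_bound[where M = "1"]) (rule that)
  obtain C where C: "growth k 0 C b" using b unfolding rapid_def tame_def by blast
  obtain c' where "0 \<le> c'" "\<And>n M C b. growth k M C (b :: 'b \<times> 'b \<Rightarrow> complex) \<Longrightarrow>
       growth k (M + 1) (c' * C * inverse (real (Suc n))) (\<lambda>p. b p - reg n b p)"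
    by (rule growth_reg_diff[where k = k]) (rule that)
  from this(2)[OF C] have c': "growth k 1 (c' * C * inverse (real (Suc n))) (\<lambda>p. b p - reg n b p)" for n
    by simp
  have rr: "rapid (reg n b)" for n by (rule rapid_reg[OF rapid_tame[OF b]])
  have "(\<lambda>n. osc (reg n b)) \<longlonglongrightarrow> osc b"
  proof (rule LIM_zero_cancel, rule Lim_null_comparison)
    show "\<forall>\<^sub>F n in sequentially. norm (osc (reg n b) - osc b) \<le> (c * (c' * C)) * inverse (real (Suc n))"
    proof (rule always_eventually, rule allI)
      fix n
      have "norm (osc (\<lambda>p. b p - reg n b p)) \<le> c * (c' * C * inverse (real (Suc n)))"
        by (rule c(2)[OF rapid_diff[OF b rr] c'])
      then show "norm (osc (reg n b) - osc b) \<le> (c * (c' * C)) * inverse (real (Suc n))"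
        by (simp add: osc_diff[OF b rr] norm_minus_commute mult.assoc)
    qed
    show "(\<lambda>n. (c * (c' * C)) * inverse (real (Suc n))) \<longlonglongrightarrow> 0"
      using tendsto_mult_right_zero[OF LIMSEQ_inverse_real_of_nat] .
  qed
  then show ?thesis by (rule LIMSEQ_unique[OF osc_reg_tendsto[OF rapid_tame[OF b]]])
qed

text \<open>Integration by parts before the limit. The derivative falling on the cutoff carries a
  factor \<open>t n\<close> by the chain rule and multiplies a bounded sequence
  \<open>osc (X n)\<close>, hence vanishes.\<close>

lemma Lam_mult_snd:
  fixes b :: "'b::euclidean_space \<times> 'b \<Rightarrow> complex"
  assumes b: "tame M b"
  shows "Lam (\<lambda>p. of_real (snd p \<bullet> e) * b p) = - \<i> * Lam (dderiv (e, 0) b)"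
proof -
  define v :: "'b \<times> 'b" where "v = (e, 0)"
  define t where "t n = inverse (real (Suc n))" for n
  define X where "X n = (\<lambda>p. dderiv v gauss (t n *\<^sub>R p) * b p)" for n
  have v: "snd p \<bullet> e = p \<bullet> prod.swap v" for p by (simp add: v_def inner_prod_def)
  have t: "0 < t n" "t n \<le> 1" for n by (simp_all only: t_def inverse_Suc_bounds)
  have rX: "rapid (X n)" for n
    unfolding X_def by (intro rapid_mult_tame[OF _ b] rapid_scale[OF _ t] rapid_dderiv rapid_gauss)
  have D: "dderiv v (reg n b) = (\<lambda>p. reg n (dderiv v b) p + of_real (t n) * X n p)" for n
  proof -
    have gd: "gauss differentiable at p" for p :: "'b \<times> 'b"
      by (rule smooth_differentiable[OF rapid_smooth[OF rapid_gauss]])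
    have r: "reg n f = (\<lambda>p. gauss (t n *\<^sub>R p) * f p)" for f by (simp add: fun_eq_iff reg_def t_def)
    show ?thesis
      unfolding r X_def
      using dderiv_mult[OF differentiable_scale[OF gd, of "t n"] smooth_differentiable[OF tame_smooth[OF b]], of v]
      by (simp only: dderiv_scale[OF gd] mult.assoc)
  qed
  have 1: "osc (reg n (\<lambda>p. of_real (snd p \<bullet> e) * b p)) = - \<i> * (osc (reg n (dderiv v b)) + of_real (t n) * osc (X n))" for n
  proof -
    have "reg n (\<lambda>p. of_real (snd p \<bullet> e) * b p) = (\<lambda>p. of_real (p \<bullet> prod.swap v) * reg n b p)"
      by (simp add: fun_eq_iff reg_def v)
    then have "\<i> * osc (reg n (\<lambda>p. of_real (snd p \<bullet> e) * b p)) = osc (dderiv v (reg n b))"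
      using osc_dderiv[OF rapid_reg[OF b], of v n] by simp
    also have "\<dots> = osc (reg n (dderiv v b)) + of_real (t n) * osc (X n)"
      unfolding D by (simp add: osc_add osc_cmult rapid_reg[OF tame_dderiv[OF b]] rapid_cmult rX)
    finally have "- \<i> * (\<i> * osc (reg n (\<lambda>p. of_real (snd p \<bullet> e) * b p)))
        = - \<i> * (osc (reg n (dderiv v b)) + of_real (t n) * osc (X n))" by simp
    then show ?thesis by (simp flip: mult.assoc)
  qed
  obtain k c where c: "0 \<le> c"
    "\<And>C f. rapid f \<Longrightarrow> growth k M C (f :: 'b \<times> 'b \<Rightarrow> complex) \<Longrightarrow> norm (osc f) \<le> c * C"
    by (rule osc_bound[where M = "M"]) (rule that)
  obtain C where C: "growth k M C b" using b unfolding tame_def by blast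
  obtain G where G: "growth k 0 G (dderiv v gauss)"
    using rapid_dderiv[OF rapid_gauss] unfolding rapid_def tame_def by blast
  have "growth k M (2 ^ k * G * C) (X n)" for n
    using growth_mult[OF growth_scale[OF t order_refl G, of n] C] t(1)[of n] by (simp add: X_def)
  then have X: "norm (osc (X n)) \<le> c * (2 ^ k * G * C)" for n by (rule c(2)[OF rX])
  have t0: "t \<longlonglongrightarrow> 0" unfolding t_def by (rule LIMSEQ_inverse_real_of_nat)
  have "(\<lambda>n. of_real (t n) * osc (X n)) \<longlonglongrightarrow> 0"
  proof (rule Lim_null_comparison)
    show "\<forall>\<^sub>F n in sequentially. norm (of_real (t n) * osc (X n)) \<le> t n * (c * (2 ^ k * G * C))"
      using X t(1) by (intro always_eventually allI) (simp add: norm_mult mult_left_mono less_imp_le)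
    show "(\<lambda>n. t n * (c * (2 ^ k * G * C))) \<longlonglongrightarrow> 0" by (rule tendsto_mult_left_zero[OF t0])
  qed
  from tendsto_mult_left[OF tendsto_add[OF osc_reg_tendsto[OF tame_dderiv[OF b, of v]] this], of "- \<i>"]
  have "(\<lambda>n. osc (reg n (\<lambda>p. of_real (snd p \<bullet> e) * b p))) \<longlonglongrightarrow> (gauss_mass TYPE('b))\<^sup>2 * (- \<i> * Lam (dderiv v b))"
    unfolding 1[symmetric] by (simp add: mult.left_commute)
  moreover have "tame (1 + M) (\<lambda>p. of_real (snd p \<bullet> e) * b p)"
    unfolding v by (rule tame_mult[OF tame_inner b])
  ultimately show ?thesis unfolding v_def by (rule Lam_eqI[rotated])
qed

text \<open>A function of the first variable does not decay along the second, so the order must be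
  nonnegative. Basis derivatives in the second variable vanish.\<close>

lemma growth_fst:
  fixes c :: "'b::euclidean_space \<Rightarrow> complex"
  assumes M: "0 \<le> M"
  shows "growth n M C c \<Longrightarrow> growth n M C (\<lambda>p :: 'b \<times> 'b. c (fst p))"
proof (induction n arbitrary: c)
  have base: "norm (c (fst p)) \<le> C * (1 + norm p) powr M" if "growth n M C c" for n c and p :: "'b \<times> 'b"
  proof -
    have "(1 + norm (fst p)) powr M \<le> (1 + norm p) powr M"
      using M norm_fst_le[of "fst p" "snd p"] by (intro powr_mono2) simp_all
    then show ?thesis
      using order_trans[OF growth_le[OF that] mult_left_mono[OF _ growth_nonneg[OF that]]] by blast
  qed
  {
    case 0
    then show ?case using base[OF 0]
      by (auto intro!: continuous_on_compose2[of UNIV c UNIV fst] continuous_on_fst)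
  next
    case (Suc n)
    have diff: "c differentiable at x" for x using Suc.prems by simp
    have "(\<lambda>p :: 'b \<times> 'b. c (fst p)) differentiable at p" for p
      using differentiableI[OF has_derivative_affine_comp[OF bounded_linear_fst diff, where c = 0]] by simp
    moreover have "growth n M C (dderiv v (\<lambda>p :: 'b \<times> 'b. c (fst p)))" if "v \<in> Basis" for v
    proof -
      have D: "dderiv v (\<lambda>p :: 'b \<times> 'b. c (fst p)) = (\<lambda>p. dderiv (fst v) c (fst p))"
        using dderiv_affine_comp[OF bounded_linear_fst diff, of v 0] by simp
      show ?thesis
      proof (cases "fst v = 0")
        case True
        have "dderiv 0 c x = 0" for x
          using linear_simps(3)[OF has_derivative_bounded_linear[OF has_derivative_dderiv[OF diff]]] .
        then show ?thesis using growth_const[of 0 C M n] M growth_nonneg[OF Suc.prems] by (simp add: D True)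
      next
        case False
        then have "fst v \<in> Basis" using that by (auto simp: Basis_prod_def)
        then show ?thesis unfolding D using Suc.prems by (intro Suc.IH) simp
      qed
    qed
    ultimately show ?case using base[OF Suc.prems] by simp
  }
qed

lemma tame_fst: "0 \<le> M \<Longrightarrow> tame M c \<Longrightarrow> tame M (\<lambda>p :: 'b::euclidean_space \<times> 'b. c (fst p))"
  by (rule tameI, elim tameE, rule exI, rule growth_fst)

lemma lborel_integral_pair:
  fixes f :: "'a::euclidean_space \<times> 'b::euclidean_space \<Rightarrow> complex"
  assumes "integrable lborel f"
  shows "(LINT p|lborel. f p) = (LINT x|lborel. LINT y|lborel. f (x, y))"
    and "(LINT p|lborel. f p) = (LINT y|lborel. LINT x|lborel. f (x, y))"
  using lborel_pair.integral_fst[of "\<lambda>x y. f (x, y)"] lborel_pair.integral_snd[of "\<lambda>x y. f (x, y)"] assms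
  by (simp_all add: lborel_prod)

lemma gauss_pair: "gauss (z, \<zeta>) = gauss z * gauss \<zeta>"
  by (simp add: gauss_def add_divide_distrib flip: exp_add of_real_mult)

text \<open>Integrating in the space variable first yields the Fourier transform of the cut-off
  \<open>c\<close>, tested against a wide Gaussian. \<open>gauss_inversion\<close> turns this into
  an average of \<open>c\<close> concentrating at the origin.\<close>

lemma Lam_fst:
  fixes c :: "'b::euclidean_space \<Rightarrow> complex"
  assumes M: "0 \<le> M" and c: "tame M c"
  shows "Lam (\<lambda>p. c (fst p)) = c 0"
proof (rule Lam_eqI[OF tame_fst[OF M c]])
  define t where "t n = inverse (real (Suc n))" for n
  have t: "0 < t n" "t n \<le> 1" for n by (simp_all only: t_def inverse_Suc_bounds)
  have t0: "t \<longlonglongrightarrow> 0" unfolding t_def by (rule LIMSEQ_inverse_real_of_nat)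
  \<comment> \<open>The space half of the cutoff stays with \<open>c\<close> to make it rapid, so
    after the rescaling in \<open>gauss_inversion\<close> it is evaluated at a point scaled
    twice.\<close>
  define h where "h n z = gauss (t n *\<^sub>R z) * c z" for n z
  have h: "rapid (h n)" for n
    unfolding h_def by (intro rapid_mult_tame[OF _ c] rapid_scale[OF _ t] rapid_gauss)
  have "osc (reg n (\<lambda>p. c (fst p))) = gauss_mass TYPE('b) * (LINT u|lborel. h n (t n *\<^sub>R u) * gauss u)" for n
  proof -
    have "osc (reg n (\<lambda>p. c (fst p)))
        = (LINT \<zeta>|lborel. LINT z|lborel. osc_phase (z, \<zeta>) * reg n (\<lambda>p. c (fst p)) (z, \<zeta>))"
      unfolding osc_def
      by (rule lborel_integral_pair(2)[OF osc_integrable[OF rapid_reg[OF tame_fst[OF M c]]]])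
    also have "\<dots> = (LINT \<zeta>|lborel. LINT z|lborel. gauss (t n *\<^sub>R \<zeta>) * (h n z * exp (- (\<i> * of_real (z \<bullet> \<zeta>)))))"
      by (simp add: osc_phase_def reg_def h_def t_def scaleR_Pair gauss_pair ac_simps)
    also have "\<dots> = (LINT \<zeta>|lborel. gauss (t n *\<^sub>R \<zeta>) * ft (h n) \<zeta>)"
      by (simp add: ft_def)
    finally show ?thesis by (simp add: gauss_inversion[OF h t])
  qed
  moreover obtain C where C: "growth 0 M C c" using c unfolding tame_def by blast
  have "(\<lambda>n. LINT u|lborel. h n (t n *\<^sub>R u) * gauss u) \<longlonglongrightarrow> gauss_mass TYPE('b) * c 0"
  proof (rule gauss_approximation)
    show "(\<lambda>n. h n (t n *\<^sub>R u)) \<longlonglongrightarrow> c 0" for u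
    proof -
      have tu: "(\<lambda>n. t n *\<^sub>R u) \<longlonglongrightarrow> 0" using tendsto_scaleR[OF t0 tendsto_const[of u]] by simp
      have ttu: "(\<lambda>n. t n *\<^sub>R t n *\<^sub>R u) \<longlonglongrightarrow> 0" using tendsto_scaleR[OF t0 tu] by simp
      show ?thesis
        using tendsto_mult[OF continuous_on_tendsto_compose[OF continuous_gauss ttu]
            continuous_on_tendsto_compose[OF growth_cont[OF C] tu]] by (simp add: h_def)
    qed
    show "norm (h n (t n *\<^sub>R u)) \<le> C * (1 + norm u) powr M" for n u
    proof -
      have "norm (h n (t n *\<^sub>R u)) \<le> norm (c (t n *\<^sub>R u))"
        unfolding h_def norm_mult by (intro mult_left_le_one_le norm_gauss_le norm_ge_zero)
      also have "\<dots> \<le> C * (1 + norm (t n *\<^sub>R u)) powr M" by (rule growth_le[OF C])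
      also have "\<dots> \<le> C * (1 + norm u) powr M"
        using t[of n] M by (intro mult_left_mono powr_mono2 growth_nonneg[OF C]) (simp_all add: mult_left_le_one_le)
      finally show ?thesis .
    qed
    show "continuous_on UNIV (\<lambda>u. h n (t n *\<^sub>R u))" for n
      by (intro continuous_on_compose2[OF rapid_cont[OF h]] continuous_intros) simp
  qed
  ultimately show "(\<lambda>n. osc (reg n (\<lambda>p. c (fst p)))) \<longlonglongrightarrow> (gauss_mass TYPE('b))\<^sup>2 * c 0"
    using tendsto_mult_left[of _ "gauss_mass TYPE('b) * c 0"] by (simp add: power2_eq_square mult.assoc)
qed

section \<open>Symbols and Taylor expansion in the covariable\<close>

text \<open>The function \<open>K\<close> of the class is eliminated: the normalised modulus is the
  least possible \<open>K\<close>. The weight involves the covariable only, but the limit is taken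
  in both variables.\<close>

definition vanishing :: "real \<Rightarrow> ('b::euclidean_space \<times> 'b \<Rightarrow> complex) \<Rightarrow> bool" where
  "vanishing m u \<longleftrightarrow> ((\<lambda>p. norm (u p) * (1 + norm (snd p)) powr (- m)) \<longlongrightarrow> 0) at_infinity"

definition xi_deg :: "'b::euclidean_space \<times> 'b \<Rightarrow> real" where
  "xi_deg v = (if fst v = 0 then 1 else 0)"

text \<open>The class \<open>V\<^sup>s\<close>, with coordinate derivatives taken in an arbitrary order.\<close>

definition symb :: "real \<Rightarrow> ('b::euclidean_space \<times> 'b \<Rightarrow> complex) \<Rightarrow> bool" where
  "symb s \<sigma> \<longleftrightarrow> smooth \<sigma> \<and> (\<forall>vs. set vs \<subseteq> Basis \<longrightarrow>
     vanishing (s - (\<Sum>v\<leftarrow>vs. xi_deg v)) (foldr dderiv vs \<sigma>))"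

lemma symb_smooth: "symb s \<sigma> \<Longrightarrow> smooth \<sigma>"
  by (simp add: symb_def)

lemma symb_vanishing: "symb s \<sigma> \<Longrightarrow> vanishing s \<sigma>"
  unfolding symb_def by (auto dest: spec[of _ "[]"])

lemma symb_dderiv:
  assumes "symb s \<sigma>" "v \<in> Basis"
  shows "symb (s - xi_deg v) (dderiv v \<sigma>)"
proof -
  have "vanishing (s - xi_deg v - (\<Sum>v\<leftarrow>vs. xi_deg v)) (foldr dderiv vs (dderiv v \<sigma>))" if "set vs \<subseteq> Basis" for vs
  proof -
    have "vanishing (s - (\<Sum>v\<leftarrow>vs @ [v]. xi_deg v)) (foldr dderiv (vs @ [v]) \<sigma>)"
      using assms that unfolding symb_def by (metis Un_subset_iff empty_set empty_subsetI insert_subset list.simps(15) set_append)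
    then show ?thesis by (simp add: algebra_simps)
  qed
  then show ?thesis using assms by (simp add: symb_def smooth_dderiv)
qed

lemma vanishing_mono:
  assumes "vanishing m u" "m \<le> m'"
  shows "vanishing m' u"
  unfolding vanishing_def
proof (rule Lim_null_comparison[OF always_eventually assms(1)[unfolded vanishing_def]], rule allI)
  fix p :: "'a \<times> 'a"
  show "norm (norm (u p) * (1 + norm (snd p)) powr (- m')) \<le> norm (u p) * (1 + norm (snd p)) powr (- m)"
    using assms(2) by (simp add: mult_left_mono powr_mono)
qed

lemma symb_mono: "symb s \<sigma> \<Longrightarrow> s \<le> s' \<Longrightarrow> symb s' \<sigma>"
  unfolding symb_def by (meson diff_right_mono vanishing_mono)

lemma xi_deg_nonneg: "0 \<le> xi_deg v"
  by (simp add: xi_deg_def)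

lemma xi_deg_snd [simp]: "xi_deg (0, e) = 1"
  by (simp add: xi_deg_def)

lemma symb_dderiv_same: "symb s \<sigma> \<Longrightarrow> v \<in> Basis \<Longrightarrow> symb s (dderiv v \<sigma>)"
  using symb_mono[OF symb_dderiv[of s \<sigma> v], of s] xi_deg_nonneg[of v] by simp

lemma vanishing_eps:
  "vanishing m u \<longleftrightarrow> (\<forall>e>0. \<forall>\<^sub>F p in at_infinity. norm (u p) \<le> e * (1 + norm (snd p)) powr m)"
proof -
  have pos: "(1 + norm x) powr m > 0" for x :: 'a by (simp add: add_nonneg_eq_0_iff)
  have iff: "norm (u p) * (1 + norm (snd p)) powr (- m) \<le> e \<longleftrightarrow> norm (u p) \<le> e * (1 + norm (snd p)) powr m" for e p
    using pos[of "snd p"] by (simp add: powr_minus field_simps)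
  have "vanishing m u \<longleftrightarrow> (\<forall>e>0. \<forall>\<^sub>F p in at_infinity. norm (u p) * (1 + norm (snd p)) powr (- m) < e)"
    unfolding vanishing_def tendsto_iff by simp
  also have "\<dots> \<longleftrightarrow> (\<forall>e>0. \<forall>\<^sub>F p in at_infinity. norm (u p) * (1 + norm (snd p)) powr (- m) \<le> e)"
  proof safe
    fix e :: real assume e: "0 < e" and *: "\<forall>e>0. \<forall>\<^sub>F p in at_infinity. norm (u p) * (1 + norm (snd p)) powr (- m) \<le> e"
    from *[rule_format, of "e / 2"] e
    show "\<forall>\<^sub>F p in at_infinity. norm (u p) * (1 + norm (snd p)) powr (- m) < e"
      by (auto elim!: eventually_mono)
  qed (auto elim!: eventually_mono)
  finally show ?thesis by (simp add: iff)
qed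

text \<open>Recovers the boundedness of \<open>K\<close>: the limit controls the complement of a
  ball, continuity and compactness the ball.\<close>

lemma vanishing_bounded:
  assumes "vanishing m u" "continuous_on UNIV u"
  obtains C where "0 \<le> C" "\<And>p. norm (u p) \<le> C * (1 + norm (snd p)) powr m"
proof -
  obtain R where R: "\<And>p. R \<le> norm p \<Longrightarrow> norm (u p) \<le> 1 * (1 + norm (snd p)) powr m"
    using assms(1)[unfolded vanishing_eps, rule_format, of 1] unfolding eventually_at_infinity by force
  let ?g = "\<lambda>p. norm (u p) * (1 + norm (snd p)) powr (- m)"
  have "continuous_on (cball 0 R) ?g"
    by (intro continuous_intros continuous_on_subset[OF assms(2)]) (auto simp: add_nonneg_eq_0_iff)
  then have "bounded (?g ` cball 0 R)" by (intro compact_imp_bounded compact_continuous_image) auto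
  then obtain B where "\<forall>x\<in>?g ` cball 0 R. norm x \<le> B"
    unfolding bounded_iff by blast
  then have B: "norm (?g p) \<le> B" if "norm p \<le> R" for p
    using that mem_cball_0[of p R] by blast
  have "norm (u p) \<le> max 1 B * (1 + norm (snd p)) powr m" for p
  proof (cases "R \<le> norm p")
    case True
    then show ?thesis using order_trans[OF R mult_right_mono[of 1 "max 1 B"]] by simp
  next
    case False
    have pos: "(1 + norm (snd p)) powr m > 0" by (simp add: add_nonneg_eq_0_iff)
    have "norm (u p) \<le> B * (1 + norm (snd p)) powr m"
      using B[of p] False pos by (simp add: powr_minus field_simps)
    also have "\<dots> \<le> max 1 B * (1 + norm (snd p)) powr m" by (intro mult_right_mono) auto
    finally show ?thesis .
  qed
  then show thesis by (intro that[of "max 1 B"]) auto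
qed

text \<open>The gain from covariable derivatives is discarded. The absolute value of
  \<open>s\<close> appears because a decaying power of the covariable alone does not decay in
  \<open>norm p\<close>.\<close>

lemma symb_tame:
  assumes "symb s \<sigma>" shows "tame \<bar>s\<bar> \<sigma>"
proof (rule tameI)
  fix n
  show "\<exists>C. growth n \<bar>s\<bar> C \<sigma>" using assms
  proof (induction n arbitrary: \<sigma>)
    have base: "\<exists>C. growth 0 \<bar>s\<bar> C \<sigma>" if \<sigma>: "symb s \<sigma>" for \<sigma> :: "'a \<times> 'a \<Rightarrow> complex"
    proof -
      obtain C where C: "0 \<le> C" "\<And>p. norm (\<sigma> p) \<le> C * (1 + norm (snd p)) powr s"
        by (rule vanishing_bounded[OF symb_vanishing[OF \<sigma>] smooth_cont[OF symb_smooth[OF \<sigma>]]]) (rule that)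
      have "(1 + norm (snd p)) powr s \<le> (1 + norm p) powr \<bar>s\<bar>" for p :: "'a \<times> 'a"
        using norm_snd_le[of "snd p" "fst p"]
        by (intro order_trans[OF powr_mono powr_mono2]) simp_all
      then have "norm (\<sigma> p) \<le> C * (1 + norm p) powr \<bar>s\<bar>" for p
        by (meson C mult_left_mono order_trans)
      then show ?thesis using smooth_cont[OF symb_smooth[OF \<sigma>]] by auto
    qed
    {
      case 0
      then show ?case by (rule base)
    next
      case (Suc n)
      show ?case
        by (rule ex_growth_SucI[OF smooth_differentiable[OF symb_smooth[OF Suc.prems]] base[OF Suc.prems]
              Suc.IH[OF symb_dderiv_same[OF Suc.prems]]])
    }
  qed
qed

text \<open>If \<open>norm p\<close> is at most half of \<open>norm q\<close>, then
  \<open>q + p\<close> is still far out and the small bound applies. Otherwise \<open>norm p\<close>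
  is itself large, and one factor \<open>1 + norm p\<close> turns the global constant
  \<open>K\<close> into \<open>e\<close>. This is the origin of the \<open>+ 1\<close> in the
  exponent.\<close>

lemma vanishing_translate:
  assumes u: "vanishing m u" "continuous_on UNIV u" and e: "0 < e"
  shows "\<forall>\<^sub>F q in at_infinity. \<forall>p. norm (u (q + p)) \<le> e * (1 + norm (snd q)) powr m * (1 + norm p) powr (\<bar>m\<bar> + 1)"
proof -
  obtain K where K: "0 \<le> K" "\<And>p. norm (u p) \<le> K * (1 + norm (snd p)) powr m"
    by (rule vanishing_bounded[OF u]) (rule that)
  obtain R where R: "\<And>p. R \<le> norm p \<Longrightarrow> norm (u p) \<le> e * (1 + norm (snd p)) powr m"
    using u(1)[unfolded vanishing_eps, rule_format, OF e] unfolding eventually_at_infinity by blast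
  have "norm (u (q + p)) \<le> e * (1 + norm (snd q)) powr m * (1 + norm p) powr (\<bar>m\<bar> + 1)"
    if q: "max (2 * R) (2 * K / e) \<le> norm q" for q p
  proof -
    have *: "norm (u (q + p)) \<le> (e * (1 + norm p)) * (1 + norm (snd (q + p))) powr m"
    proof (cases "norm p \<le> norm q / 2")
      case True
      have "norm q \<le> norm (q + p) + norm p" using norm_triangle_ineq4[of "q + p" p] by simp
      then have "R \<le> norm (q + p)" using True q by simp
      from R[OF this] show ?thesis
        by (rule order_trans) (use e in \<open>simp add: mult_right_mono\<close>)
    next
      case False
      then have "K / e \<le> norm p" using q by simp
      then have "K \<le> e * (1 + norm p)" using e by (simp add: field_simps)
      then show ?thesis by (rule order_trans[OF K(2) mult_right_mono]) simp
    qed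
    have "(1 + norm (snd (q + p))) powr m \<le> (1 + norm (snd p)) powr \<bar>m\<bar> * (1 + norm (snd q)) powr m"
      using peetre[of "snd p" "snd q" m] by (simp add: add.commute)
    also have "\<dots> \<le> (1 + norm p) powr \<bar>m\<bar> * (1 + norm (snd q)) powr m"
      using norm_snd_le[of "snd p" "fst p"] by (intro mult_right_mono powr_mono2) simp_all
    finally have "(e * (1 + norm p)) * (1 + norm (snd (q + p))) powr m
        \<le> (e * (1 + norm p)) * ((1 + norm p) powr \<bar>m\<bar> * (1 + norm (snd q)) powr m)"
      using e by (intro mult_left_mono) simp_all
    also have "\<dots> = e * (1 + norm (snd q)) powr m * (1 + norm p) powr (\<bar>m\<bar> + 1)"
      by (simp add: powr_add)
    finally show ?thesis using * by simp
  qed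
  then show ?thesis unfolding eventually_at_infinity by blast
qed

text \<open>The part of degree \<open>k\<close> in the covariable of the Taylor polynomial at
  covariable 0, in the form of Euler's recursion for homogeneous polynomials. No multi-indices or
  factorials are needed on an abstract space.\<close>

primrec taylor_term :: "nat \<Rightarrow> ('b::euclidean_space \<times> 'b \<Rightarrow> complex) \<Rightarrow> 'b \<times> 'b \<Rightarrow> complex" where
  "taylor_term 0 b = (\<lambda>p. b (fst p, 0))"
| "taylor_term (Suc k) b = (\<lambda>p. of_real (inverse (real (Suc k))) *
     (\<Sum>e\<in>Basis. of_real (snd p \<bullet> e) * taylor_term k (dderiv (0, e) b) p))"

text \<open>The recursion of \<open>taylor_term\<close> with each covariable coordinate replaced by
  -i times the derivative in the dual space direction, as \<open>Lam_mult_snd\<close> dictates, and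
  without freezing the covariable.\<close>

primrec expansion_term :: "nat \<Rightarrow> ('b::euclidean_space \<times> 'b \<Rightarrow> complex) \<Rightarrow> 'b \<times> 'b \<Rightarrow> complex" where
  "expansion_term 0 b = b"
| "expansion_term (Suc k) b = (\<lambda>p. of_real (inverse (real (Suc k))) *
     (\<Sum>e\<in>Basis. - \<i> * expansion_term k (dderiv (e, 0) (dderiv (0, e) b)) p))"

definition taylor_rest :: "nat \<Rightarrow> ('b::euclidean_space \<times> 'b \<Rightarrow> complex) \<Rightarrow> 'b \<times> 'b \<Rightarrow> complex" where
  "taylor_rest N b = (\<lambda>p. b p - (\<Sum>k<N. taylor_term k b p))"

lemma has_derivative_freeze:
  fixes b :: "'b::euclidean_space \<times> 'b \<Rightarrow> complex"
  assumes "\<And>p. b differentiable at p"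
  shows "((\<lambda>z. b (z, 0)) has_derivative (\<lambda>v. dderiv (v, 0) b (z, 0))) (at z)"
proof -
  have "bounded_linear (\<lambda>z :: 'b. (z, 0 :: 'b))"
    by (intro bounded_linear_Pair bounded_linear_ident bounded_linear_zero)
  from has_derivative_affine_comp[OF this assms, where c = 0] show ?thesis by simp
qed

lemma growth_freeze:
  fixes b :: "'b::euclidean_space \<times> 'b \<Rightarrow> complex"
  shows "growth n M C b \<Longrightarrow> growth n M C (\<lambda>z. b (z, 0))"
proof (induction n arbitrary: b)
  have base: "norm (b (z, 0)) \<le> C * (1 + norm z) powr M" if "growth n M C b" for n b and z :: 'b
    using growth_le[OF that, of "(z, 0)"] by (simp add: norm_Pair)
  {
    case 0
    then show ?case using base[OF 0]
      by (auto intro!: continuous_on_compose2[of UNIV b UNIV "\<lambda>z. (z, 0)"] continuous_on_Pair)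
  next
    case (Suc n)
    have diff: "b differentiable at p" for p by (rule growth_differentiable[OF Suc.prems])
    have "dderiv v (\<lambda>z. b (z, 0)) = (\<lambda>z. dderiv (v, 0) b (z, 0))" for v
      by (intro ext dderiv_eqI has_derivative_freeze diff)
    moreover have "(v, 0 :: 'b) \<in> Basis" if "v \<in> Basis" for v :: 'b using that by (simp add: Basis_prod_def)
    ultimately have "growth n M C (dderiv v (\<lambda>z. b (z, 0)))" if "v \<in> Basis" for v
      using Suc.IH[OF growth_dderiv[OF Suc.prems, of "(v, 0)"]] that by simp
    then show ?case
      using base[OF Suc.prems] differentiableI[OF has_derivative_freeze[OF diff]] by simp
  }
qed

lemma tame_taylor_term:
  fixes b :: "'b::euclidean_space \<times> 'b \<Rightarrow> complex"
  assumes M: "0 \<le> M"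
  shows "tame M b \<Longrightarrow> tame (M + real k) (taylor_term k b)"
proof (induction k arbitrary: b)
  case 0
  have "tame M (\<lambda>z. b (z, 0))"
    using 0 by (rule tameE[THEN tameI[rotated]]) (blast intro: growth_freeze)
  then show ?case using tame_fst[OF M] by simp
next
  case (Suc k)
  have "tame (1 + (M + real k)) (\<lambda>p. of_real (p \<bullet> (0, e)) * taylor_term k (dderiv (0, e) b) p)" for e
    by (intro tame_mult tame_inner Suc.IH tame_dderiv Suc.prems)
  then have "tame (1 + (M + real k)) (\<lambda>p. of_real (snd p \<bullet> e) * taylor_term k (dderiv (0, e) b) p)" for e
    by (simp add: inner_prod_def)
  then have "tame (1 + (M + real k)) (taylor_term (Suc k) b)"
    unfolding taylor_term.simps by (intro tame_cmult tame_sum finite_Basis)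
  then show ?case by (simp add: add_ac)
qed

lemma differentiable_taylor_term:
  fixes b :: "'b::euclidean_space \<times> 'b \<Rightarrow> complex"
  assumes "tame M b" "0 \<le> M" shows "taylor_term k b differentiable at p"
  by (rule smooth_differentiable[OF tame_smooth[OF tame_taylor_term[OF assms(2,1)]]])

lemma dderiv_taylor_term_0:
  fixes b :: "'b::euclidean_space \<times> 'b \<Rightarrow> complex"
  assumes b: "tame M b"
  shows "dderiv v (taylor_term 0 b) = taylor_term 0 (dderiv (fst v, 0) b)"
proof -
  have diff: "b differentiable at p" for p by (rule smooth_differentiable[OF tame_smooth[OF b]])
  have "((\<lambda>p. b (fst p, 0)) has_derivative (\<lambda>v. dderiv (fst v, 0) b (fst p, 0))) (at p)" for p
    by (rule has_derivative_compose[OF has_derivative_fst[OF has_derivative_ident] has_derivative_freeze[OF diff]])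
  then show ?thesis unfolding taylor_term.simps by (intro ext dderiv_eqI)
qed

lemma dderiv_taylor_term_Suc:
  fixes b :: "'b::euclidean_space \<times> 'b \<Rightarrow> complex"
  assumes b: "tame M b" "0 \<le> M"
  shows "dderiv v (taylor_term (Suc k) b) = (\<lambda>p. of_real (inverse (real (Suc k))) *
    (\<Sum>e\<in>Basis. of_real (snd p \<bullet> e) * dderiv v (taylor_term k (dderiv (0, e) b)) p
        + of_real (snd v \<bullet> e) * taylor_term k (dderiv (0, e) b) p))"
proof
  fix p :: "'b \<times> 'b"
  have l: "((\<lambda>p. complex_of_real (snd p \<bullet> e)) has_derivative (\<lambda>v. of_real (snd v \<bullet> e))) (at p)" for e
    by (intro has_derivative_of_real has_derivative_inner_left has_derivative_snd has_derivative_ident)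
  have "(taylor_term (Suc k) b has_derivative (\<lambda>v. of_real (inverse (real (Suc k))) *
    (\<Sum>e\<in>Basis. of_real (snd p \<bullet> e) * dderiv v (taylor_term k (dderiv (0, e) b)) p
        + of_real (snd v \<bullet> e) * taylor_term k (dderiv (0, e) b) p))) (at p)"
    unfolding taylor_term.simps
    by (intro has_derivative_mult_right has_derivative_sum has_derivative_mult l has_derivative_dderiv
        differentiable_taylor_term[OF tame_dderiv[OF b(1)] b(2)])
  then show "dderiv v (taylor_term (Suc k) b) p = of_real (inverse (real (Suc k))) *
    (\<Sum>e\<in>Basis. of_real (snd p \<bullet> e) * dderiv v (taylor_term k (dderiv (0, e) b)) p
        + of_real (snd v \<bullet> e) * taylor_term k (dderiv (0, e) b) p)"
    by (rule dderiv_eqI)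
qed

lemma dderiv_fst_taylor_term:
  fixes b :: "'b::euclidean_space \<times> 'b \<Rightarrow> complex"
  assumes M: "0 \<le> M"
  shows "tame M b \<Longrightarrow> dderiv (e, 0) (taylor_term k b) = taylor_term k (dderiv (e, 0) b)"
proof (induction k arbitrary: b)
  case 0
  then show ?case using dderiv_taylor_term_0[OF 0] by simp
next
  case (Suc k)
  have "dderiv (e, 0) (taylor_term k (dderiv (0, f) b)) = taylor_term k (dderiv (0, f) (dderiv (e, 0) b))" for f
    by (simp add: Suc.IH[OF tame_dderiv[OF Suc.prems]] dderiv_commute_smooth[OF tame_smooth[OF Suc.prems], of "(e, 0)"])
  then show ?case
    unfolding dderiv_taylor_term_Suc[OF Suc.prems M] by simp
qed

lemma dderiv_zero: "b differentiable at p \<Longrightarrow> dderiv 0 b p = 0"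
  using linear_simps(3)[OF has_derivative_bounded_linear[OF has_derivative_dderiv]] .

text \<open>For degree k + 1 the product rule gives one copy of the \<open>k\<close>-th term of the
  derivative from the linear factor and, by induction, \<open>k\<close> more from the inner terms.
  These k + 1 copies cancel the normalising factor.\<close>

lemma dderiv_snd_taylor_term:
  fixes b :: "'b::euclidean_space \<times> 'b \<Rightarrow> complex"
  assumes M: "0 \<le> M" and e: "e \<in> Basis"
  shows "tame M b \<Longrightarrow> dderiv (0, e) (taylor_term k b) =
    (if k = 0 then (\<lambda>_. 0) else taylor_term (k - 1) (dderiv (0, e) b))"
proof (induction k arbitrary: b)
  case 0
  have "dderiv (0, 0) b = (\<lambda>_. 0)"
    using dderiv_zero[OF smooth_differentiable[OF tame_smooth[OF 0]]] by (simp add: fun_eq_iff zero_prod_def)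
  then show ?case using dderiv_taylor_term_0[OF 0, of "(0, e)"] by simp
next
  case (Suc k)
  have e1: "(\<Sum>f\<in>Basis. of_real (e \<bullet> f) * taylor_term k (dderiv (0, f) b) p) = taylor_term k (dderiv (0, e) b) p" for p
  proof -
    have "(\<Sum>f\<in>Basis. of_real (e \<bullet> f) * taylor_term k (dderiv (0, f) b) p)
       = (\<Sum>f\<in>Basis. if f = e then taylor_term k (dderiv (0, f) b) p else 0)"
      using e by (intro sum.cong) (auto simp: inner_Basis)
    then show ?thesis using e by simp
  qed
  have comm: "dderiv (0, e) (dderiv (0, f) b) = dderiv (0, f) (dderiv (0, e) b)" for f
    by (rule dderiv_commute_smooth[OF tame_smooth[OF Suc.prems]])
  show ?case
  proof (cases k)
    case 0
    have "dderiv (0, e) (taylor_term 0 (dderiv (0, f) b)) = (\<lambda>_. 0)" for f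
      using Suc.IH[OF tame_dderiv[OF Suc.prems]] 0 by simp
    then show ?thesis using e1 unfolding dderiv_taylor_term_Suc[OF Suc.prems M] by (simp add: 0)
  next
    case (Suc j)
    have "dderiv (0, e) (taylor_term k (dderiv (0, f) b)) = taylor_term j (dderiv (0, f) (dderiv (0, e) b))" for f
      using Suc.IH[OF tame_dderiv[OF Suc.prems]] Suc by (simp add: comm)
    moreover have "(\<Sum>f\<in>Basis. of_real (snd p \<bullet> f) * taylor_term j (dderiv (0, f) (dderiv (0, e) b)) p)
        = of_real (real (Suc j)) * taylor_term k (dderiv (0, e) b) p" for p
      by (simp add: Suc del: of_nat_Suc)
    ultimately have "dderiv (0, e) (taylor_term (Suc k) b) = (\<lambda>p. of_real (inverse (real (Suc k))) *
      (of_real (real (Suc j)) * taylor_term k (dderiv (0, e) b) p + taylor_term k (dderiv (0, e) b) p))"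
      unfolding dderiv_taylor_term_Suc[OF Suc.prems M] by (simp add: sum.distrib e1 del: of_real_inverse of_nat_Suc)
    also have "\<dots> = taylor_term k (dderiv (0, e) b)"
    proof -
      have r: "real (Suc j) + 1 = real (Suc k)" using Suc by simp
      have "inverse (real (Suc k)) * (real (Suc j) + 1) = 1" unfolding r by simp
      then have "complex_of_real (inverse (real (Suc k)) * (real (Suc j) + 1)) = 1"
        by (simp only: of_real_1)
      then have "complex_of_real (inverse (real (Suc k))) * (of_real (real (Suc j)) + 1) = 1"
        by (simp only: of_real_mult of_real_add of_real_1)
      then have "of_real (inverse (real (Suc k))) * (of_real (real (Suc j)) * x + x) = x" for x :: complex
        by (metis distrib_right mult.assoc mult_1)
      then show ?thesis by simp
    qed
    finally show ?thesis by simp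
  qed
qed

lemma smooth_cmult: "smooth f \<Longrightarrow> smooth (\<lambda>p. c * f p)"
  by (simp add: smooth_def times_diff_cmult)

lemma smooth_sum: "(\<And>i. i \<in> I \<Longrightarrow> smooth (f i)) \<Longrightarrow> smooth (\<lambda>p. \<Sum>i\<in>I. f i p)"
  by (simp add: smooth_def times_diff_sum)

lemma smooth_expansion_term: "smooth a \<Longrightarrow> smooth (expansion_term k a)"
proof (induction k arbitrary: a)
  case (Suc k)
  then show ?case unfolding expansion_term.simps by (intro smooth_cmult smooth_sum Suc.IH smooth_dderiv)
qed simp

lemma dderiv_expansion_term:
  "smooth a \<Longrightarrow> dderiv v (expansion_term k a) = expansion_term k (dderiv v a)"
proof (induction k arbitrary: a)
  case (Suc k)
  let ?a = "\<lambda>e. dderiv (e, 0) (dderiv (0, e) a)"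
  have sm: "smooth (?a e)" for e by (intro smooth_dderiv Suc.prems)
  have diff: "expansion_term k (?a e) differentiable at p" for e p
    by (rule smooth_differentiable[OF smooth_expansion_term[OF sm]])
  have diff': "(\<lambda>p. - \<i> * expansion_term k (?a e) p) differentiable at p" for e p
    by (rule smooth_differentiable[OF smooth_cmult[OF smooth_expansion_term[OF sm]]])
  have diff'': "(\<lambda>p. \<Sum>e\<in>Basis. - \<i> * expansion_term k (?a e) p) differentiable at p" for p
    by (rule smooth_differentiable[OF smooth_sum[OF smooth_cmult[OF smooth_expansion_term[OF sm]]]])
  have comm: "dderiv v (?a e) = dderiv (e, 0) (dderiv (0, e) (dderiv v a))" for e
    by (simp add: dderiv_commute_smooth[of _ v] smooth_dderiv Suc.prems)
  show ?case
    unfolding expansion_term.simps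
    by (simp only: dderiv_cmult[OF diff''] dderiv_sum[OF diff'] dderiv_cmult[OF diff] Suc.IH[OF sm] comm)
qed simp

lemma expansion_term_translate:
  "smooth a \<Longrightarrow> expansion_term k (\<lambda>p. a (q + p)) = (\<lambda>p. expansion_term k a (q + p))"
proof (induction k arbitrary: a)
  case (Suc k)
  have "dderiv (e, 0) (dderiv (0, e) (\<lambda>p. a (q + p))) = (\<lambda>p. dderiv (e, 0) (dderiv (0, e) a) (q + p))" for e
    by (simp add: dderiv_translate smooth_differentiable smooth_dderiv Suc.prems)
  then show ?case by (simp add: Suc.IH smooth_dderiv Suc.prems)
qed simp

lemma tame_freeze:
  fixes b :: "'b::euclidean_space \<times> 'b \<Rightarrow> complex"
  shows "tame M b \<Longrightarrow> tame M (\<lambda>z. b (z, 0))"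
  by (rule tameI, elim tameE, rule exI, rule growth_freeze)

text \<open>The space derivative produced by \<open>Lam_mult_snd\<close> passes through
  \<open>taylor_term\<close> by \<open>dderiv_fst_taylor_term\<close>, so the recursions on the two
  sides agree; \<open>Lam_fst\<close> starts the induction.\<close>

lemma Lam_taylor_term:
  fixes b :: "'b::euclidean_space \<times> 'b \<Rightarrow> complex"
  assumes M: "0 \<le> M"
  shows "tame M b \<Longrightarrow> Lam (taylor_term k b) = expansion_term k b 0"
proof (induction k arbitrary: b)
  case 0
  then show ?case using Lam_fst[OF M tame_freeze[OF 0]] by (simp add: zero_prod_def)
next
  case (Suc k)
  have t: "tame (M + k) (taylor_term k (dderiv (0, e) b))" for e
    by (intro tame_taylor_term M tame_dderiv Suc.prems)
  have tt: "tame (1 + (M + k)) (\<lambda>p. of_real (snd p \<bullet> e) * taylor_term k (dderiv (0, e) b) p)" for e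
    using tame_mult[OF tame_inner t, of "(0, e)"] by (simp add: inner_prod_def)
  have "Lam (taylor_term (Suc k) b) = of_real (inverse (real (Suc k))) *
      (\<Sum>e\<in>Basis. Lam (\<lambda>p. of_real (snd p \<bullet> e) * taylor_term k (dderiv (0, e) b) p))"
    unfolding taylor_term.simps
    by (simp only: Lam_cmult[OF tame_sum[OF finite_Basis tt]] Lam_sum[OF finite_Basis tt])
  also have "\<dots> = of_real (inverse (real (Suc k))) *
      (\<Sum>e\<in>Basis. - \<i> * Lam (taylor_term k (dderiv (e, 0) (dderiv (0, e) b))))"
    by (simp only: Lam_mult_snd[OF t] dderiv_fst_taylor_term[OF M tame_dderiv[OF Suc.prems]])
  also have "\<dots> = expansion_term (Suc k) b 0"
    by (simp only: Suc.IH[OF tame_dderiv[OF tame_dderiv[OF Suc.prems]]] expansion_term.simps)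
  finally show ?case .
qed

lemma tame_taylor_rest:
  fixes b :: "'b::euclidean_space \<times> 'b \<Rightarrow> complex"
  assumes "0 \<le> M" "tame M b"
  shows "tame (M + real N) (taylor_rest N b)"
  unfolding taylor_rest_def
  by (intro tame_diff tame_sum tame_mono[OF assms(2)] tame_mono[OF tame_taylor_term[OF assms]]) auto

lemma dderiv_taylor_rest:
  fixes b :: "'b::euclidean_space \<times> 'b \<Rightarrow> complex"
  assumes b: "0 \<le> M" "tame M b"
  shows "dderiv v (taylor_rest N b) = (\<lambda>p. dderiv v b p - (\<Sum>k<N. dderiv v (taylor_term k b) p))"
proof
  fix p
  show "dderiv v (taylor_rest N b) p = dderiv v b p - (\<Sum>k<N. dderiv v (taylor_term k b) p)"
    unfolding taylor_rest_def
    by (rule dderiv_eqI) (intro has_derivative_diff has_derivative_sum has_derivative_dderiv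
      differentiable_taylor_term[OF b(2,1)] smooth_differentiable[OF tame_smooth[OF b(2)]])
qed

lemma dderiv_fst_taylor_rest:
  fixes b :: "'b::euclidean_space \<times> 'b \<Rightarrow> complex"
  assumes b: "0 \<le> M" "tame M b"
  shows "dderiv (e, 0) (taylor_rest N b) = taylor_rest N (dderiv (e, 0) b)"
  unfolding dderiv_taylor_rest[OF b] by (simp add: taylor_rest_def dderiv_fst_taylor_term[OF b])

text \<open>Truncated subtraction is right at \<open>N = 0\<close>: the rest is then
  \<open>b\<close> itself, and its derivative is again a rest of order 0.\<close>

lemma dderiv_snd_taylor_rest:
  fixes b :: "'b::euclidean_space \<times> 'b \<Rightarrow> complex"
  assumes b: "0 \<le> M" "tame M b" and e: "e \<in> Basis"
  shows "dderiv (0, e) (taylor_rest N b) = taylor_rest (N - 1) (dderiv (0, e) b)"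
  unfolding dderiv_taylor_rest[OF b]
  by (cases N) (simp_all add: taylor_rest_def dderiv_snd_taylor_term[OF b(1) e b(2)] sum.lessThan_Suc_shift
      del: sum.lessThan_Suc)

lemma taylor_rest_Suc_zero: "taylor_rest (Suc N) b (z, 0) = 0"
  by (simp add: taylor_rest_def sum.lessThan_Suc_shift del: sum.lessThan_Suc)

text \<open>A rest of positive order vanishes at covariable 0, and its covariable derivatives are
  rests of order one less. Iterating the mean value inequality along the segment to the origin gives
  the power of the norm, without the factorial of the sharp formula.\<close>

lemma taylor_rest_bound:
  fixes b :: "'b::euclidean_space \<times> 'b \<Rightarrow> complex"
  assumes M: "0 \<le> M"
  shows "tame M b \<Longrightarrow>
    (\<And>fs \<theta>. length fs = N \<Longrightarrow> set fs \<subseteq> Basis \<Longrightarrow> \<theta> \<in> {0..1} \<Longrightarrow>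
       norm (foldr (\<lambda>e. dderiv (0, e)) fs b (z, \<theta> *\<^sub>R \<zeta>)) \<le> B) \<Longrightarrow>
    norm (taylor_rest N b (z, \<zeta>)) \<le> (real DIM('b) * norm \<zeta>) ^ N * B"
proof (induction N arbitrary: b \<zeta>)
  case 0
  from 0(2)[of "[]" 1] show ?case by (simp add: taylor_rest_def)
next
  case (Suc N)
  let ?d = "real DIM('b) * norm \<zeta>"
  have B: "norm (taylor_rest N (dderiv (0, e) b) (z, s *\<^sub>R \<zeta>)) \<le> ?d ^ N * B"
    if s: "s \<in> {0..1}" and e: "e \<in> Basis" for s e
  proof -
    have hyp: "norm (foldr (\<lambda>e. dderiv (0, e)) fs (dderiv (0, e) b) (z, \<theta> *\<^sub>R s *\<^sub>R \<zeta>)) \<le> B"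
      if "length fs = N" "set fs \<subseteq> Basis" "\<theta> \<in> {0..1}" for fs \<theta>
      using Suc.prems(2)[of "fs @ [e]" "\<theta> * s"] that s e by (simp add: mult_le_one)
    \<comment> \<open>\<open>N\<close> equal directions are enough to read off the sign of
      \<open>B\<close>, which is needed when the norm of \<open>s *\<^sub>R \<zeta>\<close> is
      replaced by that of \<open>\<zeta>\<close>.\<close>
    have "0 \<le> B"
    proof -
      have "norm (foldr (\<lambda>e. dderiv (0, e)) (replicate N e) (dderiv (0, e) b) (z, 1 *\<^sub>R s *\<^sub>R \<zeta>)) \<le> B"
        by (rule hyp) (use e in auto)
      then show ?thesis using norm_ge_zero order_trans by blast
    qed
    have "norm (taylor_rest N (dderiv (0, e) b) (z, s *\<^sub>R \<zeta>)) \<le> (real DIM('b) * norm (s *\<^sub>R \<zeta>)) ^ N * B"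
      by (rule Suc.IH[OF tame_dderiv[OF Suc.prems(1)] hyp])
    also have "\<dots> \<le> ?d ^ N * B"
      using s \<open>0 \<le> B\<close> by (intro mult_right_mono power_mono) (simp_all add: mult_left_le_one_le)
    finally show ?thesis .
  qed
  have diff: "taylor_rest (Suc N) b differentiable at p" for p
    by (rule smooth_differentiable[OF tame_smooth[OF tame_taylor_rest[OF M Suc.prems(1)]]])
  have "norm (taylor_rest (Suc N) b ((z, 0) + (0, \<zeta>)) - taylor_rest (Suc N) b (z, 0)) \<le> ?d ^ Suc N * B"
  proof (rule norm_diff_along_le[OF diff])
    fix s :: real assume s: "s \<in> {0..1}"
    let ?p = "(z, 0) + s *\<^sub>R (0, \<zeta>)"
    have "dderiv (0, \<zeta>) (taylor_rest (Suc N) b) ?p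
        = (\<Sum>e\<in>Basis. of_real (\<zeta> \<bullet> e) * taylor_rest N (dderiv (0, e) b) ?p)"
    proof -
      interpret D: bounded_linear "\<lambda>v. dderiv v (taylor_rest (Suc N) b) ?p"
        using has_derivative_dderiv[OF diff] by (rule has_derivative_bounded_linear)
      have "(\<Sum>e\<in>Basis. (\<zeta> \<bullet> e) *\<^sub>R (0 :: 'b, e)) = (0, \<zeta>)"
        by (simp add: prod_eq_iff fst_sum snd_sum euclidean_representation)
      then have "dderiv (0, \<zeta>) (taylor_rest (Suc N) b) ?p
          = dderiv (\<Sum>e\<in>Basis. (\<zeta> \<bullet> e) *\<^sub>R (0 :: 'b, e)) (taylor_rest (Suc N) b) ?p" by simp
      also have "\<dots> = (\<Sum>e\<in>Basis. of_real (\<zeta> \<bullet> e) * dderiv (0, e) (taylor_rest (Suc N) b) ?p)"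
        by (simp only: D.sum D.scale) (simp add: scaleR_conv_of_real)
      also have "\<dots> = (\<Sum>e\<in>Basis. of_real (\<zeta> \<bullet> e) * taylor_rest N (dderiv (0, e) b) ?p)"
        by (intro sum.cong refl) (simp add: dderiv_snd_taylor_rest[OF M Suc.prems(1)])
      finally show ?thesis .
    qed
    then have "norm (dderiv (0, \<zeta>) (taylor_rest (Suc N) b) ?p)
        \<le> (\<Sum>e\<in>Basis. norm (of_real (\<zeta> \<bullet> e) * taylor_rest N (dderiv (0, e) b) ?p))"
      by (simp only: norm_sum)
    also have "\<dots> \<le> (\<Sum>e\<in>(Basis :: 'b set). norm \<zeta> * (?d ^ N * B))"
    proof (rule sum_mono)
      fix e :: 'b assume e: "e \<in> Basis"
      have "\<bar>\<zeta> \<bullet> e\<bar> * norm (taylor_rest N (dderiv (0, e) b) (z, s *\<^sub>R \<zeta>)) \<le> norm \<zeta> * (?d ^ N * B)"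
        by (intro mult_mono Basis_le_norm e B s) auto
      then show "norm (of_real (\<zeta> \<bullet> e) * taylor_rest N (dderiv (0, e) b) ?p) \<le> norm \<zeta> * (?d ^ N * B)"
        by (simp add: norm_mult)
    qed
    also have "\<dots> = ?d ^ Suc N * B" by simp
    finally show "norm (dderiv (0, \<zeta>) (taylor_rest (Suc N) b) ?p) \<le> ?d ^ Suc N * B" .
  qed
  then show ?case by (simp add: taylor_rest_Suc_zero)
qed

lemma symb_foldr_snd:
  "symb s a \<Longrightarrow> set fs \<subseteq> Basis \<Longrightarrow> symb (s - real (length fs)) (foldr (\<lambda>e. dderiv (0, e)) fs a)"
proof (induction fs)
  case (Cons e fs)
  then have "symb (s - real (length fs) - xi_deg (0, e)) (dderiv (0, e) (foldr (\<lambda>e. dderiv (0, e)) fs a))"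
    by (intro symb_dderiv Cons.IH) (auto simp: Basis_prod_def)
  then show ?case by (simp add: algebra_simps)
qed simp

lemma foldr_snd_translate:
  "smooth a \<Longrightarrow> foldr (\<lambda>e. dderiv (0, e)) fs (\<lambda>p. a (q + p)) = (\<lambda>p. foldr (\<lambda>e. dderiv (0, e)) fs a (q + p))
    \<and> smooth (foldr (\<lambda>e. dderiv (0, e)) fs a)"
  by (induction fs) (simp_all add: dderiv_translate smooth_differentiable smooth_dderiv)

text \<open>All covariable derivatives of order \<open>N\<close> have symbol order
  \<open>s - real N\<close>, and there are only finitely many lists of directions, so
  \<open>vanishing_translate\<close> holds for all of them outside one ball. The Taylor factor of
  degree \<open>N\<close> adds \<open>N\<close> to the weight in \<open>p\<close>.\<close>

lemma taylor_rest_small: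
  fixes a :: "'b::euclidean_space \<times> 'b \<Rightarrow> complex"
  assumes a: "symb s a" and e: "0 < e"
  shows "\<forall>\<^sub>F q in at_infinity. \<forall>p. norm (taylor_rest N (\<lambda>p. a (q + p)) p)
    \<le> e * (1 + norm (snd q)) powr (s - real N) * (1 + norm p) powr (real N + \<bar>s - real N\<bar> + 1)"
proof -
  let ?D = "\<lambda>fs. foldr (\<lambda>e. dderiv (0, e)) fs a"
  let ?L = "{fs :: 'b list. set fs \<subseteq> Basis \<and> length fs = N}"
  \<comment> \<open>Absorbs the dimension factor of the Taylor bound; the derivatives are made
    smaller than \<open>e / d\<close> so that \<open>e\<close> results.\<close>
  define d where "d = (1 + real DIM('b)) ^ N"
  have d: "0 < d" by (simp add: d_def)
  have "\<forall>\<^sub>F q in at_infinity. \<forall>fs\<in>?L. \<forall>p. norm (?D fs (q + p))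
      \<le> (e / d) * (1 + norm (snd q)) powr (s - real N) * (1 + norm p) powr (\<bar>s - real N\<bar> + 1)"
  proof (rule eventually_ball_finite)
    show "finite ?L" by (rule finite_lists_length_eq) simp
    show "\<forall>fs\<in>?L. \<forall>\<^sub>F q in at_infinity. \<forall>p. norm (?D fs (q + p))
      \<le> (e / d) * (1 + norm (snd q)) powr (s - real N) * (1 + norm p) powr (\<bar>s - real N\<bar> + 1)"
    proof
      fix fs :: "'b list" assume fs: "fs \<in> ?L"
      then have "symb (s - real N) (?D fs)" using symb_foldr_snd[OF a] by auto
      then show "\<forall>\<^sub>F q in at_infinity. \<forall>p. norm (?D fs (q + p))
        \<le> (e / d) * (1 + norm (snd q)) powr (s - real N) * (1 + norm p) powr (\<bar>s - real N\<bar> + 1)"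
        by (intro vanishing_translate symb_vanishing smooth_cont symb_smooth) (use e d in simp_all)
    qed
  qed
  then show ?thesis
  proof eventually_elim
    case (elim q)
    show ?case
    proof
      fix p :: "'b \<times> 'b"
      obtain z \<zeta> where p: "p = (z, \<zeta>)" by (cases p)
      let ?B = "(e / d) * (1 + norm (snd q)) powr (s - real N) * (1 + norm p) powr (\<bar>s - real N\<bar> + 1)"
      have tm: "tame \<bar>s\<bar> (\<lambda>p. a (q + p))" by (rule tame_translate[OF symb_tame[OF a]])
      have "norm (taylor_rest N (\<lambda>p. a (q + p)) (z, \<zeta>)) \<le> (real DIM('b) * norm \<zeta>) ^ N * ?B"
      proof (rule taylor_rest_bound[OF abs_ge_zero tm])
        fix fs :: "'b list" and \<theta> :: real
        assume fs: "length fs = N" "set fs \<subseteq> Basis" and \<theta>: "\<theta> \<in> {0..1}"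
        have "norm (?D fs (q + (z, \<theta> *\<^sub>R \<zeta>)))
            \<le> (e / d) * (1 + norm (snd q)) powr (s - real N) * (1 + norm (z, \<theta> *\<^sub>R \<zeta>)) powr (\<bar>s - real N\<bar> + 1)"
          using elim fs by blast
        also have "\<dots> \<le> ?B"
        proof (intro mult_left_mono powr_mono2)
          have "norm (\<theta> *\<^sub>R \<zeta>) \<le> norm \<zeta>" using \<theta> by (simp add: mult_left_le_one_le)
          then show "1 + norm (z, \<theta> *\<^sub>R \<zeta>) \<le> 1 + norm p"
            unfolding p norm_Pair by (intro add_left_mono real_sqrt_le_mono power_mono) simp_all
        qed (use e d in simp_all)
        finally show "norm (foldr (\<lambda>e. dderiv (0, e)) fs (\<lambda>p. a (q + p)) (z, \<theta> *\<^sub>R \<zeta>)) \<le> ?B"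
          using foldr_snd_translate[OF symb_smooth[OF a]] by simp
      qed
      also have "\<dots> \<le> (d * (1 + norm p) ^ N) * ?B"
      proof (rule mult_right_mono)
        have "real DIM('b) * norm \<zeta> \<le> (1 + real DIM('b)) * (1 + norm p)"
          using norm_snd_le[of \<zeta> z] unfolding p by (intro mult_mono) simp_all
        then have "(real DIM('b) * norm \<zeta>) ^ N \<le> ((1 + real DIM('b)) * (1 + norm p)) ^ N"
          by (rule power_mono) simp
        then show "(real DIM('b) * norm \<zeta>) ^ N \<le> d * (1 + norm p) ^ N"
          by (simp add: d_def power_mult_distrib)
      qed (use e d in simp)
      also have "\<dots> = e * (1 + norm (snd q)) powr (s - real N) * ((1 + norm p) ^ N * (1 + norm p) powr (\<bar>s - real N\<bar> + 1))"
        using d by simp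
      also have "(1 + norm p) ^ N * (1 + norm p) powr (\<bar>s - real N\<bar> + 1) = (1 + norm p) powr (real N + \<bar>s - real N\<bar> + 1)"
      proof -
        have "(1 + norm p) ^ N = (1 + norm p) powr real N" by (simp add: powr_realpow add_pos_nonneg)
        then show ?thesis by (simp add: add.assoc powr_add)
      qed
      finally show "norm (taylor_rest N (\<lambda>p. a (q + p)) p)
        \<le> e * (1 + norm (snd q)) powr (s - real N) * (1 + norm p) powr (real N + \<bar>s - real N\<bar> + 1)"
        by (simp only: p)
    qed
  qed
qed

text \<open>A space derivative keeps \<open>s\<close> and \<open>N\<close>; a covariable derivative
  lowers both by one, so \<open>s - real N\<close> is preserved and the weight in \<open>p\<close>
  only decreases. Hence the induction must generalise over \<open>s\<close>, \<open>a\<close> and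
  \<open>N\<close>. At \<open>N = 0\<close> no lowering is possible, and the derivative is used
  merely as a symbol of order \<open>s\<close>.\<close>

lemma taylor_rest_growth:
  fixes a :: "'b::euclidean_space \<times> 'b \<Rightarrow> complex"
  assumes e: "0 < e"
  shows "symb s a \<Longrightarrow> \<forall>\<^sub>F q in at_infinity. growth n (real N + \<bar>s - real N\<bar> + 1)
    (e * (1 + norm (snd q)) powr (s - real N)) (taylor_rest N (\<lambda>p. a (q + p)))"
proof (induction n arbitrary: s a N)
  have tm: "tame \<bar>s\<bar> (\<lambda>p. a (q + p))" if "symb s a" for s q and a :: "'b \<times> 'b \<Rightarrow> complex"
    by (rule tame_translate[OF symb_tame[OF that]])
  {
    case 0
    show ?case
      using taylor_rest_small[OF 0 e, of N]
    proof eventually_elim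
      case (elim q)
      then show ?case
        using smooth_cont[OF tame_smooth[OF tame_taylor_rest[OF abs_ge_zero tm[OF 0]]]] by simp
    qed
  next
    case (Suc n)
    have diff: "a differentiable at p" for p by (rule smooth_differentiable[OF symb_smooth[OF Suc.prems]])
    have "\<forall>\<^sub>F q in at_infinity. \<forall>v\<in>Basis. growth n (real N + \<bar>s - real N\<bar> + 1)
      (e * (1 + norm (snd q)) powr (s - real N)) (dderiv v (taylor_rest N (\<lambda>p. a (q + p))))"
    proof (rule eventually_ball_finite[OF finite_Basis], rule ballI)
      fix v :: "'b \<times> 'b" assume v: "v \<in> Basis"
      then consider w where "v = (w, 0)" "w \<in> Basis" | w where "v = (0, w)" "w \<in> Basis"
        by (auto simp: Basis_prod_def)
      then show "\<forall>\<^sub>F q in at_infinity. growth n (real N + \<bar>s - real N\<bar> + 1)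
        (e * (1 + norm (snd q)) powr (s - real N)) (dderiv v (taylor_rest N (\<lambda>p. a (q + p))))"
      proof cases
        case 1
        show ?thesis
          using Suc.IH[OF symb_dderiv_same[OF Suc.prems v], of N]
          by eventually_elim
            (simp add: 1 dderiv_fst_taylor_rest[OF abs_ge_zero tm[OF Suc.prems]] dderiv_translate[OF diff])
      next
        case 2
        have D: "dderiv v (taylor_rest N (\<lambda>p. a (q + p))) = taylor_rest (N - 1) (\<lambda>p. dderiv v a (q + p))" for q
          using dderiv_snd_taylor_rest[OF abs_ge_zero tm[OF Suc.prems] 2(2)] 2(1)
          by (simp add: dderiv_translate[OF diff])
        show ?thesis
        proof (cases N)
          case 0
          then show ?thesis unfolding D using Suc.IH[OF symb_dderiv_same[OF Suc.prems v], of 0] by simp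
        next
          case (Suc N')
          have "symb (s - 1) (dderiv v a)" using symb_dderiv[OF Suc.prems v] 2(1) by simp
          from Suc.IH[OF this, of N'] show ?thesis
            unfolding D
          proof eventually_elim
            case (elim q)
            have "s - 1 - real N' = s - real N" by (simp add: Suc)
            with growth_mono[OF elim, of "real N + \<bar>s - real N\<bar> + 1" "e * (1 + norm (snd q)) powr (s - real N)"]
            show ?case by (simp add: Suc)
          qed
        qed
      qed
    qed
    moreover have "\<forall>\<^sub>F q in at_infinity. \<forall>p. norm (taylor_rest N (\<lambda>p. a (q + p)) p)
       \<le> e * (1 + norm (snd q)) powr (s - real N) * (1 + norm p) powr (real N + \<bar>s - real N\<bar> + 1)"
      by (rule taylor_rest_small[OF Suc.prems e])
    ultimately show ?case
    proof eventually_elim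
      case (elim q)
      then show ?case
        using smooth_differentiable[OF tame_smooth[OF tame_taylor_rest[OF abs_ge_zero tm[OF Suc.prems]]]] by simp
    qed
  }
qed

section \<open>The transposed symbol: derivatives and asymptotic expansion\<close>

definition transp_symbol :: "('b::euclidean_space \<times> 'b \<Rightarrow> complex) \<Rightarrow> 'b \<times> 'b \<Rightarrow> complex" where
  "transp_symbol a q = Lam (\<lambda>p. a (q + p))"

text \<open>Moving \<open>q\<close> translates the amplitude, so the difference quotient can be
  taken under \<open>Lam\<close>: \<open>growth_taylor\<close> makes the remainder quadratic in
  \<open>h\<close> in the norm that controls \<open>Lam\<close>.\<close>

lemma has_derivative_transp_symbol:
  fixes a :: "'b::euclidean_space \<times> 'b \<Rightarrow> complex"
  assumes a: "tame M a"
  shows "(transp_symbol a has_derivative (\<lambda>h. transp_symbol (dderiv h a) q)) (at q)"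
proof -
  obtain k c where c: "0 \<le> c"
    "\<And>M' C b. tame M' b \<Longrightarrow> growth k M C (b :: 'b \<times> 'b \<Rightarrow> complex) \<Longrightarrow> norm (Lam b) \<le> c * C"
    by (rule Lam_bound[where M = M]) (rule that)
  define f where "f = (\<lambda>p. a (q + p))"
  have f: "tame M f" unfolding f_def by (rule tame_translate[OF a])
  have D: "dderiv h f = (\<lambda>p. dderiv h a (q + p))" for h
    unfolding f_def by (rule dderiv_translate[OF smooth_differentiable[OF tame_smooth[OF a]]])
  obtain C where C: "growth (Suc (Suc k)) M C f" using f unfolding tame_def by blast
  define K where "K = c * ((DIM('b \<times> 'b))\<^sup>2 * 2 powr \<bar>M\<bar> * C)"
  have le: "norm (transp_symbol a (q + h) - transp_symbol a q - transp_symbol (dderiv h a) q) \<le> K * (norm h)\<^sup>2"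
    if h: "norm h \<le> 1" for h
  proof -
    have t: "tame M (\<lambda>p. f (h + p))" "tame M (dderiv h f)" "tame M (\<lambda>p. f (h + p) - f p)"
      by (intro tame_translate tame_dderiv tame_diff f)+
    have "norm (Lam (\<lambda>p. f (h + p) - f p - dderiv h f p)) \<le> c * ((DIM('b \<times> 'b))\<^sup>2 * 2 powr \<bar>M\<bar> * C * (norm h)\<^sup>2)"
      by (rule c(2)[OF tame_diff[OF t(3,2)] growth_taylor[OF h tame_smooth[OF f] C]])
    also have "Lam (\<lambda>p. f (h + p) - f p - dderiv h f p) = Lam (\<lambda>p. f (h + p)) - Lam f - Lam (dderiv h f)"
      by (simp add: Lam_diff[OF t(3,2)] Lam_diff[OF t(1) f])
    also have "\<dots> = transp_symbol a (q + h) - transp_symbol a q - transp_symbol (dderiv h a) q"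
      unfolding D by (simp add: transp_symbol_def f_def add.assoc)
    finally show ?thesis by (simp add: K_def mult.assoc)
  qed
  show ?thesis unfolding has_derivative_at
  proof
    \<comment> \<open>Linearity of \<open>Lam\<close> makes the candidate derivative a finite
      combination of the coordinates of \<open>h\<close>, and thus a bounded linear map.\<close>
    have eq: "transp_symbol (dderiv h a) q = (\<Sum>b\<in>Basis. of_real (h \<bullet> b) * transp_symbol (dderiv b a) q)" for h
    proof -
      have "dderiv h f = (\<lambda>p. \<Sum>b\<in>Basis. of_real (h \<bullet> b) * dderiv b f p)"
        by (intro ext dderiv_Basis smooth_differentiable tame_smooth[OF f])
      then have "Lam (dderiv h f) = (\<Sum>b\<in>Basis. of_real (h \<bullet> b) * Lam (dderiv b f))"
        by (simp only: Lam_sum[OF finite_Basis tame_cmult[OF tame_dderiv[OF f]]] Lam_cmult[OF tame_dderiv[OF f]])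
      then show ?thesis unfolding D by (simp add: transp_symbol_def)
    qed
    have "bounded_linear (\<lambda>h. \<Sum>b\<in>Basis. of_real (h \<bullet> b) * transp_symbol (dderiv b a) q)"
      by (intro bounded_linear_sum bounded_linear_compose[OF bounded_linear_mult_left]
          bounded_linear_compose[OF bounded_linear_of_real] bounded_linear_inner_left)
    then show "bounded_linear (\<lambda>h. transp_symbol (dderiv h a) q)" by (subst eq)
    show "(\<lambda>h. norm (transp_symbol a (q + h) - transp_symbol a q - transp_symbol (dderiv h a) q) / norm h) \<midarrow>0\<rightarrow> 0"
    proof (rule Lim_null_comparison)
      show "(\<lambda>h :: 'b \<times> 'b. K * norm h) \<midarrow>0\<rightarrow> 0"
        by (rule tendsto_mult_right_zero[OF tendsto_norm_zero[OF tendsto_ident_at]])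
      show "\<forall>\<^sub>F h in at 0. norm (norm (transp_symbol a (q + h) - transp_symbol a q - transp_symbol (dderiv h a) q) / norm h) \<le> K * norm h"
        unfolding eventually_at
      proof (rule exI[of _ 1], intro conjI ballI impI)
        fix h :: "'b \<times> 'b" assume "h \<noteq> 0 \<and> dist h 0 < 1"
        then have h: "0 < norm h" "norm h \<le> 1" by simp_all
        show "norm (norm (transp_symbol a (q + h) - transp_symbol a q - transp_symbol (dderiv h a) q) / norm h) \<le> K * norm h"
          using le[OF h(2)] h(1) by (simp add: pos_divide_le_eq power2_eq_square mult.assoc)
      qed simp
    qed
  qed
qed

lemma dderiv_transp_symbol: "tame M a \<Longrightarrow> dderiv v (transp_symbol a) = transp_symbol (dderiv v a)"
  by (intro ext dderiv_eqI has_derivative_transp_symbol)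

lemma smooth_transp_symbol: "tame M a \<Longrightarrow> smooth (transp_symbol a)"
proof -
  have "times_diff n (transp_symbol a)" if "tame M a" for n
    using that
  proof (induction n arbitrary: a)
    case 0
    then show ?case
      using differentiableI[OF has_derivative_transp_symbol]
      by (auto intro!: continuous_at_imp_continuous_on differentiable_imp_continuous_within)
  next
    case (Suc n)
    then show ?case
      using differentiableI[OF has_derivative_transp_symbol[OF Suc.prems]]
      by (simp add: dderiv_transp_symbol[OF Suc.prems] tame_dderiv)
  qed
  then show "tame M a \<Longrightarrow> smooth (transp_symbol a)" by (simp add: smooth_def)
qed

text \<open>The error \<open>E a\<close> is \<open>Lam\<close> of the Taylor rest and satisfies
  \<open>dderiv v (E a) = E (dderiv v a)\<close>. The undifferentiated estimate, proved for symbols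
  of every order, therefore applies to all derivatives. At \<open>N = 0\<close> it says that
  transposition preserves the class.\<close>

theorem transp_symbol_expansion:
  fixes a :: "'b::euclidean_space \<times> 'b \<Rightarrow> complex"
  assumes a: "symb s a"
  shows "symb (s - real N) (\<lambda>q. transp_symbol a q - (\<Sum>k<N. expansion_term k a q))"
proof -
  define E where "E a q = transp_symbol a q - (\<Sum>k<N. expansion_term k a q)" for a :: "'b \<times> 'b \<Rightarrow> complex" and q
  have E: "E a q = Lam (taylor_rest N (\<lambda>p. a (q + p)))" if "symb s a" for a q s
  proof -
    have t: "tame \<bar>s\<bar> (\<lambda>p. a (q + p))" by (rule tame_translate[OF symb_tame[OF that]])
    have tt: "tame (\<bar>s\<bar> + real N) (taylor_term k (\<lambda>p. a (q + p)))" if "k \<in> {..<N}" for k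
      using that by (intro tame_mono[OF tame_taylor_term[OF abs_ge_zero t]]) simp
    have "Lam (taylor_rest N (\<lambda>p. a (q + p))) =
        Lam (\<lambda>p. a (q + p)) - (\<Sum>k<N. Lam (taylor_term k (\<lambda>p. a (q + p))))"
      unfolding taylor_rest_def
      using Lam_diff[OF tame_mono[OF t] tame_sum[OF finite_lessThan tt]] Lam_sum[OF finite_lessThan tt] by simp
    also have "(\<Sum>k<N. Lam (taylor_term k (\<lambda>p. a (q + p)))) = (\<Sum>k<N. expansion_term k a q)"
      by (simp add: Lam_taylor_term[OF abs_ge_zero t] expansion_term_translate[OF symb_smooth[OF that]])
    finally show ?thesis by (simp add: E_def transp_symbol_def)
  qed
  have van: "vanishing (s - real N) (E a)" if a: "symb s a" for a s
    unfolding vanishing_eps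
  proof (intro allI impI)
    fix e :: real assume e: "0 < e"
    let ?M = "real N + \<bar>s - real N\<bar> + 1"
    obtain k c where c: "0 \<le> c"
      "\<And>M' C b. tame M' b \<Longrightarrow> growth k ?M C (b :: 'b \<times> 'b \<Rightarrow> complex) \<Longrightarrow> norm (Lam b) \<le> c * C"
      by (rule Lam_bound[where M = ?M]) (rule that)
    \<comment> \<open>The summand 1 allows for \<open>c = 0\<close>; the bound on \<open>Lam\<close>
      then returns at most \<open>e\<close>.\<close>
    have "0 < e / (c + 1)" using e c(1) by simp
    from taylor_rest_growth[OF this a, of k N]
    show "\<forall>\<^sub>F q in at_infinity. norm (E a q) \<le> e * (1 + norm (snd q)) powr (s - real N)"
    proof eventually_elim
      case (elim q)
      have "norm (E a q) \<le> c * (e / (c + 1) * (1 + norm (snd q)) powr (s - real N))"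
        unfolding E[OF a]
        by (rule c(2)[OF tame_taylor_rest[OF abs_ge_zero tame_translate[OF symb_tame[OF a]]] elim])
      also have "\<dots> = (c / (c + 1)) * (e * (1 + norm (snd q)) powr (s - real N))" by simp
      also have "\<dots> \<le> 1 * (e * (1 + norm (snd q)) powr (s - real N))"
        using c(1) e by (intro mult_right_mono) (simp_all add: divide_le_eq_1)
      finally show ?case by simp
    qed
  qed
  have smE: "smooth (E a)" if a: "symb s a" for a s
  proof -
    have "smooth (\<lambda>q. \<Sum>k<N. expansion_term k a q)"
      by (intro smooth_sum smooth_expansion_term symb_smooth[OF a])
    then have "smooth (\<lambda>q. (- 1) * (\<Sum>k<N. expansion_term k a q))" by (rule smooth_cmult)
    then have "smooth (\<lambda>q. transp_symbol a q + (- 1) * (\<Sum>k<N. expansion_term k a q))"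
      using smooth_transp_symbol[OF symb_tame[OF a]] by (simp only: smooth_def times_diff_add simp_thms)
    then show ?thesis by (simp add: E_def[abs_def])
  qed
  have DE: "dderiv v (E a) = E (dderiv v a)" if a: "symb s a" for a s v
  proof
    fix q
    have "(E a has_derivative (\<lambda>v. transp_symbol (dderiv v a) q - (\<Sum>k<N. dderiv v (expansion_term k a) q))) (at q)"
      unfolding E_def[abs_def]
      by (intro has_derivative_diff has_derivative_transp_symbol[OF symb_tame[OF a]] has_derivative_sum
          has_derivative_dderiv smooth_differentiable smooth_expansion_term symb_smooth[OF a])
    from dderiv_eqI[OF this] show "dderiv v (E a) q = E (dderiv v a) q"
      by (simp add: E_def dderiv_expansion_term[OF symb_smooth[OF a]])
  qed
  have "symb (s - (\<Sum>v\<leftarrow>vs. xi_deg v)) (foldr dderiv vs a) \<and> foldr dderiv vs (E a) = E (foldr dderiv vs a)"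
    if "set vs \<subseteq> Basis" for vs
    using that
  proof (induction vs)
    case (Cons v vs)
    then have IH: "symb (s - (\<Sum>v\<leftarrow>vs. xi_deg v)) (foldr dderiv vs a)" "foldr dderiv vs (E a) = E (foldr dderiv vs a)"
      by auto
    have "symb (s - (\<Sum>v\<leftarrow>vs. xi_deg v) - xi_deg v) (dderiv v (foldr dderiv vs a))"
      using Cons.prems by (intro symb_dderiv IH) simp
    then show ?case using DE[OF IH(1)] IH(2) by (simp add: algebra_simps)
  qed (simp add: a)
  then have "vanishing (s - real N - (\<Sum>v\<leftarrow>vs. xi_deg v)) (foldr dderiv vs (E a))" if "set vs \<subseteq> Basis" for vs
    using van[of "s - (\<Sum>v\<leftarrow>vs. xi_deg v)" "foldr dderiv vs a"] that by (simp add: algebra_simps)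
  then have "symb (s - real N) (E a)" using smE[OF a] by (simp add: symb_def)
  then show ?thesis by (simp add: E_def[abs_def])
qed

section \<open>The transpose relation\<close>

text \<open>Decay and measurability without derivatives: what domination of integrals asks for, and
  what \<open>ft_decay\<close> provides for a Fourier transform.\<close>

definition decays :: "('a::euclidean_space \<Rightarrow> complex) \<Rightarrow> bool" where
  "decays f \<longleftrightarrow> f \<in> borel_measurable borel \<and> (\<forall>M. \<exists>C. \<forall>x. norm (f x) \<le> C * (1 + norm x) powr M)"

lemma rapid_decays: "rapid f \<Longrightarrow> decays f"
  unfolding decays_def rapid_def tame_def
  by (meson growth_le rapid_borel rapid_def tame_def)

lemma ft_decays: "rapid f \<Longrightarrow> decays (ft f)"
  unfolding decays_def by (simp add: ft_decay ft_measurable rapid_borel)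

lemma decays_pair:
  fixes f :: "'a::euclidean_space \<Rightarrow> complex" and h :: "'b::euclidean_space \<Rightarrow> complex"
  assumes "decays f" "decays h"
  shows "decays (\<lambda>p. f (fst p) * h (snd p))"
proof -
  have [measurable]: "f \<in> borel_measurable borel" "h \<in> borel_measurable borel"
    using assms by (simp_all add: decays_def)
  have meas: "(\<lambda>p. f (fst p) * h (snd p)) \<in> borel_measurable borel"
    unfolding borel_prod[symmetric] by measurable
  have "\<exists>C. \<forall>p. norm (f (fst p) * h (snd p)) \<le> C * (1 + norm p) powr M" for M
  proof -
    \<comment> \<open>A nonpositive exponent makes the power antitone, so the product of the two
      weights can be compared with the weight of the pair.\<close>
    define L where "L = min M 0"
    obtain C where C: "\<And>x. norm (f x) \<le> C * (1 + norm x) powr L" using assms(1) unfolding decays_def by blast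
    obtain D where D: "\<And>x. norm (h x) \<le> D * (1 + norm x) powr L" using assms(2) unfolding decays_def by blast
    have CD: "0 \<le> C" "0 \<le> D"
      using order_trans[OF norm_ge_zero C[of 0]] order_trans[OF norm_ge_zero D[of 0]] by simp_all
    have "norm (f (fst p) * h (snd p)) \<le> (C * D) * (1 + norm p) powr M" for p
    proof -
      have "1 + norm p \<le> (1 + norm (fst p)) * (1 + norm (snd p))"
        using norm_Pair_le[of "fst p" "snd p"] by (simp add: distrib_left distrib_right)
          (smt (verit) mult_nonneg_nonneg norm_ge_zero)
      then have "((1 + norm (fst p)) * (1 + norm (snd p))) powr L \<le> (1 + norm p) powr L"
        by (intro powr_mono2') (simp_all add: L_def add_pos_nonneg)
      also have "\<dots> \<le> (1 + norm p) powr M" by (intro powr_mono) (simp_all add: L_def)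
      finally have *: "(1 + norm (fst p)) powr L * (1 + norm (snd p)) powr L \<le> (1 + norm p) powr M"
        by (simp add: powr_mult)
      have "norm (f (fst p) * h (snd p)) \<le> (C * (1 + norm (fst p)) powr L) * (D * (1 + norm (snd p)) powr L)"
        unfolding norm_mult using CD by (intro mult_mono C D) simp_all
      also have "\<dots> = (C * D) * ((1 + norm (fst p)) powr L * (1 + norm (snd p)) powr L)" by simp
      also have "\<dots> \<le> (C * D) * (1 + norm p) powr M" using CD by (intro mult_left_mono *) simp_all
      finally show ?thesis .
    qed
    then show ?thesis by blast
  qed
  with meas show ?thesis by (simp add: decays_def)
qed

text \<open>The constant \<open>D\<close> does not depend on \<open>v\<close>, so one integrable
  majorant serves a whole sequence.\<close>

lemma decays_bound:
  fixes G :: "'a::euclidean_space \<Rightarrow> complex"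
  assumes "decays G" "\<And>p. norm (u p) \<le> C * (1 + norm p) powr M"
  obtains D where "\<And>v p. norm (v p) \<le> C * (1 + norm p) powr M \<Longrightarrow>
    norm (v p * G p) \<le> D * (1 + norm p) powr (- 2 * real DIM('a))"
proof -
  have C: "0 \<le> C" using order_trans[OF norm_ge_zero assms(2)[of 0]] by simp
  obtain E where E: "\<And>p. norm (G p) \<le> E * (1 + norm p) powr (- 2 * real DIM('a) - M)"
    using assms(1) unfolding decays_def by blast
  have "norm (v p * G p) \<le> (C * E) * (1 + norm p) powr (- 2 * real DIM('a))"
    if "norm (v p) \<le> C * (1 + norm p) powr M" for v :: "'a \<Rightarrow> complex" and p
  proof -
    have "norm (v p * G p) \<le> (C * (1 + norm p) powr M) * (E * (1 + norm p) powr (- 2 * real DIM('a) - M))"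
      unfolding norm_mult using C by (intro mult_mono that E) simp_all
    also have "\<dots> = (C * E) * ((1 + norm p) powr M * (1 + norm p) powr (- 2 * real DIM('a) - M))" by simp
    finally show ?thesis by (simp flip: powr_add)
  qed
  then show thesis by (rule that)
qed

lemma decays_integrable:
  fixes G :: "'a::euclidean_space \<Rightarrow> complex"
  assumes "decays G" and u: "\<And>p. norm (u p) \<le> C * (1 + norm p) powr M" "continuous_on UNIV u"
  shows "integrable lborel (\<lambda>p. u p * G p)"
proof -
  obtain D where D: "\<And>v p. norm (v p) \<le> C * (1 + norm p) powr M \<Longrightarrow>
    norm (v p * G p) \<le> D * (1 + norm p) powr (- 2 * real DIM('a))"
    by (rule decays_bound[OF assms(1) u(1)]) (rule that)
  have [measurable]: "u \<in> borel_measurable borel" "G \<in> borel_measurable borel"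
    using u(2) assms(1) by (simp_all add: borel_measurable_continuous_onI decays_def)
  show ?thesis
    by (rule Bochner_Integration.integrable_bound[OF integrable_mult_right[OF integrable_weight, of D]])
      (use order_trans[OF D[of u, OF u(1)] abs_ge_self] in auto)
qed

lemma decays_tendsto:
  fixes G :: "'a::euclidean_space \<Rightarrow> complex"
  assumes G: "decays G" and u: "\<And>n p. norm (u n p) \<le> C * (1 + norm p) powr M" "\<And>n. continuous_on UNIV (u n)"
    and lim: "\<And>p. (\<lambda>n. u n p) \<longlonglongrightarrow> v p" and v: "continuous_on UNIV v"
  shows "(\<lambda>n. LINT p|lborel. u n p * G p) \<longlonglongrightarrow> (LINT p|lborel. v p * G p)"
proof -
  obtain D where D: "\<And>v p. norm (v p) \<le> C * (1 + norm p) powr M \<Longrightarrow>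
    norm (v p * G p) \<le> D * (1 + norm p) powr (- 2 * real DIM('a))"
    by (rule decays_bound[OF G u(1)]) (rule that)
  have [measurable]: "\<And>n. u n \<in> borel_measurable borel" "v \<in> borel_measurable borel" "G \<in> borel_measurable borel"
    using u(2) v G by (simp_all add: borel_measurable_continuous_onI decays_def)
  show ?thesis
  proof (rule integral_dominated_convergence)
    show "integrable lborel (\<lambda>p :: 'a. D * (1 + norm p) powr (- 2 * real DIM('a)))"
      by (intro integrable_mult_right integrable_weight)
    show "AE p in lborel. (\<lambda>n. u n p * G p) \<longlonglongrightarrow> v p * G p"
      by (intro AE_I2 tendsto_mult lim tendsto_const)
    show "AE p in lborel. norm (u n p * G p) \<le> D * (1 + norm p) powr (- 2 * real DIM('a))" for n
      by (intro AE_I2 D u(1))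
  qed measurable
qed

lemma integral_reflect:
  fixes f :: "'a::euclidean_space \<Rightarrow> complex"
  assumes [measurable]: "f \<in> borel_measurable borel"
  shows "(LINT x|lborel. f (- x)) = (LINT x|lborel. f x)"
proof -
  have "distr lborel borel (\<lambda>x :: 'a. - x) = lborel"
    using lborel_affine[of "-1" "0 :: 'a"] by (simp add: density_1)
  then have "(LINT x|lborel. f x) = (LINT x|distr lborel borel (\<lambda>x :: 'a. - x). f x)" by simp
  also have "\<dots> = (LINT x|lborel. f (- x))" by (rule integral_distr) measurable
  finally show ?thesis ..
qed

text \<open>The pairing of \<open>pseudo_op \<sigma> f\<close> with \<open>g\<close> as one
  absolutely convergent integral over phase space, a form in which the order of integration is free
  and limits in the symbol can be taken.\<close>

definition op_form :: "('b::euclidean_space \<times> 'b \<Rightarrow> complex) \<Rightarrow> ('b \<Rightarrow> complex) \<Rightarrow> ('b \<Rightarrow> complex) \<Rightarrow> complex" where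
  "op_form \<sigma> f g = (LINT p|lborel. (\<sigma> p * exp (\<i> * of_real (fst p \<bullet> snd p))) * (g (fst p) * ft f (snd p)))"

lemma continuous_plane_wave:
  "continuous_on UNIV (\<lambda>p :: 'b::euclidean_space \<times> 'b. exp (\<i> * complex_of_real (fst p \<bullet> snd p)))"
  by (intro continuous_intros)

lemma op_form_weight: "rapid f \<Longrightarrow> rapid g \<Longrightarrow> decays (\<lambda>p. g (fst p) * ft f (snd p))"
  by (intro decays_pair rapid_decays ft_decays)

lemma op_form_tendsto:
  fixes v :: "'b::euclidean_space \<times> 'b \<Rightarrow> complex"
  assumes f: "rapid f" and g: "rapid g"
    and u: "\<And>n p. norm (u n p) \<le> C * (1 + norm p) powr M" "\<And>n. continuous_on UNIV (u n)"
    and lim: "\<And>p. (\<lambda>n. u n p) \<longlonglongrightarrow> v p" and v: "continuous_on UNIV v"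
  shows "(\<lambda>n. op_form (u n) f g) \<longlonglongrightarrow> op_form v f g"
  unfolding op_form_def
  by (rule decays_tendsto[OF op_form_weight[OF f g], where C = C and M = M])
    (intro continuous_on_mult continuous_plane_wave tendsto_mult tendsto_const u v lim | simp add: norm_mult u)+

lemma op_form_integrable:
  fixes \<sigma> :: "'b::euclidean_space \<times> 'b \<Rightarrow> complex"
  assumes f: "rapid f" and g: "rapid g"
    and u: "\<And>p. norm (\<sigma> p) \<le> C * (1 + norm p) powr M" "continuous_on UNIV \<sigma>"
  shows "integrable lborel (\<lambda>p. (\<sigma> p * exp (\<i> * of_real (fst p \<bullet> snd p))) * (g (fst p) * ft f (snd p)))"
  by (rule decays_integrable[OF op_form_weight[OF f g], where C = C and M = M])
    (intro continuous_on_mult continuous_plane_wave u | simp add: norm_mult u)+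

lemma op_form_iterated:
  fixes \<sigma> :: "'b::euclidean_space \<times> 'b \<Rightarrow> complex"
  assumes "rapid f" "rapid g" "\<And>p. norm (\<sigma> p) \<le> C * (1 + norm p) powr M" "continuous_on UNIV \<sigma>"
  shows "op_form \<sigma> f g = (LINT x|lborel. (LINT \<xi>|lborel. \<sigma> (x, \<xi>) * ft f \<xi> * exp (\<i> * of_real (x \<bullet> \<xi>))) * g x)"
proof -
  have "op_form \<sigma> f g = (LINT x|lborel. LINT \<xi>|lborel. (\<sigma> (x, \<xi>) * exp (\<i> * of_real (x \<bullet> \<xi>))) * (g x * ft f \<xi>))"
    unfolding op_form_def using lborel_integral_pair(1)[OF op_form_integrable[OF assms]] by simp
  also have "\<dots> = (LINT x|lborel. LINT \<xi>|lborel. (\<sigma> (x, \<xi>) * ft f \<xi> * exp (\<i> * of_real (x \<bullet> \<xi>))) * g x)"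
    by (simp only: ac_simps)
  also have "\<dots> = (LINT x|lborel. (LINT \<xi>|lborel. \<sigma> (x, \<xi>) * ft f \<xi> * exp (\<i> * of_real (x \<bullet> \<xi>))) * g x)"
    by (simp only: integral_mult_left_zero)
  finally show ?thesis .
qed

lemma osc_translate:
  fixes b :: "'b::euclidean_space \<times> 'b \<Rightarrow> complex"
  assumes b: "rapid b"
  shows "osc (\<lambda>p. b (q + p)) = (LINT p|lborel. osc_phase (p - q) * b p)"
proof -
  have "continuous_on UNIV (\<lambda>p. osc_phase (p - q) * b p)"
    by (intro continuous_on_mult rapid_cont[OF b] continuous_on_compose2[OF continuous_osc_phase] continuous_intros) simp
  from integral_translate[OF this, of q] show ?thesis by (simp add: osc_def)
qed

text \<open>The right side becomes a double integral over phase-space points \<open>p\<close> and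
  \<open>q\<close>. Integrating over \<open>q\<close> first gives the transform of \<open>f\<close>
  at \<open>- snd p\<close> and, by Fourier inversion, \<open>g\<close> at \<open>fst p\<close>. The
  constant from the inversion cancels the normalisation of \<open>Lam\<close>.\<close>

lemma op_form_transpose_rapid:
  fixes b :: "'b::euclidean_space \<times> 'b \<Rightarrow> complex"
  assumes b: "rapid b" and f: "rapid f" and g: "rapid g"
  shows "op_form (\<lambda>p. b (fst p, - snd p)) f g = op_form (transp_symbol b) g f"
proof -
  let ?c = "(gauss_mass TYPE('b))\<^sup>2"
  define G where "G q = f (fst q) * ft g (snd q)" for q :: "'b \<times> 'b"
  have G: "decays G" unfolding G_def[abs_def] by (rule op_form_weight[OF g f])
  have intG: "integrable lborel G"
    using decays_integrable[OF G, of "\<lambda>_. 1" 1 0] by (simp add: add_nonneg_eq_0_iff)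
  \<comment> \<open>In the exponent of \<open>osc_phase (p - q)\<close> the term quadratic in
    \<open>q\<close> cancels against the plane wave of the operator. What is left is linear in each
    component of \<open>q\<close>, so the \<open>q\<close>-integral consists of Fourier
    integrals.\<close>
  define U where "U r = (exp (- (\<i> * of_real (fst (fst r) \<bullet> snd (fst r)))) :: complex)
      * (exp (\<i> * of_real (fst (fst r) \<bullet> snd (snd r))) * exp (\<i> * of_real (fst (snd r) \<bullet> snd (fst r))))"
    for r :: "('b \<times> 'b) \<times> 'b \<times> 'b"
  have U: "osc_phase (p - q) * exp (\<i> * of_real (fst q \<bullet> snd q)) = U (p, q)" for p q :: "'b \<times> 'b"
    by (simp add: osc_phase_def U_def inner_diff_left inner_diff_right algebra_simps flip: exp_add)
  have cU: "continuous_on UNIV U" unfolding U_def[abs_def] by (intro continuous_intros)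
  have nU: "norm (U r) \<le> 1" for r by (simp add: U_def norm_mult)
  have inner: "(LINT q|lborel. U (p, q) * G q) = ?c * (exp (- (\<i> * of_real (fst p \<bullet> snd p))) * (g (fst p) * ft f (- snd p)))" for p
  proof -
    have int: "integrable lborel (\<lambda>q. U (p, q) * G q)"
      by (rule decays_integrable[OF G, where C = 1 and M = 0])
        (use nU in \<open>auto simp: add_nonneg_eq_0_iff intro!: continuous_on_compose2[OF cU] continuous_intros\<close>)
    have "(LINT q|lborel. U (p, q) * G q) = (LINT y|lborel. LINT \<eta>|lborel. U (p, y, \<eta>) * G (y, \<eta>))"
      by (rule lborel_integral_pair(1)[OF int])
    also have "\<dots> = (LINT y|lborel. LINT \<eta>|lborel. (exp (- (\<i> * of_real (fst p \<bullet> snd p))) * (f y * exp (- (\<i> * of_real (y \<bullet> - snd p)))))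
        * (ft g \<eta> * exp (\<i> * of_real (fst p \<bullet> \<eta>))))"
      by (simp add: U_def G_def ac_simps)
    also have "\<dots> = (LINT y|lborel. (exp (- (\<i> * of_real (fst p \<bullet> snd p))) * (f y * exp (- (\<i> * of_real (y \<bullet> - snd p))))) * (?c * g (fst p)))"
      by (simp only: integral_mult_right_zero fourier_inversion[OF g])
    also have "\<dots> = exp (- (\<i> * of_real (fst p \<bullet> snd p))) * ft f (- snd p) * (?c * g (fst p))"
      by (simp only: integral_mult_right_zero integral_mult_left_zero ft_def)
    finally show ?thesis by (simp only: ac_simps)
  qed
  have "?c * op_form (transp_symbol b) g f = (LINT q|lborel. LINT p|lborel. U (p, q) * (b p * G q))"
  proof -
    have t: "?c * transp_symbol b q = (LINT p|lborel. osc_phase (p - q) * b p)" for q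
      unfolding transp_symbol_def using Lam_rapid[OF rapid_translate[OF b]] osc_translate[OF b] by simp
    have "?c * op_form (transp_symbol b) g f
      = (LINT q|lborel. (?c * transp_symbol b q) * (exp (\<i> * of_real (fst q \<bullet> snd q)) * G q))"
      unfolding op_form_def G_def integral_mult_right_zero[symmetric] by (simp only: ac_simps)
    also have "\<dots> = (LINT q|lborel. LINT p|lborel. (osc_phase (p - q) * b p) * (exp (\<i> * of_real (fst q \<bullet> snd q)) * G q))"
      unfolding t by (simp only: integral_mult_left_zero)
    also have "\<dots> = (LINT q|lborel. LINT p|lborel. U (p, q) * (b p * G q))"
      unfolding U[symmetric] by (simp only: ac_simps)
    finally show ?thesis .
  qed
  also have "\<dots> = (LINT p|lborel. LINT q|lborel. U (p, q) * (b p * G q))"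
    by (rule lborel_pair.Fubini_integral) (rule integrable_pair_mult[OF rapid_integrable[OF b] intG cU nU])
  also have "\<dots> = (LINT p|lborel. b p * (LINT q|lborel. U (p, q) * G q))"
    unfolding integral_mult_right_zero[symmetric] by (simp only: ac_simps)
  also have "\<dots> = ?c * (LINT p|lborel. b p * (exp (- (\<i> * of_real (fst p \<bullet> snd p))) * (g (fst p) * ft f (- snd p))))"
    unfolding inner integral_mult_right_zero[symmetric] by (simp only: ac_simps)
  also have "(LINT p|lborel. b p * (exp (- (\<i> * of_real (fst p \<bullet> snd p))) * (g (fst p) * ft f (- snd p))))
      = op_form (\<lambda>p. b (fst p, - snd p)) f g"
  proof -
    obtain C where C: "growth 0 0 C b" using b unfolding rapid_def tame_def by blast
    have nb: "norm (b p) \<le> C * (1 + norm q) powr 0" for p q :: "'b \<times> 'b"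
      using growth_le[OF C, of p] by (simp add: add_nonneg_eq_0_iff)
    have cb: "continuous_on UNIV (\<lambda>p :: 'b \<times> 'b. b (fst p, - snd p))"
      by (intro continuous_on_compose2[OF rapid_cont[OF b]] continuous_intros) simp
    have [measurable]: "f \<in> borel_measurable borel" "g \<in> borel_measurable borel" "ft f \<in> borel_measurable borel"
      using f g by (simp_all add: rapid_borel ft_measurable)
    have [measurable]: "b \<in> borel_measurable (borel \<Otimes>\<^sub>M borel)"
      using rapid_borel[OF b] by (simp add: borel_prod)
    let ?F = "\<lambda>x \<xi>. b (x, \<xi>) * (exp (- (\<i> * of_real (x \<bullet> \<xi>))) * (g x * ft f (- \<xi>)))"
    have dg: "decays (\<lambda>p :: 'b \<times> 'b. g (fst p) * ft f (- snd p))"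
    proof (rule decays_pair[where h = "\<lambda>\<xi>. ft f (- \<xi>)"])
      have "\<forall>M. \<exists>C. \<forall>x. norm (ft f (- x)) \<le> C * (1 + norm x) powr M"
        using ft_decay[OF f] by (metis norm_minus_cancel)
      then show "decays (\<lambda>\<xi>. ft f (- \<xi>))" by (simp add: decays_def)
    qed (rule rapid_decays[OF g])
    have "integrable lborel (\<lambda>p. (b p * exp (- (\<i> * of_real (fst p \<bullet> snd p)))) * (g (fst p) * ft f (- snd p)))"
      by (rule decays_integrable[OF dg, where C = C and M = 0])
        (use nb in \<open>auto simp: norm_mult intro!: continuous_on_mult rapid_cont[OF b] continuous_intros\<close>)
    then have "(LINT p|lborel. (b p * exp (- (\<i> * of_real (fst p \<bullet> snd p)))) * (g (fst p) * ft f (- snd p)))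
        = (LINT x|lborel. LINT \<xi>|lborel. (b (x, \<xi>) * exp (- (\<i> * of_real (x \<bullet> \<xi>)))) * (g x * ft f (- \<xi>)))"
      using lborel_integral_pair(1) by fastforce
    then have "(LINT p|lborel. b p * (exp (- (\<i> * of_real (fst p \<bullet> snd p))) * (g (fst p) * ft f (- snd p))))
        = (LINT x|lborel. LINT \<xi>|lborel. ?F x \<xi>)" by (simp only: mult.assoc)
    \<comment> \<open>Reflecting the covariable restores the plane wave and the argument of
      \<open>ft f\<close> and puts the minus sign into the symbol.\<close>
    also have "\<dots> = (LINT x|lborel. LINT \<xi>|lborel. ?F x (- \<xi>))"
    proof (rule Bochner_Integration.integral_cong[OF refl])
      have "?F x \<in> borel_measurable borel" for x by measurable
      then show "(LINT \<xi>|lborel. ?F x \<xi>) = (LINT \<xi>|lborel. ?F x (- \<xi>))" for x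
        by (rule integral_reflect[symmetric])
    qed
    also have "\<dots> = (LINT x|lborel. LINT \<xi>|lborel. (b (x, - \<xi>) * exp (\<i> * of_real (x \<bullet> \<xi>))) * (g x * ft f \<xi>))"
      by (simp add: mult.assoc)
    also have "\<dots> = op_form (\<lambda>p. b (fst p, - snd p)) f g"
      unfolding op_form_def
      using lborel_integral_pair(1)[OF op_form_integrable[OF f g nb cb]] by simp
    finally show ?thesis .
  qed
  finally show ?thesis using gauss_mass_nonzero[where 'b = 'b] by simp
qed

lemma norm_reg_le: "norm (reg n a p) \<le> norm (a p)"
  unfolding reg_def norm_mult by (intro mult_left_le_one_le norm_gauss_le norm_ge_zero)

lemma reg_tendsto: "(\<lambda>n. reg n a p) \<longlonglongrightarrow> a p"
proof -
  have "(\<lambda>n. inverse (real (Suc n)) *\<^sub>R p) \<longlonglongrightarrow> 0 *\<^sub>R p"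
    by (intro tendsto_scaleR LIMSEQ_inverse_real_of_nat tendsto_const)
  then have "(\<lambda>n. gauss (inverse (real (Suc n)) *\<^sub>R p)) \<longlonglongrightarrow> gauss 0"
    using continuous_on_tendsto_compose[OF continuous_gauss, of "\<lambda>n. inverse (real (Suc n)) *\<^sub>R p" 0 sequentially]
    by simp
  from tendsto_mult[OF this tendsto_const, of "a p"] show ?thesis by (simp add: reg_def)
qed

text \<open>Both sides pass to the limit of the cutoff by dominated convergence. On the left the
  cutoff only decreases the modulus of the amplitude. On the right \<open>Lam_bound\<close>, uniform
  bounds on \<open>reg n a\<close> and the polynomial cost of a translation give a majorant
  independent of \<open>n\<close>.\<close>

theorem op_form_transpose:
  fixes a :: "'b::euclidean_space \<times> 'b \<Rightarrow> complex"
  assumes a: "tame M a" and f: "rapid f" and g: "rapid g"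
  shows "op_form (\<lambda>p. a (fst p, - snd p)) f g = op_form (transp_symbol a) g f"
proof -
  have r: "rapid (reg n a)" for n by (rule rapid_reg[OF a])
  have cR: "continuous_on UNIV (\<lambda>p :: 'b \<times> 'b. u (fst p, - snd p))" if "continuous_on UNIV u" for u :: "'b \<times> 'b \<Rightarrow> complex"
    by (intro continuous_on_compose2[OF that] continuous_intros) simp
  have left: "(\<lambda>n. op_form (\<lambda>p. reg n a (fst p, - snd p)) f g) \<longlonglongrightarrow> op_form (\<lambda>p. a (fst p, - snd p)) f g"
  proof -
    obtain C where C: "growth 0 M C a" using a unfolding tame_def by blast
    have "norm (fst p, - snd p) = norm p" for p :: "'b \<times> 'b" by (simp add: norm_prod_def)
    then have "norm (reg n a (fst p, - snd p)) \<le> C * (1 + norm p) powr M" for n p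
      using order_trans[OF norm_reg_le[of n a "(fst p, - snd p)"] growth_le[OF C, of "(fst p, - snd p)"]] by simp
    then show ?thesis
      by (rule op_form_tendsto[OF f g]) (intro cR rapid_cont r reg_tendsto smooth_cont tame_smooth[OF a])+
  qed
  have right: "(\<lambda>n. op_form (transp_symbol (reg n a)) g f) \<longlonglongrightarrow> op_form (transp_symbol a) g f"
  proof -
    obtain k c where c: "0 \<le> c"
      "\<And>M' C b. tame M' b \<Longrightarrow> growth k M C (b :: 'b \<times> 'b \<Rightarrow> complex) \<Longrightarrow> norm (Lam b) \<le> c * C"
      by (rule Lam_bound[where M = M]) (rule that)
    obtain d where d: "0 \<le> d" "\<And>n M C b. growth k M C (b :: 'b \<times> 'b \<Rightarrow> complex) \<Longrightarrow> growth k M (d * C) (reg n b)"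
      by (rule growth_reg[where k = k]) (rule that)
    obtain C where C: "growth k M C a" using a unfolding tame_def by blast
    have bound: "norm (transp_symbol (reg n a) p) \<le> (c * (d * C)) * (1 + norm p) powr \<bar>M\<bar>" for n p
      using c(2)[OF tame_translate[OF rapid_tame[OF r[of n], of 0], of p] growth_translate[OF d(2)[OF C, of n], of p]]
      by (simp add: transp_symbol_def mult.assoc)
    \<comment> \<open>Here the order is \<open>M + 1\<close>, the price of the rate 1/(n+1) of the
      cutoff; after translation the rate depends polynomially on \<open>p\<close>.\<close>
    have lim: "(\<lambda>n. transp_symbol (reg n a) p) \<longlonglongrightarrow> transp_symbol a p" for p
    proof -
      obtain k c where c: "0 \<le> c"
        "\<And>M' C b. tame M' b \<Longrightarrow> growth k (M + 1) C (b :: 'b \<times> 'b \<Rightarrow> complex) \<Longrightarrow> norm (Lam b) \<le> c * C"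
        by (rule Lam_bound[where M = "M + 1"]) (rule that)
      obtain d where d: "0 \<le> d" "\<And>n M C b. growth k M C (b :: 'b \<times> 'b \<Rightarrow> complex) \<Longrightarrow>
          growth k (M + 1) (d * C * inverse (real (Suc n))) (\<lambda>p. b p - reg n b p)"
        by (rule growth_reg_diff[where k = k]) (rule that)
      obtain C where C: "growth k M C a" using a unfolding tame_def by blast
      define K where "K = c * (d * C * (1 + norm p) powr \<bar>M + 1\<bar>)"
      have "norm (transp_symbol (reg n a) p - transp_symbol a p) \<le> K * inverse (real (Suc n))" for n
      proof -
        note t = tame_translate[OF a] tame_translate[OF rapid_tame[OF r]]
        have "norm (Lam (\<lambda>x. a (p + x) - reg n a (p + x))) \<le> c * (d * C * inverse (real (Suc n)) * (1 + norm p) powr \<bar>M + 1\<bar>)"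
          by (rule c(2)[OF tame_diff[OF t] growth_translate[OF d(2)[OF C]]])
        also have "Lam (\<lambda>x. a (p + x) - reg n a (p + x)) = transp_symbol a p - transp_symbol (reg n a) p"
          by (simp only: Lam_diff[OF t] transp_symbol_def)
        finally show ?thesis
          by (simp add: norm_minus_commute K_def mult_ac)
      qed
      then have "\<forall>\<^sub>F n in sequentially. norm (transp_symbol (reg n a) p - transp_symbol a p) \<le> K * inverse (real (Suc n))"
        by simp
      from Lim_null_comparison[OF this tendsto_mult_right_zero[OF LIMSEQ_inverse_real_of_nat]]
      show ?thesis by (rule LIM_zero_cancel)
    qed
    show ?thesis
      by (rule op_form_tendsto[OF g f bound])
        (intro smooth_cont smooth_transp_symbol[OF rapid_tame[OF r, of 0]] smooth_transp_symbol[OF a] lim)+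
  qed
  from LIMSEQ_unique[OF left right[unfolded op_form_transpose_rapid[OF r f g, symmetric]]]
  show ?thesis .
qed

section \<open>Multi-indices\<close>

text \<open>The list is reversed because \<open>fold\<close> applies its first entry first, whereas
  \<open>foldr\<close> applies its last entry first.\<close>

definition mi_list :: "('d::finite \<Rightarrow> 'a) \<Rightarrow> ('d \<Rightarrow> nat) \<Rightarrow> 'a list" where
  "mi_list e \<alpha> = concat (map (\<lambda>i. replicate (\<alpha> i) (e i)) (rev index_list))"

lemma index_list: "distinct (index_list :: 'd::finite list)" "set (index_list :: 'd list) = UNIV"
proof -
  have "\<exists>is :: 'd list. distinct is \<and> set is = UNIV" using finite_distinct_list[of "UNIV :: 'd set"] by auto
  from someI_ex[OF this] show "distinct (index_list :: 'd list)" "set (index_list :: 'd list) = UNIV"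
    unfolding index_list_def by auto
qed

lemma mderiv_conv_foldr: "mderiv e \<alpha> f = foldr dderiv (mi_list e \<alpha>) f"
proof -
  have rep: "foldr dderiv (replicate n v) g = (dderiv v ^^ n) g" for n v and g :: "'a \<Rightarrow> complex"
    by (induction n) simp_all
  have "fold (\<lambda>i. dderiv (e i) ^^ \<alpha> i) xs f = foldr dderiv (concat (map (\<lambda>i. replicate (\<alpha> i) (e i)) (rev xs))) f" for xs
    by (induction xs rule: rev_induct) (simp_all add: rep)
  then show ?thesis by (simp add: mderiv_def mi_list_def)
qed

lemma sum_list_mi_list: 
  fixes h :: "'a \<Rightarrow> 'c::semiring_1"
  shows "sum_list (map h (mi_list e \<alpha>)) = (\<Sum>i\<in>UNIV. of_nat (\<alpha> i) * h (e i))"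
proof -
  have "sum_list (map h (concat (map (\<lambda>i. replicate (\<alpha> i) (e i)) xs))) = (\<Sum>i\<leftarrow>xs. of_nat (\<alpha> i) * h (e i))" for xs
    by (induction xs) (simp_all add: sum_list_replicate)
  then show ?thesis
    by (simp add: mi_list_def sum_list_distinct_conv_sum_set index_list)
qed

lemma mset_mi_list: "mset (mi_list e \<alpha>) = (\<Sum>i\<in>UNIV. replicate_mset (\<alpha> i) (e i))"
proof -
  have "mset (concat (map (\<lambda>i. replicate (\<alpha> i) (e i)) xs)) = (\<Sum>i\<leftarrow>xs. replicate_mset (\<alpha> i) (e i))" for xs
    by (induction xs) simp_all
  then show ?thesis
    by (simp add: mi_list_def sum_list_distinct_conv_sum_set index_list)
qed

lemma mi_list_zero [simp]: "mi_list e (\<lambda>_. 0) = []"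
  by (auto simp: mi_list_def)

lemma set_mi_list: "set (mi_list e \<alpha>) \<subseteq> range e"
  unfolding mi_list_def by (auto simp: set_replicate_conv_if split: if_splits)

lemma mset_mi_list_Suc: "mset (mi_list e (\<alpha>(i := Suc (\<alpha> i)))) = add_mset (e i) (mset (mi_list e \<alpha>))"
proof -
  have "(\<Sum>j\<in>UNIV - {i}. replicate_mset ((\<alpha>(i := Suc (\<alpha> i))) j) (e j)) = (\<Sum>j\<in>UNIV - {i}. replicate_mset (\<alpha> j) (e j))"
    by (intro sum.cong) auto
  then show ?thesis
    unfolding mset_mi_list by (simp add: sum.remove[of UNIV i])
qed

lemma mi_size_Suc: "mi_size (\<alpha>(i := Suc (\<alpha> i))) = Suc (mi_size \<alpha>)"
proof -
  have "(\<Sum>j\<in>UNIV - {i}. (\<alpha>(i := Suc (\<alpha> i))) j) = (\<Sum>j\<in>UNIV - {i}. \<alpha> j)" by (intro sum.cong) auto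
  then show ?thesis by (simp add: mi_size_def sum.remove[of UNIV i])
qed

lemma foldr_dderiv_smooth: "smooth f \<Longrightarrow> smooth (foldr dderiv vs f)"
  by (induction vs) (simp_all add: smooth_dderiv)

lemma foldr_dderiv_perm:
  assumes f: "smooth f" and perm: "mset vs = mset ws"
  shows "foldr dderiv vs f = foldr dderiv ws f"
proof -
  \<comment> \<open>\<open>dderiv\<close> commutes only on smooth functions, whereas
    \<open>fold_multiset_equiv\<close> asks for commuting operators outright. \<open>F\<close> is
    therefore the identity elsewhere.\<close>
  define F where "F v g = (if smooth g then dderiv v g else g)" for v and g :: "'a \<Rightarrow> complex"
  have F: "foldr F us f = foldr dderiv us f" for us
    by (induction us) (simp_all add: F_def foldr_dderiv_smooth[OF f])
  have "F u \<circ> F v = F v \<circ> F u" for u v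
    by (auto simp: F_def fun_eq_iff smooth_dderiv dderiv_commute_smooth)
  then have "fold F (rev vs) = fold F (rev ws)"
    using perm by (intro fold_multiset_equiv) auto
  then have "foldr F vs f = foldr F ws f" by (simp only: foldr_conv_fold)
  then show ?thesis by (simp only: F)
qed

lemma tame_foldrI:
  fixes f :: "'a::euclidean_space \<Rightarrow> complex"
  assumes "smooth f" "\<And>vs. set vs \<subseteq> Basis \<Longrightarrow> \<exists>C. \<forall>x. norm (foldr dderiv vs f x) \<le> C * (1 + norm x) powr M"
  shows "tame M f"
proof (rule tameI)
  fix n
  show "\<exists>C. growth n M C f" using assms
  proof (induction n arbitrary: f)
    case 0
    then show ?case using 0(2)[of "[]"] smooth_cont[OF 0(1)] by auto
  next
    case (Suc n)
    show ?case
    proof (rule ex_growth_SucI)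
      show "f differentiable at p" for p by (rule smooth_differentiable[OF Suc.prems(1)])
      show "\<exists>C. growth 0 M C f" using Suc.prems(2)[of "[]"] smooth_cont[OF Suc.prems(1)] by auto
      show "\<exists>C. growth n M C (dderiv v f)" if "v \<in> Basis" for v
      proof (rule Suc.IH[OF smooth_dderiv[OF Suc.prems(1)]])
        show "\<exists>C. \<forall>x. norm (foldr dderiv vs (dderiv v f) x) \<le> C * (1 + norm x) powr M" if "set vs \<subseteq> Basis" for vs
          using Suc.prems(2)[of "vs @ [v]"] that \<open>v \<in> Basis\<close> by simp
      qed
    qed
  qed
qed

lemma Basis_cart: "(Basis :: (real ^ 'd::finite) set) = range (\<lambda>i. axis i 1)"
  by (auto simp: Basis_vec_def)

lemma ex_mi_list:
  fixes vs :: "(real ^ 'd::finite) list"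
  shows "set vs \<subseteq> Basis \<Longrightarrow> \<exists>\<alpha>. mset vs = mset (mi_list (\<lambda>i. axis i 1) \<alpha>)"
proof (induction vs)
  case Nil
  show ?case by (rule exI[of _ "\<lambda>_. 0"]) (simp add: mset_mi_list)
next
  case (Cons v vs)
  then obtain \<alpha> i where "mset vs = mset (mi_list (\<lambda>i. axis i 1) \<alpha>)" "v = axis i 1" by (auto simp: Basis_cart)
  then have "mset (v # vs) = mset (mi_list (\<lambda>i. axis i 1) (\<alpha>(i := Suc (\<alpha> i))))"
    by (simp only: mset_mi_list_Suc mset.simps)
  then show ?case by blast
qed

lemma schwartz_rapid:
  fixes f :: "real ^ 'd::finite \<Rightarrow> complex"
  assumes f: "f \<in> schwartz"
  shows "rapid f"
  unfolding rapid_def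
proof
  fix M :: real
  have sm: "smooth f" and bd: "\<And>\<alpha> \<beta>. bounded (range (\<lambda>x. mi_power x \<alpha> *\<^sub>R mderiv (\<lambda>i. axis i 1) \<beta> f x))"
    using f by (auto simp: schwartz_def)
  define N where "N = nat \<lceil>- M\<rceil>"
  have N: "- M \<le> real N" unfolding N_def by linarith
  show "tame M f"
  proof (rule tame_foldrI[OF sm])
    fix vs :: "(real ^ 'd) list" assume "set vs \<subseteq> Basis"
    then obtain \<beta> where "mset vs = mset (mi_list (\<lambda>i. axis i 1) \<beta>)" using ex_mi_list by blast
    then have vs: "foldr dderiv vs f = mderiv (\<lambda>i. axis i 1) \<beta> f"
      unfolding mderiv_conv_foldr by (rule foldr_dderiv_perm[OF sm])
    define F where "F = mderiv (\<lambda>i. axis i 1) \<beta> f"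
    \<comment> \<open>Of the monomial bounds only pure powers of one coordinate enter, as
      \<open>moment_decay\<close> requires.\<close>
    have pow: "mi_power x (\<lambda>j. if j = i then N else 0) = (x $ i) ^ N" for x :: "real ^ 'd" and i
    proof -
      have "mi_power x (\<lambda>j. if j = i then N else 0) = (\<Prod>j\<in>UNIV. if j = i then (x $ j) ^ N else 1)"
        unfolding mi_power_def by (intro prod.cong) auto
      then show ?thesis by simp
    qed
    obtain C0 where C0: "\<And>x. norm (F x) \<le> C0"
    proof -
      have "mi_power x (\<lambda>_. 0) = 1" for x :: "real ^ 'd" by (simp add: mi_power_def)
      then show thesis using bd[of "\<lambda>_. 0" \<beta>] that unfolding F_def bounded_iff by auto
    qed
    have "\<exists>C. \<forall>x. \<bar>x \<bullet> v\<bar> ^ N * norm (F x) \<le> C" if v: "v \<in> Basis" for v :: "real ^ 'd"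
    proof -
      obtain i where i: "v = axis i 1" using v by (auto simp: Basis_cart)
      show ?thesis
        using bd[of "\<lambda>j. if j = i then N else 0" \<beta>]
        unfolding F_def bounded_iff by (simp add: pow i inner_axis power_abs)
    qed
    then obtain C where "\<And>v x. v \<in> Basis \<Longrightarrow> \<bar>x \<bullet> v\<bar> ^ N * norm (F x) \<le> C v" by metis
    then show "\<exists>C. \<forall>x. norm (foldr dderiv vs f x) \<le> C * (1 + norm x) powr M"
      unfolding vs F_def[symmetric] by (rule moment_decay[OF N C0])
  qed
qed

section \<open>Identification of \<open>symbol_V\<close> with \<open>symb\<close>, and reflection of
  the covariable\<close>

definition phase_list :: "('d::finite \<Rightarrow> nat) \<Rightarrow> ('d \<Rightarrow> nat) \<Rightarrow> ((real ^ 'd) \<times> (real ^ 'd)) list" where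
  "phase_list \<alpha> \<beta> = mi_list (\<lambda>i. (axis i 1, 0)) \<alpha> @ mi_list (\<lambda>i. (0, axis i 1)) \<beta>"

lemma Dx_Dxi_conv_foldr: "Dx \<alpha> (Dxi \<beta> \<sigma>) = foldr dderiv (phase_list \<alpha> \<beta>) \<sigma>"
  by (simp add: Dx_def Dxi_def mderiv_conv_foldr phase_list_def)

lemma xi_deg_phase_list: "(\<Sum>v\<leftarrow>phase_list \<alpha> \<beta>. xi_deg v) = real (mi_size \<beta>)"
  by (simp add: phase_list_def sum_list_mi_list xi_deg_def mi_size_def)

lemma set_phase_list: "set (phase_list \<alpha> \<beta>) \<subseteq> Basis"
proof -
  have "set (phase_list \<alpha> \<beta>) \<subseteq> range (\<lambda>i. (axis i 1, 0)) \<union> range (\<lambda>i. (0, axis i 1))"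
    unfolding phase_list_def using set_mi_list by fastforce
  also have "\<dots> \<subseteq> Basis" by (auto simp: Basis_prod_def Basis_cart)
  finally show ?thesis .
qed

lemma ex_phase_list:
  fixes vs :: "((real ^ 'd::finite) \<times> (real ^ 'd)) list"
  shows "set vs \<subseteq> Basis \<Longrightarrow> \<exists>\<alpha> \<beta>. mset vs = mset (phase_list \<alpha> \<beta>)"
proof (induction vs)
  case Nil
  show ?case by (rule exI[of _ "\<lambda>_. 0"], rule exI[of _ "\<lambda>_. 0"]) (simp add: phase_list_def mset_mi_list)
next
  case (Cons v vs)
  then obtain \<alpha> \<beta> where ab: "mset vs = mset (phase_list \<alpha> \<beta>)" by auto
  from Cons.prems consider i where "v = (axis i 1, 0)" | i where "v = (0, axis i 1)"
    by (auto simp: Basis_prod_def Basis_cart)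
  then show ?case
  proof cases
    case 1
    have "mset (v # vs) = mset (phase_list (\<alpha>(i := Suc (\<alpha> i))) \<beta>)"
      using ab by (simp add: phase_list_def mset_mi_list_Suc 1)
    then show ?thesis by blast
  next
    case 2
    have "mset (v # vs) = mset (phase_list \<alpha> (\<beta>(i := Suc (\<beta> i))))"
      using ab by (simp add: phase_list_def mset_mi_list_Suc 2)
    then show ?thesis by blast
  qed
qed

text \<open>From left to right, \<open>K\<close> majorises the normalised derivative and forces its
  limit. From right to left, the normalised derivative itself is taken as \<open>K\<close>, bounded
  by \<open>vanishing_bounded\<close>. \<open>foldr_dderiv_perm\<close> reduces an arbitrary order
  of differentiation to the one in \<open>Dx\<close> and \<open>Dxi\<close>.\<close>

lemma symbol_V_iff_symb: "\<sigma> \<in> symbol_V s \<longleftrightarrow> symb s \<sigma>"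
proof
  assume \<sigma>: "\<sigma> \<in> symbol_V s"
  then have sm: "smooth \<sigma>" by (simp add: symbol_V_def)
  have "vanishing (s - (\<Sum>v\<leftarrow>vs. xi_deg v)) (foldr dderiv vs \<sigma>)" if vs: "set vs \<subseteq> Basis" for vs
  proof -
    obtain \<alpha> \<beta> where ab: "mset vs = mset (phase_list \<alpha> \<beta>)" using ex_phase_list[OF vs] by blast
    have D: "foldr dderiv vs \<sigma> = Dx \<alpha> (Dxi \<beta> \<sigma>)"
      unfolding Dx_Dxi_conv_foldr by (rule foldr_dderiv_perm[OF sm ab])
    have "(\<Sum>v\<leftarrow>vs. xi_deg v) = (\<Sum>v\<leftarrow>phase_list \<alpha> \<beta>. xi_deg v)"
      using ab by (metis mset_map sum_mset_sum_list)
    then have deg: "(\<Sum>v\<leftarrow>vs. xi_deg v) = real (mi_size \<beta>)" by (simp only: xi_deg_phase_list)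
    obtain K where K: "(K \<longlongrightarrow> 0) at_infinity"
      "\<And>x \<xi>. norm (Dx \<alpha> (Dxi \<beta> \<sigma>) (x, \<xi>)) \<le> K (x, \<xi>) * (1 + norm \<xi>) powr (s - real (mi_size \<beta>))"
      using \<sigma> unfolding symbol_V_def by blast
    show ?thesis
      unfolding vanishing_def D deg
    proof (rule Lim_null_comparison[OF always_eventually K(1)], rule allI)
      fix p :: "(real ^ 'a) \<times> (real ^ 'a)"
      obtain x \<xi> where p: "p = (x, \<xi>)" by (cases p)
      have pos: "(1 + norm \<xi>) powr (s - real (mi_size \<beta>)) > 0" by (simp add: add_nonneg_eq_0_iff)
      show "norm (norm (Dx \<alpha> (Dxi \<beta> \<sigma>) p) * (1 + norm (snd p)) powr - (s - real (mi_size \<beta>))) \<le> K p"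
        using K(2)[of x \<xi>] pos unfolding powr_minus p by (simp add: field_simps)
    qed
  qed
  then show "symb s \<sigma>" using sm by (simp add: symb_def)
next
  assume \<sigma>: "symb s \<sigma>"
  have "\<exists>K. bounded (range K) \<and> (K \<longlongrightarrow> 0) at_infinity \<and>
     (\<forall>x \<xi>. norm (Dx \<alpha> (Dxi \<beta> \<sigma>) (x, \<xi>)) \<le> K (x, \<xi>) * (1 + norm \<xi>) powr (s - real (mi_size \<beta>)))" for \<alpha> \<beta>
  proof -
    let ?u = "foldr dderiv (phase_list \<alpha> \<beta>) \<sigma>" and ?m = "s - real (mi_size \<beta>)"
    define K where "K p = norm (?u p) * (1 + norm (snd p)) powr (- ?m)" for p
    have van: "vanishing ?m ?u"
      using \<sigma> set_phase_list[of \<alpha> \<beta>] unfolding symb_def by (metis xi_deg_phase_list)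
    obtain C where C: "0 \<le> C" "\<And>p. norm (?u p) \<le> C * (1 + norm (snd p)) powr ?m"
      by (rule vanishing_bounded[OF van smooth_cont[OF foldr_dderiv_smooth[OF symb_smooth[OF \<sigma>]]]]) (rule that)
    have pos: "(1 + norm x) powr ?m > 0" for x :: "real ^ 'a" by (simp add: add_nonneg_eq_0_iff)
    have "norm (K p) \<le> C" for p
      using C(2)[of p] pos[of "snd p"] unfolding K_def powr_minus by (simp add: field_simps)
    then have "bounded (range K)" unfolding bounded_iff by blast
    moreover have "(K \<longlongrightarrow> 0) at_infinity" using van unfolding vanishing_def K_def .
    moreover have "norm (Dx \<alpha> (Dxi \<beta> \<sigma>) (x, \<xi>)) \<le> K (x, \<xi>) * (1 + norm \<xi>) powr ?m" for x \<xi>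
      using pos[of \<xi>] unfolding Dx_Dxi_conv_foldr K_def powr_minus by (simp add: field_simps)
    ultimately show ?thesis by blast
  qed
  then show "\<sigma> \<in> symbol_V s" using symb_smooth[OF \<sigma>] by (simp add: symbol_V_def)
qed

text \<open>Every basis derivative of the reflected function is plus or minus the reflected
  derivative, and reflection changes neither \<open>norm p\<close> nor \<open>norm (snd p)\<close>.
  The accumulated sign is kept as a factor \<open>c\<close> of modulus 1.\<close>

lemma symb_reflect:
  fixes \<sigma> :: "'b::euclidean_space \<times> 'b \<Rightarrow> complex"
  assumes \<sigma>: "symb s \<sigma>"
  shows "symb s (\<lambda>p. \<sigma> (fst p, - snd p))"
proof -
  define R where "R p = (fst p, - snd p)" for p :: "'b \<times> 'b"
  have R: "bounded_linear R"
    unfolding R_def[abs_def]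
    by (intro bounded_linear_Pair bounded_linear_fst bounded_linear_minus bounded_linear_snd)
  have smR: "smooth (\<lambda>p. u (R p))" if "smooth u" for u :: "'b \<times> 'b \<Rightarrow> complex"
    using smooth_affine_comp[OF R that, of 0] by simp
  have D: "\<exists>c. norm c = 1 \<and> dderiv v (\<lambda>p. u (R p)) = (\<lambda>p. c * dderiv v u (R p))"
    if "v \<in> Basis" "smooth u" for v and u :: "'b \<times> 'b \<Rightarrow> complex"
  proof -
    have Dv: "dderiv v (\<lambda>p. u (R p)) = (\<lambda>p. dderiv (R v) u (R p))"
      using dderiv_affine_comp[OF R smooth_differentiable[OF that(2)], of v 0] by simp
    have "dderiv (- v) u p = - dderiv v u p" for p
      using linear_simps(4)[OF has_derivative_bounded_linear[OF has_derivative_dderiv[OF smooth_differentiable[OF that(2)]]]] .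
    moreover have "R v = v \<or> R v = - v" using that(1) by (auto simp: R_def Basis_prod_def)
    ultimately consider "dderiv v (\<lambda>p. u (R p)) = (\<lambda>p. 1 * dderiv v u (R p))"
      | "dderiv v (\<lambda>p. u (R p)) = (\<lambda>p. (- 1) * dderiv v u (R p))"
      using Dv by fastforce
    then show ?thesis
    proof cases
      case 1
      show ?thesis by (rule exI[of _ 1]) (use 1 in simp)
    next
      case 2
      show ?thesis by (rule exI[of _ "-1"]) (use 2 in simp)
    qed
  qed
  have fold: "\<exists>c. norm c = 1 \<and> foldr dderiv vs (\<lambda>p. \<sigma> (R p)) = (\<lambda>p. c * foldr dderiv vs \<sigma> (R p))"
    if "set vs \<subseteq> Basis" for vs
    using that
  proof (induction vs)
    case Nil
    show ?case by (rule exI[of _ 1]) simp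
  next
    case (Cons v vs)
    then obtain c where c: "norm c = 1" "foldr dderiv vs (\<lambda>p. \<sigma> (R p)) = (\<lambda>p. c * foldr dderiv vs \<sigma> (R p))" by auto
    have sm: "smooth (foldr dderiv vs \<sigma>)" by (rule foldr_dderiv_smooth[OF symb_smooth[OF \<sigma>]])
    obtain d where d: "norm d = 1" "dderiv v (\<lambda>p. foldr dderiv vs \<sigma> (R p)) = (\<lambda>p. d * dderiv v (foldr dderiv vs \<sigma>) (R p))"
      using D[of v "foldr dderiv vs \<sigma>"] Cons.prems sm by auto
    have "foldr dderiv (v # vs) (\<lambda>p. \<sigma> (R p)) = (\<lambda>p. (c * d) * foldr dderiv (v # vs) \<sigma> (R p))"
      using dderiv_cmult[OF smooth_differentiable[OF smR[OF sm]], of v c] by (simp add: c(2) d(2) mult.assoc)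
    then show ?case using c(1) d(1) by (intro exI[of _ "c * d"]) (simp add: norm_mult)
  qed
  have "vanishing (s - (\<Sum>v\<leftarrow>vs. xi_deg v)) (foldr dderiv vs (\<lambda>p. \<sigma> (R p)))" if vs: "set vs \<subseteq> Basis" for vs
    unfolding vanishing_eps
  proof (intro allI impI)
    let ?m = "s - (\<Sum>v\<leftarrow>vs. xi_deg v)"
    fix e :: real assume e: "0 < e"
    have "vanishing ?m (foldr dderiv vs \<sigma>)" using \<sigma> vs by (simp add: symb_def)
    then obtain r where r: "\<And>p. r \<le> norm p \<Longrightarrow> norm (foldr dderiv vs \<sigma> p) \<le> e * (1 + norm (snd p)) powr ?m"
      using e unfolding vanishing_eps eventually_at_infinity by blast
    obtain c where c: "norm c = 1" "foldr dderiv vs (\<lambda>p. \<sigma> (R p)) = (\<lambda>p. c * foldr dderiv vs \<sigma> (R p))"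
      using fold[OF vs] by blast
    have "norm (foldr dderiv vs (\<lambda>p. \<sigma> (R p)) p) \<le> e * (1 + norm (snd p)) powr ?m" if "r \<le> norm p" for p
    proof -
      have "norm (R p) = norm p" "norm (snd (R p)) = norm (snd p)" by (simp_all add: R_def norm_prod_def)
      then show ?thesis using r[of "R p"] that unfolding c(2) by (simp add: c(1) norm_mult)
    qed
    then show "\<forall>\<^sub>F p in at_infinity. norm (foldr dderiv vs (\<lambda>p. \<sigma> (R p)) p) \<le> e * (1 + norm (snd p)) powr ?m"
      unfolding eventually_at_infinity by blast
  qed
  then show ?thesis using smR[OF symb_smooth[OF \<sigma>]] unfolding R_def symb_def by blast
qed

section \<open>The expansion in terms of multi-indices\<close>

lemma Dx_Dxi_Suc:
  fixes b :: "(real ^ 'd::finite) \<times> (real ^ 'd) \<Rightarrow> complex"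
  assumes b: "smooth b"
  shows "Dx \<alpha> (Dxi \<alpha> (dderiv (axis i 1, 0) (dderiv (0, axis i 1) b)))
    = Dx (\<alpha>(i := Suc (\<alpha> i))) (Dxi (\<alpha>(i := Suc (\<alpha> i))) b)"
proof -
  have "foldr dderiv (phase_list \<alpha> \<alpha> @ [(axis i 1, 0), (0, axis i 1)]) b
      = foldr dderiv (phase_list (\<alpha>(i := Suc (\<alpha> i))) (\<alpha>(i := Suc (\<alpha> i)))) b"
    by (rule foldr_dderiv_perm[OF b]) (simp add: phase_list_def mset_mi_list_Suc)
  then show ?thesis unfolding Dx_Dxi_conv_foldr by simp
qed

lemma mi_fact_Suc: "mi_fact (\<alpha>(i := Suc (\<alpha> i))) = Suc (\<alpha> i) * mi_fact \<alpha>"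
proof -
  have "(\<Prod>j\<in>UNIV - {i}. fact ((\<alpha>(i := Suc (\<alpha> i))) j)) = (\<Prod>j\<in>UNIV - {i}. fact (\<alpha> j) :: nat)"
    by (intro prod.cong) auto
  then show ?thesis unfolding mi_fact_def by (simp add: prod.remove[of UNIV i] algebra_simps)
qed

lemma finite_mi_size_eq: "finite {\<alpha> :: 'd::finite \<Rightarrow> nat. mi_size \<alpha> = k}"
  by (rule finite_subset[OF _ finite_mi_size_less[of "Suc k"]]) auto

text \<open>A multi-index \<beta> of size k + 1 arises by raising entry \<open>i\<close> exactly
  when its \<open>i\<close>-th entry is positive, and the lowered index has reciprocal factorial
  \<open>\<beta> i\<close> / \<open>mi_fact \<beta>\<close>. Where \<open>\<beta> i = 0\<close> the
  weight vanishes, so the sum extends to all \<beta>; summing the weights over \<open>i\<close>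
  gives k + 1.\<close>

lemma multinomial_step:
  fixes G :: "('d::finite \<Rightarrow> nat) \<Rightarrow> complex"
  shows "(\<Sum>i\<in>UNIV. \<Sum>\<alpha> | mi_size \<alpha> = k. G (\<alpha>(i := Suc (\<alpha> i))) / of_nat (mi_fact \<alpha>))
    = of_nat (Suc k) * (\<Sum>\<beta> | mi_size \<beta> = Suc k. G \<beta> / of_nat (mi_fact \<beta>))"
proof -
  have "(\<Sum>\<alpha> | mi_size \<alpha> = k. G (\<alpha>(i := Suc (\<alpha> i))) / of_nat (mi_fact \<alpha>))
      = (\<Sum>\<beta> | mi_size \<beta> = Suc k. of_nat (\<beta> i) * (G \<beta> / of_nat (mi_fact \<beta>)))" (is "?L = ?R") for i
  proof -
    have "?L = (\<Sum>\<beta> | mi_size \<beta> = Suc k \<and> \<beta> i \<noteq> 0. of_nat (\<beta> i) * (G \<beta> / of_nat (mi_fact \<beta>)))"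
    proof (rule sum.reindex_bij_witness[where i = "\<lambda>\<beta>. \<beta>(i := \<beta> i - 1)" and j = "\<lambda>\<alpha>. \<alpha>(i := Suc (\<alpha> i))"])
      fix \<beta> :: "'d \<Rightarrow> nat" assume \<beta>: "\<beta> \<in> {\<beta>. mi_size \<beta> = Suc k \<and> \<beta> i \<noteq> 0}"
      then have eq: "(\<beta>(i := \<beta> i - 1))(i := Suc ((\<beta>(i := \<beta> i - 1)) i)) = \<beta>" by auto
      then show "(\<beta>(i := \<beta> i - 1))(i := Suc ((\<beta>(i := \<beta> i - 1)) i)) = \<beta>" .
      have "Suc (mi_size (\<beta>(i := \<beta> i - 1))) = mi_size \<beta>"
        using mi_size_Suc[of "\<beta>(i := \<beta> i - 1)" i] unfolding eq by simp
      then show "\<beta>(i := \<beta> i - 1) \<in> {\<alpha>. mi_size \<alpha> = k}" using \<beta> by simp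
    next
      fix \<alpha> :: "'d \<Rightarrow> nat" assume \<alpha>: "\<alpha> \<in> {\<alpha>. mi_size \<alpha> = k}"
      show "(\<alpha>(i := Suc (\<alpha> i)))(i := (\<alpha>(i := Suc (\<alpha> i))) i - 1) = \<alpha>" by auto
      show "\<alpha>(i := Suc (\<alpha> i)) \<in> {\<beta>. mi_size \<beta> = Suc k \<and> \<beta> i \<noteq> 0}" using \<alpha> by (simp add: mi_size_Suc)
      show "of_nat ((\<alpha>(i := Suc (\<alpha> i))) i) * (G (\<alpha>(i := Suc (\<alpha> i))) / of_nat (mi_fact (\<alpha>(i := Suc (\<alpha> i)))))
          = G (\<alpha>(i := Suc (\<alpha> i))) / of_nat (mi_fact \<alpha>)"
        unfolding mi_fact_Suc of_nat_mult by (simp del: of_nat_Suc)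
    qed
    also have "\<dots> = ?R"
      by (rule sum.mono_neutral_left) (auto intro: finite_mi_size_eq)
    finally show ?thesis .
  qed
  then have "(\<Sum>i\<in>UNIV. \<Sum>\<alpha> | mi_size \<alpha> = k. G (\<alpha>(i := Suc (\<alpha> i))) / of_nat (mi_fact \<alpha>))
    = (\<Sum>i\<in>UNIV. \<Sum>\<beta> | mi_size \<beta> = Suc k. of_nat (\<beta> i) * (G \<beta> / of_nat (mi_fact \<beta>)))" by simp
  also have "\<dots> = (\<Sum>\<beta> | mi_size \<beta> = Suc k. \<Sum>i\<in>UNIV. of_nat (\<beta> i) * (G \<beta> / of_nat (mi_fact \<beta>)))"
    by (rule sum.swap)
  also have "\<dots> = (\<Sum>\<beta> | mi_size \<beta> = Suc k. of_nat (mi_size \<beta>) * (G \<beta> / of_nat (mi_fact \<beta>)))"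
    unfolding mi_size_def of_nat_sum sum_distrib_right ..
  also have "\<dots> = of_nat (Suc k) * (\<Sum>\<beta> | mi_size \<beta> = Suc k. G \<beta> / of_nat (mi_fact \<beta>))"
    unfolding sum_distrib_left by (intro sum.cong) auto
  finally show ?thesis .
qed

text \<open>The normalising factor in the recursion of \<open>expansion_term\<close> cancels the
  factor \<open>Suc k\<close> from \<open>multinomial_step\<close>.\<close>

lemma expansion_term_multi_index:
  fixes b :: "(real ^ 'd::finite) \<times> (real ^ 'd) \<Rightarrow> complex"
  shows "smooth b \<Longrightarrow> expansion_term k b p =
    (\<Sum>\<alpha> | mi_size \<alpha> = k. (- \<i>) ^ k / of_nat (mi_fact \<alpha>) * Dx \<alpha> (Dxi \<alpha> b) p)"
proof (induction k arbitrary: b)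
  case 0
  have "{\<alpha> :: 'd \<Rightarrow> nat. mi_size \<alpha> = 0} = {\<lambda>_. 0}" by (auto simp: mi_size_def fun_eq_iff)
  moreover have "Dx (\<lambda>_. 0) (Dxi (\<lambda>_. 0) b) = b"
    by (simp add: Dx_Dxi_conv_foldr phase_list_def mi_list_zero)
  ultimately show ?case by (simp add: mi_fact_def)
next
  case (Suc k)
  let ?b = "\<lambda>i :: 'd. dderiv (axis i 1, 0) (dderiv (0, axis i 1) b)"
  have inj: "inj (\<lambda>i :: 'd. axis i (1 :: real))" by (auto simp: inj_on_def axis_eq_axis)
  have "expansion_term (Suc k) b p = of_real (inverse (real (Suc k))) * (\<Sum>i\<in>UNIV. - \<i> * expansion_term k (?b i) p)"
    unfolding expansion_term.simps Basis_cart sum.reindex[OF inj] by simp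
  also have "(\<Sum>i\<in>UNIV. - \<i> * expansion_term k (?b i) p)
      = (\<Sum>i\<in>UNIV. - \<i> * (\<Sum>\<alpha> | mi_size \<alpha> = k. (- \<i>) ^ k / of_nat (mi_fact \<alpha>) * Dx \<alpha> (Dxi \<alpha> (?b i)) p))"
    by (intro sum.cong refl arg_cong[where f = "(*) (- \<i>)"] Suc.IH smooth_dderiv Suc.prems)
  also have "\<dots> = (\<Sum>i\<in>UNIV. \<Sum>\<alpha> | mi_size \<alpha> = k.
      ((- \<i>) ^ Suc k * Dx (\<alpha>(i := Suc (\<alpha> i))) (Dxi (\<alpha>(i := Suc (\<alpha> i))) b) p) / of_nat (mi_fact \<alpha>))"
    unfolding sum_distrib_left Dx_Dxi_Suc[OF Suc.prems] by (simp add: mult.assoc)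
  also have "\<dots> = of_nat (Suc k) * (\<Sum>\<beta> | mi_size \<beta> = Suc k. ((- \<i>) ^ Suc k * Dx \<beta> (Dxi \<beta> b) p) / of_nat (mi_fact \<beta>))"
    by (rule multinomial_step)
  finally have "expansion_term (Suc k) b p = (\<Sum>\<beta> | mi_size \<beta> = Suc k. ((- \<i>) ^ Suc k * Dx \<beta> (Dxi \<beta> b) p) / of_nat (mi_fact \<beta>))"
    by (simp del: of_nat_Suc power_Suc)
  then show ?case by (simp del: power_Suc)
qed

lemma sum_expansion_term:
  fixes b :: "(real ^ 'd::finite) \<times> (real ^ 'd) \<Rightarrow> complex"
  assumes b: "smooth b"
  shows "(\<Sum>k<N. expansion_term k b p) =
    (\<Sum>\<alpha> | mi_size \<alpha> < N. \<i> powi (- int (mi_size \<alpha>)) / of_nat (mi_fact \<alpha>) * Dx \<alpha> (Dxi \<alpha> b) p)"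
proof -
  have pw: "\<i> powi (- int n) = (- \<i>) ^ n" for n
    by (simp add: power_int_minus power_int_of_nat flip: power_inverse)
  have "(\<Sum>\<alpha> | mi_size \<alpha> < N. \<i> powi (- int (mi_size \<alpha>)) / of_nat (mi_fact \<alpha>) * Dx \<alpha> (Dxi \<alpha> b) p)
    = (\<Sum>k<N. \<Sum>\<alpha> | \<alpha> \<in> {\<alpha>. mi_size \<alpha> < N} \<and> mi_size \<alpha> = k. \<i> powi (- int (mi_size \<alpha>)) / of_nat (mi_fact \<alpha>) * Dx \<alpha> (Dxi \<alpha> b) p)"
    by (rule sum.group[symmetric]) (auto simp: finite_mi_size_less)
  also have "\<dots> = (\<Sum>k<N. expansion_term k b p)"
    unfolding expansion_term_multi_index[OF b] by (intro sum.cong) (auto simp: pw)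
  finally show ?thesis ..
qed

section \<open>From the phase-space form back to the operators\<close>

lemma fourier_conv_ft: "fourier = ft"
  by (simp add: fun_eq_iff fourier_def ft_def)

lemma pairing_pseudo_op:
  fixes \<sigma> :: "(real ^ 'd::finite) \<times> (real ^ 'd) \<Rightarrow> complex"
  assumes "symb s \<sigma>" "rapid f" "rapid g"
  shows "pairing (pseudo_op \<sigma> f) g = op_form \<sigma> f g"
proof -
  obtain C where C: "growth 0 \<bar>s\<bar> C \<sigma>" using symb_tame[OF assms(1)] unfolding tame_def by blast
  show ?thesis
    unfolding op_form_iterated[OF assms(2,3) growth_le[OF C] growth_cont[OF C]]
    by (simp add: pairing_def pseudo_op_def fourier_conv_ft)
qed

theorem theorem2p1:
  fixes s :: real and \<sigma> :: "(real ^ 'd::finite) \<times> (real ^ 'd) \<Rightarrow> complex"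
  assumes "\<sigma> \<in> symbol_V s"
  shows "\<exists>\<sigma>' \<in> symbol_V s.
           is_transpose (pseudo_op \<sigma>) (pseudo_op \<sigma>') \<and>
           (\<forall>N::nat.
              (\<lambda>(x, \<xi>). \<sigma>' (x, \<xi>) -
                 (\<Sum>\<alpha> | mi_size \<alpha> < N.
                    \<i> powi (- int (mi_size \<alpha>)) / of_nat (mi_fact \<alpha>) *
                    Dx \<alpha> (Dxi \<alpha> (\<lambda>(y, \<eta>). \<sigma> (y, - \<eta>))) (x, \<xi>)))
              \<in> symbol_V (s - real N))"
proof -
  define a where "a = (\<lambda>p. \<sigma> (fst p, - snd p))"
  have a_eq: "(\<lambda>(y, \<eta>). \<sigma> (y, - \<eta>)) = a" by (simp add: a_def split_beta')
  have s: "symb s \<sigma>" using assms by (simp add: symbol_V_iff_symb)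
  have a: "symb s a" unfolding a_def by (rule symb_reflect[OF s])
  have exp: "symb (s - real N) (\<lambda>q. transp_symbol a q - (\<Sum>k<N. expansion_term k a q))" for N
    by (rule transp_symbol_expansion[OF a])
  \<comment> \<open>With \<open>N = 0\<close> the sum is empty, so membership of the transposed
    symbol in the class is a case of the expansion.\<close>
  have T: "symb s (transp_symbol a)" using exp[of 0] by simp
  have "is_transpose (pseudo_op \<sigma>) (pseudo_op (transp_symbol a))"
    unfolding is_transpose_def
  proof (intro ballI)
    fix f g :: "real ^ 'd \<Rightarrow> complex" assume "f \<in> schwartz" "g \<in> schwartz"
    then have f: "rapid f" and g: "rapid g" by (simp_all add: schwartz_rapid)
    have "pairing (pseudo_op \<sigma> f) g = op_form (\<lambda>p. a (fst p, - snd p)) f g"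
      using pairing_pseudo_op[OF s f g] by (simp add: a_def)
    also have "\<dots> = op_form (transp_symbol a) g f"
      by (rule op_form_transpose[OF symb_tame[OF a] f g])
    also have "\<dots> = pairing (pseudo_op (transp_symbol a) g) f"
      by (rule pairing_pseudo_op[OF T g f, symmetric])
    finally show "pairing (pseudo_op \<sigma> f) g = pairing f (pseudo_op (transp_symbol a) g)"
      by (simp add: pairing_def mult.commute)
  qed
  moreover have "(\<lambda>(x, \<xi>). transp_symbol a (x, \<xi>) -
      (\<Sum>\<alpha> | mi_size \<alpha> < N. \<i> powi (- int (mi_size \<alpha>)) / of_nat (mi_fact \<alpha>) * Dx \<alpha> (Dxi \<alpha> a) (x, \<xi>)))
      \<in> symbol_V (s - real N)" for N
    using exp[of N] unfolding symbol_V_iff_symb sum_expansion_term[OF symb_smooth[OF a]]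
    by (simp add: split_beta')
  ultimately show ?thesis
    unfolding a_eq using T by (intro bexI[of _ "transp_symbol a"]) (simp_all add: symbol_V_iff_symb)
qed

end
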